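(* Let $\alpha\in(0,1)$, $r\in\{0,\dots,d-1\}$ ($r\ge1$ in the spectral gap case), $\beta\in(0,1)$, $L>0$, and let $\varepsilon_n\ge0$, $\underline\lambda_{r,n}>0$ vary arbitrarily with $n$. Let $\hbar_n\in(0,1)$ satisfy $n\hbar_n\to\infty$. Given $n$ observations, there are tests $\varphi_{\alpha,n}$ that have uniform level $\alpha$ over the null hypothesis and are uniformly consistent (i.e. the infimum over the alternative of the rejection probability tends to one) for $n\to\infty$, in each of the following two testing problems, for some suitably large constant $C>0$ not depending on $n$: (i) $\mathcal H_0(r,\beta,L,\varepsilon_n)$ versus $\mathcal H_1(r,\hbar_n,v_n)$ with $v_n=C(Ln^{-\beta}+\varepsilon_n)$; (ii) $\mathcal H_0^{gap}(r,\beta,L,\varepsilon_n,\underline\lambda_{r,n})$ versus $\mathcal H_1(r,\hbar_n,v_n)$ with $v_n=C\big((Ln^{-\beta}+\varepsilon_n)\wedge(\underline\lambda_{r,n}^{-1}L^2n^{-2\beta}+\varepsilon_n)\big)$.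
   Context: Notation: $\mathbb R^{d\times d}_{spd}$ is the set of symmetric positive semi-definite matrices, $\lambda_1(S)\ge\dots\ge\lambda_d(S)$ are the ordered eigenvalues of a symmetric matrix, $\|\cdot\|$ is the spectral norm, $\|S\|_{L^p}=(\int_0^1\|S(t)\|^pdt)^{1/p}$, $a\wedge b=\min(a,b)$. Model: one observes $Y(i/n)$, $i=0,\dots,n$, where $dY(t)=dX(t)+dZ(t)$, $dX(t)=\sigma_X(t)dB(t)$, $dZ(t)=\sigma_Z(t)dB_Z(t)$, $t\in[0,1]$, with independent ($m$- and $d$-dimensional) standard Brownian motions $B,B_Z$ and deterministic coefficients; $\Sigma_X=\sigma_X\sigma_X^\top$, $\Sigma_Z=\sigma_Z\sigma_Z^\top$, $\Sigma_Y=\Sigma_X+\Sigma_Z$. Tests are measurable functions of the observations. Besov seminorm: $\omega_p(S,h)=\sup_{s\in[0,h]}(\int_0^{1-s}\|S(t+s)-S(t)\|^pdt)^{1/p}$ and $|S|_{B^\beta_{p,\infty}}=\sup_{0<h\le1}h^{-\beta}\omega_p(S,h)$. $\mathcal H_0(r,\beta,L,\varepsilon)$ is the set of $(\Sigma_X,\Sigma_Z)$ with $\sup_{t\in[0,1]}\operatorname{rank}(\Sigma_X(t))\le r$, $|\Sigma_X|_{B^\beta_{2,\infty}}\le L$, $\|\Sigma_Z\|_{L^2}\le\varepsilon$. $\mathcal H_0^{gap}(r,\beta,L,\varepsilon,\underline\lambda_r)$ is the set of $(\Sigma_X,\Sigma_Z)$ with $\sup_t\operatorname{rank}(\Sigma_X(t))\le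 r$, $\inf_t\lambda_r(\Sigma_X(t))\ge\underline\lambda_r$, $|\Sigma_X|_{B^\beta_{4,\infty}}\le L$, $\|\Sigma_Z\|_{L^2}\le\varepsilon$. $\mathcal H_1(r,\hbar,v)$ is the set of $\Sigma_X\in C([0,1];\mathbb R^{d\times d}_{spd})$ with $\sup_{|I|\ge\hbar}|I|\min_{t\in I}\lambda_{r+1}(\Sigma_X(t))\ge v$, the supremum being over intervals $I\subset[0,1]$ of length $|I|\ge\hbar$; under the alternative $\Sigma_Z$ is arbitrary (zero or non-zero). *)

theory Defs
  imports "HOL-Probability.Probability" "HOL-Library.Multiset"
begin

section \<open>Symmetric matrices\<close>

definition psd :: "real^'d^'d \<Rightarrow> bool" where
  "psd S \<longleftrightarrow> transpose S = S \<and> (\<forall>x. 0 \<le> x \<bullet> (S *v x))"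

definition spectral_norm :: "real^'d^'d \<Rightarrow> real" where
  "spectral_norm S = onorm ((*v) S)"

definition eigenspace :: "real^'d^'d \<Rightarrow> real \<Rightarrow> (real^'d) set" where
  "eigenspace S \<mu> = {x. S *v x = \<mu> *\<^sub>R x}"

definition real_spectrum :: "real^'d^'d \<Rightarrow> real set" where
  "real_spectrum S = {\<mu>. \<exists>x. x \<noteq> 0 \<and> x \<in> eigenspace S \<mu>}"

text \<open>
  The real eigenvalues in decreasing order, each repeated according to its geometric multiplicity.
  For symmetric \<open>S\<close> geometric and algebraic multiplicities agree, and the list has
  length \<open>CARD('d)\<close>.
\<close>

definition eigvals :: "real^'d^'d \<Rightarrow> real list" where
  "eigvals S =
     rev (sorted_list_of_multiset (\<Sum>\<mu>\<in>real_spectrum S. replicate_mset (dim (eigenspace S \<mu>)) \<mu>))"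

text \<open>The \<open>k\<close>-th largest eigenvalue of a symmetric matrix, for \<open>1 \<le> k \<le> CARD('d)\<close>.\<close>

definition eigval :: "nat \<Rightarrow> real^'d^'d \<Rightarrow> real" where
  "eigval k S = eigvals S ! (k - 1)"


section \<open>Function classes\<close>

definition ennreal_powr :: "ennreal \<Rightarrow> real \<Rightarrow> ennreal" where
  "ennreal_powr x a = (if x = \<infinity> then \<infinity> else ennreal (enn2real x powr a))"

text \<open>The norms take values in \<open>[0, \<infinity>]\<close>, so that an upper bound includes finiteness.\<close>

definition Lp_norm :: "real \<Rightarrow> (real \<Rightarrow> real^'d^'d) \<Rightarrow> ennreal" where
  "Lp_norm p S =
     ennreal_powr (\<integral>\<^sup>+t\<in>{0..1}. ennreal (spectral_norm (S t) powr p) \<partial>lborel) (1 / p)"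

definition Lp_modulus :: "real \<Rightarrow> (real \<Rightarrow> real^'d^'d) \<Rightarrow> real \<Rightarrow> ennreal" where
  "Lp_modulus p S h =
     (SUP s\<in>{0..h}. ennreal_powr
        (\<integral>\<^sup>+t\<in>{0..1-s}. ennreal (spectral_norm (S (t + s) - S t) powr p) \<partial>lborel) (1 / p))"

definition besov_seminorm :: "real \<Rightarrow> real \<Rightarrow> (real \<Rightarrow> real^'d^'d) \<Rightarrow> ennreal" where
  "besov_seminorm p \<beta> S = (SUP h\<in>{0<..1}. ennreal (h powr (- \<beta>)) * Lp_modulus p S h)"


section \<open>Hypotheses\<close>

text \<open>
  Matrix functions on \<open>[0, 1]\<close> are represented by functions on the reals whose values
  outside \<open>[0, 1]\<close> are irrelevant.
\<close>

definition H0 :: "nat \<Rightarrow> real \<Rightarrow> real \<Rightarrow> real \<Rightarrow> ((real \<Rightarrow> real^'d^'d) \<times> (real \<Rightarrow> real^'d^'d)) set" where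
  "H0 r \<beta> L \<epsilon> = {(SX, SZ).
     (\<forall>t\<in>{0..1}. psd (SX t) \<and> psd (SZ t)) \<and>
     (SUP t\<in>{0..1}. rank (SX t)) \<le> r \<and>
     besov_seminorm 2 \<beta> SX \<le> ennreal L \<and>
     Lp_norm 2 SZ \<le> ennreal \<epsilon>}"

definition H0_gap ::
    "nat \<Rightarrow> real \<Rightarrow> real \<Rightarrow> real \<Rightarrow> real \<Rightarrow> ((real \<Rightarrow> real^'d^'d) \<times> (real \<Rightarrow> real^'d^'d)) set" where
  "H0_gap r \<beta> L \<epsilon> lam = {(SX, SZ).
     (\<forall>t\<in>{0..1}. psd (SX t) \<and> psd (SZ t)) \<and>
     (SUP t\<in>{0..1}. rank (SX t)) \<le> r \<and>
     (INF t\<in>{0..1}. eigval r (SX t)) \<ge> lam \<and>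
     besov_seminorm 4 \<beta> SX \<le> ennreal L \<and>
     Lp_norm 2 SZ \<le> ennreal \<epsilon>}"

text \<open>
  The supremum is taken over closed intervals \<open>I = [a, b]\<close>; on these the continuous
  function \<open>t \<mapsto> eigval (r + 1) (SX t)\<close> attains its infimum.
\<close>

definition H1 :: "nat \<Rightarrow> real \<Rightarrow> real \<Rightarrow> (real \<Rightarrow> real^'d^'d) set" where
  "H1 r hbar v = {SX.
     continuous_on {0..1} SX \<and> (\<forall>t\<in>{0..1}. psd (SX t)) \<and>
     Sup {(b - a) * (INF t\<in>{a..b}. eigval (r + 1) (SX t)) | a b. 0 \<le> a \<and> b \<le> 1 \<and> hbar \<le> b - a} \<ge> v}"


section \<open>Brownian motion and stochastic integrals of deterministic integrands\<close>

definition standard_brownian_motion :: "'w measure \<Rightarrow> (real \<Rightarrow> 'w \<Rightarrow> real^'k) \<Rightarrow> bool" where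
  "standard_brownian_motion M W \<longleftrightarrow>
     (\<forall>t\<in>{0..1}. W t \<in> borel_measurable M) \<and>
     (AE \<omega> in M. W 0 \<omega> = 0) \<and>
     (AE \<omega> in M. continuous_on {0..1} (\<lambda>t. W t \<omega>)) \<and>
     (\<forall>s t i. 0 \<le> s \<and> s < t \<and> t \<le> 1 \<longrightarrow>
        distributed M lborel (\<lambda>\<omega>. (W t \<omega> - W s \<omega>) $ i)
          (\<lambda>x. ennreal (normal_density 0 (sqrt (t - s)) x))) \<and>
     (\<forall>N \<tau>. 0 \<le> \<tau> 0 \<and> (\<forall>j<N. \<tau> j < \<tau> (Suc j)) \<and> \<tau> N \<le> 1 \<longrightarrow>
        prob_space.indep_vars M (\<lambda>_. borel)
          (\<lambda>(j, i) \<omega>. (W (\<tau> (Suc j)) \<omega> - W (\<tau> j) \<omega>) $ i) ({..<N} \<times> UNIV))"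

text \<open>
  A list of triples \<open>(a, b, c)\<close> with \<open>0 \<le> a \<le> b \<le> 1\<close> encodes the step function
  that is the sum of the functions \<open>1\<^bsub>(a, b]\<^esub> c\<close>.
\<close>

type_synonym ('k, 'd) step = "(real \<times> real \<times> (real^'k^'d)) list"

definition is_step :: "('k::finite, 'd::finite) step \<Rightarrow> bool" where
  "is_step xs \<longleftrightarrow> (\<forall>(a, b, c)\<in>set xs. 0 \<le> a \<and> a \<le> b \<and> b \<le> 1)"

definition step_fun :: "('k::finite, 'd::finite) step \<Rightarrow> real \<Rightarrow> real^'k^'d" where
  "step_fun xs t = (\<Sum>(a, b, c)\<leftarrow>xs. indicator {a<..b} t *\<^sub>R c)"

definition step_integral ::
    "(real \<Rightarrow> 'w \<Rightarrow> real^'k) \<Rightarrow> ('k::finite, 'd::finite) step \<Rightarrow> real \<Rightarrow> 'w \<Rightarrow> real^'d" where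
  "step_integral W xs t \<omega> = (\<Sum>(a, b, c)\<leftarrow>xs. c *v (W (min b t) \<omega> - W (min a t) \<omega>))"

definition square_integrable :: "(real \<Rightarrow> real^'k^'d) \<Rightarrow> bool" where
  "square_integrable \<sigma> \<longleftrightarrow>
     set_borel_measurable lborel {0..1} \<sigma> \<and>
     (\<integral>\<^sup>+t\<in>{0..1}. ennreal ((norm (\<sigma> t))\<^sup>2) \<partial>lborel) < \<infinity>"

text \<open>
  \<open>dX(t) = \<sigma>(t) dW(t)\<close> on \<open>[0, 1]\<close>: every \<open>X(t) - X(0)\<close> is a version of the Ito
  integral of \<open>\<sigma>\<close> over \<open>[0, t]\<close>, i.e. the limit in \<open>L\<^sup>2\<close> of the integrals of
  step functions converging to \<open>\<sigma>\<close> in \<open>L\<^sup>2[0, 1]\<close>. The initial value \<open>X(0)\<close> is an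
  arbitrary random variable.
\<close>

definition ito_differential ::
    "'w measure \<Rightarrow> (real \<Rightarrow> 'w \<Rightarrow> real^'k) \<Rightarrow> (real \<Rightarrow> real^'k^'d) \<Rightarrow> (real \<Rightarrow> 'w \<Rightarrow> real^'d) \<Rightarrow> bool" where
  "ito_differential M W \<sigma> X \<longleftrightarrow>
     square_integrable \<sigma> \<and>
     (\<forall>t\<in>{0..1}. X t \<in> borel_measurable M) \<and>
     (\<exists>xs :: nat \<Rightarrow> ('k, 'd) step.
        (\<forall>k. is_step (xs k)) \<and>
        (\<lambda>k. \<integral>\<^sup>+s\<in>{0..1}. ennreal ((norm (\<sigma> s - step_fun (xs k) s))\<^sup>2) \<partial>lborel) \<longlonglongrightarrow> 0 \<and>
        (\<forall>t\<in>{0..1}.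
           (\<lambda>k. \<integral>\<^sup>+\<omega>. ennreal ((norm (X t \<omega> - X 0 \<omega> - step_integral W (xs k) t \<omega>))\<^sup>2) \<partial>M) \<longlonglongrightarrow> 0))"


section \<open>The statistical model and tests\<close>

text \<open>The sigma-algebra generated by a process on \<open>[0, 1]\<close>.\<close>

definition process_events :: "'w measure \<Rightarrow> (real \<Rightarrow> 'w \<Rightarrow> real^'k) \<Rightarrow> 'w set set" where
  "process_events M W =
     {(\<lambda>\<omega>. \<lambda>t\<in>{0..1}. W t \<omega>) -` A \<inter> space M | A. A \<in> sets (PiM {0..1} (\<lambda>_. borel))}"

definition diffusion_model ::
    "'w measure \<Rightarrow> (real \<Rightarrow> 'w \<Rightarrow> real^'m) \<Rightarrow> (real \<Rightarrow> 'w \<Rightarrow> real^'d) \<Rightarrow>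
     (real \<Rightarrow> real^'m^'d) \<Rightarrow> (real \<Rightarrow> real^'d^'d) \<Rightarrow>
     (real \<Rightarrow> 'w \<Rightarrow> real^'d) \<Rightarrow> (real \<Rightarrow> 'w \<Rightarrow> real^'d) \<Rightarrow> bool" where
  "diffusion_model M B BZ \<sigma>X \<sigma>Z X Z \<longleftrightarrow>
     prob_space M \<and>
     standard_brownian_motion M B \<and> standard_brownian_motion M BZ \<and>
     prob_space.indep_set M (process_events M B) (process_events M BZ) \<and>
     ito_differential M B \<sigma>X X \<and> ito_differential M BZ \<sigma>Z Z"

definition covariance :: "(real \<Rightarrow> real^'k^'d) \<Rightarrow> real \<Rightarrow> real^'d^'d" where
  "covariance \<sigma> t = \<sigma> t ** transpose (\<sigma> t)"

text \<open>
  All realisations \<open>(M, Y)\<close> of the model on probability spaces over the type \<open>'w\<close>, driven by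
  an \<open>'m\<close>-dimensional \<open>B\<close>, whose pair of covariance functions lies in the hypothesis \<open>K\<close>.
\<close>

definition experiments ::
    "'m::finite itself \<Rightarrow> ((real \<Rightarrow> real^'d^'d) \<times> (real \<Rightarrow> real^'d^'d)) set \<Rightarrow>
     ('w measure \<times> (real \<Rightarrow> 'w \<Rightarrow> real^'d)) set" where
  "experiments _ K = {(M, Y). \<exists>(B :: real \<Rightarrow> 'w \<Rightarrow> real^'m) BZ \<sigma>X \<sigma>Z X Z.
     diffusion_model M B BZ \<sigma>X \<sigma>Z X Z \<and>
     (covariance \<sigma>X, covariance \<sigma>Z) \<in> K \<and>
     Y = (\<lambda>t \<omega>. X t \<omega> + Z t \<omega>)}"

definition obs :: "nat \<Rightarrow> (real \<Rightarrow> 'w \<Rightarrow> real^'d) \<Rightarrow> 'w \<Rightarrow> nat \<Rightarrow> real^'d" where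
  "obs n Y \<omega> = (\<lambda>i\<in>{0..n}. Y (real i / real n) \<omega>)"

text \<open>Non-randomised tests; the value \<open>1\<close> means rejection of the null hypothesis.\<close>

definition is_test :: "nat \<Rightarrow> ((nat \<Rightarrow> real^'d) \<Rightarrow> real) \<Rightarrow> bool" where
  "is_test n \<phi> \<longleftrightarrow>
     \<phi> \<in> borel_measurable (PiM {0..n} (\<lambda>_. borel)) \<and>
     (\<forall>y\<in>space (PiM {0..n} (\<lambda>_. borel :: (real^'d) measure)). \<phi> y \<in> {0, 1})"

definition rejection_probs ::
    "nat \<Rightarrow> ((nat \<Rightarrow> real^'d) \<Rightarrow> real) \<Rightarrow> ('w measure \<times> (real \<Rightarrow> 'w \<Rightarrow> real^'d)) set \<Rightarrow> real set" where
  "rejection_probs n \<phi> E = {measure M {\<omega> \<in> space M. \<phi> (obs n Y \<omega>) = 1} | M Y. (M, Y) \<in> E}"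

definition uniform_level ::
    "real \<Rightarrow> (nat \<Rightarrow> (nat \<Rightarrow> real^'d) \<Rightarrow> real) \<Rightarrow>
     (nat \<Rightarrow> ('w measure \<times> (real \<Rightarrow> 'w \<Rightarrow> real^'d)) set) \<Rightarrow> bool" where
  "uniform_level \<alpha> \<phi> E \<longleftrightarrow> (\<forall>n\<ge>1. \<forall>p\<in>rejection_probs n (\<phi> n) (E n). p \<le> \<alpha>)"

text \<open>Inserting \<open>1\<close> makes the infimum over an empty alternative equal to \<open>1\<close> and changes no other.\<close>

definition uniformly_consistent ::
    "(nat \<Rightarrow> (nat \<Rightarrow> real^'d) \<Rightarrow> real) \<Rightarrow>
     (nat \<Rightarrow> ('w measure \<times> (real \<Rightarrow> 'w \<Rightarrow> real^'d)) set) \<Rightarrow> bool" where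
  "uniformly_consistent \<phi> E \<longleftrightarrow> (\<lambda>n. Inf (insert 1 (rejection_probs n (\<phi> n) (E n)))) \<longlonglongrightarrow> 1"

end

theory Submission
  imports Defs
begin

text \<open>
  Cut the increments into blocks of \<open>r + 1\<close> and measure how far the \<open>r + 1\<close> increments of a block
  are from being linearly dependent; the test rejects when the sum of these quantities is large.

  Under the null hypothesis \<open>\<Sigma>\<^sub>X(t)\<close> has rank at most \<open>r\<close>, so some normalised combination of
  the increments of a block lies in the kernel of \<open>\<Sigma>\<^sub>X(t)\<close>, for any \<open>t\<close> in the block. On this
  kernel the quadratic form of \<open>\<Sigma>\<^sub>X(s)\<close> is at most \<open>\<Sigma>\<^sub>X(s) - \<Sigma>\<^sub>X(t)\<close> in norm. With a spectral gap
  \<open>S \<le> S\<^sup>2 / \<lambda>\<close> holds for \<open>S = \<Sigma>\<^sub>X(s)\<close>, which squares this difference. Averaging over \<open>t\<close>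
  bounds the expectation of the statistic by the Besov modulus at lag \<open>(r + 1) / n\<close>, and Markov's
  inequality yields the level.

  Under the alternative every subspace of dimension at least \<open>d - r\<close> contains a direction in which
  an increment has variance of order \<open>v / (n \<bar>I\<bar>)\<close>. Conditionally on the other increments of its block
  and on \<open>Z\<close>, a Gaussian increment is therefore far from their span with probability close to one.
  The blocks being independent, an exponential Markov inequality shows that the statistic exceeds a
  multiple of \<open>v\<close> except with probability exponentially small in the number of blocks in \<open>I\<close>.
\<close>


section \<open>Eigenvalues of symmetric matrices\<close>

text \<open>No null distribution is computed. Once \<open>C\<close> is large, the statistic exceeds
  any prescribed multiple of its null mean with probability tending to one under the alternative, so
  Markov's inequality costs only a factor of order 1/\<alpha> in \<open>C\<close>. Three obstacles
  shape the argument. The Besov seminorm controls increments of \<open>\<Sigma>\<^sub>X\<close> only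
  in an integrated sense, so no fixed point of a block can serve as reference for the kernel. Under
  the alternative the direction of large variance may turn with time and must avoid the span of
  random vectors, so spread is needed in every sufficiently large subspace, not in one direction. An
  Ito integral is given only as an L2 limit, so Gaussian laws are available for step integrands
  alone; the event of a small statistic can be transferred from them because
  \<open>degeneracy\<close> is an infimum of continuous functions. The sum over blocks is not
  normalised: increments over time 1/n have covariance of order 1/n, so about n/(r+1) blocks add up
  to an integral over time, which is the scale of the separation rate.\<close>

lemma symmetric_matrix_dot:
  fixes S :: "real^'d^'d"
  assumes "transpose S = S"
  shows "(S *v x) \<bullet> y = x \<bullet> (S *v y)"
  by (metis assms dot_lmul_matrix vector_transpose_matrix)

lemma subspace_eigenspace: "subspace (eigenspace S \<mu>)"
  by (auto simp: eigenspace_def subspace_def matrix_vector_right_distrib scaleR_right_distrib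
      matrix_vector_mult_scaleR)

lemma eigenspace_orthogonal:
  assumes "transpose S = S" "x \<in> eigenspace S \<mu>" "y \<in> eigenspace S \<nu>" "\<mu> \<noteq> \<nu>"
  shows "x \<bullet> y = 0"
proof -
  have "\<mu> * (x \<bullet> y) = \<nu> * (x \<bullet> y)"
    using symmetric_matrix_dot[OF assms(1), of x y] assms(2,3) by (simp add: eigenspace_def)
  then show ?thesis using assms(4) by simp
qed

text \<open>The Rayleigh quotient attains its maximum on the unit sphere at an eigenvector.\<close>

lemma eigenvector_in_invariant_subspace:
  fixes S :: "real^'d^'d"
  assumes S: "transpose S = S" and V: "subspace V" "\<And>x. x \<in> V \<Longrightarrow> S *v x \<in> V" "V \<noteq> {0}"
  obtains v \<mu> where "v \<in> V" "v \<noteq> 0" "v \<in> eigenspace S \<mu>"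
proof -
  let ?K = "V \<inter> sphere 0 1"
  have "compact ?K" by (intro closed_Int_compact closed_subspace V compact_sphere)
  moreover obtain w where w: "w \<in> V" "w \<noteq> 0" using V subspace_0 by blast
  have "w /\<^sub>R norm w \<in> ?K" using w V(1) by (simp add: subspace_scale)
  then have "?K \<noteq> {}" by blast
  moreover have "continuous_on ?K (\<lambda>x. x \<bullet> (S *v x))"
    by (intro continuous_intros matrix_vector_mult_linear_continuous_on)
  ultimately obtain v where v: "v \<in> ?K" and max: "\<And>y. y \<in> ?K \<Longrightarrow> y \<bullet> (S *v y) \<le> v \<bullet> (S *v v)"
    using continuous_attains_sup by (metis (no_types, lifting))
  define \<mu> where "\<mu> = v \<bullet> (S *v v)"
  \<comment> \<open>\<open>A\<close> is nonnegative on \<open>V\<close> because \<open>v\<close> is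
    maximal, and its quadratic form vanishes at \<open>v\<close>. The aim is \<open>A v = 0\<close>,
    which makes \<open>v\<close> an eigenvector.\<close>
  define A where "A y = \<mu> *\<^sub>R y - S *v y" for y
  have A_lin: "A (x + t *\<^sub>R y) = A x + t *\<^sub>R A y" for x y t
    by (simp add: A_def matrix_vector_right_distrib algebra_simps matrix_vector_mult_scaleR)
  have A_sym: "A x \<bullet> y = x \<bullet> A y" for x y
    using symmetric_matrix_dot[OF S, of x y] by (simp add: A_def inner_diff_left inner_diff_right)
  have A_pos: "0 \<le> y \<bullet> A y" if y: "y \<in> V" for y
  proof (cases "y = 0")
    case False
    have "(y /\<^sub>R norm y) \<bullet> (S *v (y /\<^sub>R norm y)) \<le> \<mu>"
      unfolding \<mu>_def using False V(1) y by (intro max) (auto simp: subspace_scale)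
    then have "(y \<bullet> (S *v y)) / (norm y)\<^sup>2 \<le> \<mu>"
      by (simp add: matrix_vector_mult_scaleR power2_eq_square divide_inverse mult.commute mult.left_commute)
    then show ?thesis using False
      by (simp add: A_def inner_diff_right dot_square_norm divide_le_eq)
  qed (simp add: A_def)
  have vAv: "v \<bullet> A v = 0" using v by (simp add: A_def inner_diff_right \<mu>_def dot_square_norm)
  define z where "z = A v"
  have zV: "z \<in> V" using v V by (simp add: z_def A_def subspace_diff subspace_scale)
  define q where "q = z \<bullet> A z"
  have q: "0 \<le> q" using A_pos zV by (simp add: q_def)
  \<comment> \<open>Moving from \<open>v\<close> to \<open>v - s z\<close> changes the form by
    \<open>s\<^sup>2 * q - 2 * s * (norm z)\<^sup>2\<close>. This step length keeps
    \<open>s * q\<close> below \<open>(norm z)\<^sup>2\<close>; adding one covers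
    \<open>q = 0\<close>.\<close>
  define s where "s = (norm z)\<^sup>2 / (q + 1)"
  have "0 \<le> (v + (- s) *\<^sub>R z) \<bullet> A (v + (- s) *\<^sub>R z)"
    using A_pos v zV V(1) by (metis IntD1 subspace_add subspace_scale)
  also have "\<dots> = s\<^sup>2 * q - 2 * s * (norm z)\<^sup>2"
    unfolding A_lin using A_sym[of v z] vAv
    by (simp add: inner_add_left inner_add_right z_def[symmetric] q_def[symmetric] dot_square_norm
        power2_eq_square algebra_simps inner_commute)
  finally have "2 * s * (norm z)\<^sup>2 \<le> s\<^sup>2 * q" by simp
  moreover have "s\<^sup>2 * q \<le> s * (norm z)\<^sup>2"
  proof -
    have "s * q \<le> (norm z)\<^sup>2" using q by (simp add: s_def divide_simps mult_left_mono)
    moreover have "0 \<le> s" using q by (simp add: s_def)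
    ultimately have "s * (s * q) \<le> s * (norm z)\<^sup>2" by (rule mult_left_mono)
    then show ?thesis by (simp add: power2_eq_square mult.assoc)
  qed
  ultimately have "s * (norm z)\<^sup>2 \<le> 0" by simp
  then have "z = 0" using q by (simp add: s_def divide_le_0_iff mult_le_0_iff) 
  then have "v \<in> eigenspace S \<mu>" by (simp add: eigenspace_def z_def A_def)
  then show ?thesis using that v by (metis IntD1 IntD2 mem_sphere_0 norm_zero zero_neq_one)
qed

section \<open>Orthogonal decomposition into eigenspaces\<close>

definition spectral_space :: "real^'d^'d \<Rightarrow> real set \<Rightarrow> (real^'d) set" where
  "spectral_space S F = span (\<Union>\<mu>\<in>F. eigenspace S \<mu>)"

lemma spectral_space_dim:
  assumes S: "transpose S = S" and F: "finite F"
  shows "dim (spectral_space S F) = (\<Sum>\<mu>\<in>F. dim (eigenspace S \<mu>))"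
  using F
proof (induction F)
  case (insert \<nu> F)
  have "dim (eigenspace S \<nu> \<union> (\<Union>\<mu>\<in>F. eigenspace S \<mu>)) =
      dim (eigenspace S \<nu>) + dim (\<Union>\<mu>\<in>F. eigenspace S \<mu>)"
    by (rule dim_orthogonal_sum) (use eigenspace_orthogonal[OF S] insert in blast)
  then show ?case using insert by (simp add: spectral_space_def)
qed (simp add: spectral_space_def)

text \<open>Orthogonal eigenspaces add their dimensions, and each has dimension at least one, so no
  finite set of eigenvalues has more members than the space has dimensions.\<close>

lemma finite_real_spectrum:
  fixes S :: "real^'d^'d"
  assumes S: "transpose S = S"
  shows "finite (real_spectrum S)"
proof -
  have "card F \<le> CARD('d)" if F: "finite F" "F \<subseteq> real_spectrum S" for F
  proof -
    have "1 \<le> dim (eigenspace S \<mu>)" if "\<mu> \<in> F" for \<mu>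
    proof -
      obtain x where "x \<noteq> 0" "x \<in> eigenspace S \<mu>" using F \<open>\<mu> \<in> F\<close> by (auto simp: real_spectrum_def)
      then show ?thesis by (metis dim_eq_0 empty_iff insert_iff less_one not_le subsetD)
    qed
    then have "card F \<le> (\<Sum>\<mu>\<in>F. dim (eigenspace S \<mu>))"
      using sum_mono[of F "\<lambda>_. 1" "\<lambda>\<mu>. dim (eigenspace S \<mu>)"] by simp
    also have "\<dots> = dim (spectral_space S F)" using spectral_space_dim[OF S F(1)] by simp
    also have "\<dots> \<le> CARD('d)" by (rule dim_subset_UNIV_cart)
    finally show ?thesis .
  qed
  then show ?thesis by (metis finite_if_finite_subsets_card_bdd)
qed

text \<open>The orthogonal complement of all eigenvectors is invariant under \<open>S\<close>; were
  it nonzero, it would contain an eigenvector orthogonal to itself.\<close>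

lemma spectral_space_spectrum:
  fixes S :: "real^'d^'d"
  assumes S: "transpose S = S"
  shows "spectral_space S (real_spectrum S) = UNIV"
proof (rule ccontr)
  define E where "E = (\<Union>\<mu>\<in>real_spectrum S. eigenspace S \<mu>)"
  define V where "V = {y. \<forall>x\<in>E. x \<bullet> y = 0}"
  assume ne: "spectral_space S (real_spectrum S) \<noteq> UNIV"
  have "V \<noteq> {0}"
  proof -
    obtain a where a: "a \<noteq> 0" "\<forall>x\<in>span E. a \<bullet> x = 0"
      using span_not_univ_subset_hyperplane[of E] ne by (auto simp: E_def spectral_space_def)
    then have "a \<in> V" by (auto simp: V_def inner_commute span_base)
    then show ?thesis using a by auto
  qed
  moreover have "subspace V" by (auto simp: V_def subspace_def inner_add_right)
  moreover have "S *v y \<in> V" if y: "y \<in> V" for y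
  proof -
    have "x \<bullet> (S *v y) = 0" if x: "x \<in> E" for x
    proof -
      obtain \<mu> where "S *v x = \<mu> *\<^sub>R x" using x by (auto simp: E_def eigenspace_def)
      then show ?thesis using symmetric_matrix_dot[OF S, of x y] x y by (simp add: V_def)
    qed
    then show ?thesis by (simp add: V_def)
  qed
  ultimately obtain v \<mu> where v: "v \<in> V" "v \<noteq> 0" "v \<in> eigenspace S \<mu>"
    using eigenvector_in_invariant_subspace[OF S] by blast
  then have "v \<in> E" by (auto simp: E_def real_spectrum_def)
  then show False using v by (auto simp: V_def)
qed

lemma spectral_space_decomp:
  assumes "finite F" "x \<in> spectral_space S F"
  obtains y where "\<And>\<mu>. \<mu> \<in> F \<Longrightarrow> y \<mu> \<in> eigenspace S \<mu>" "x = (\<Sum>\<mu>\<in>F. y \<mu>)"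
proof -
  have "\<exists>y. (\<forall>\<mu>\<in>F. y \<mu> \<in> eigenspace S \<mu>) \<and> x = (\<Sum>\<mu>\<in>F. y \<mu>)"
    using assms
  proof (induction F arbitrary: x)
    case empty
    then show ?case by (simp add: spectral_space_def)
  next
    case (insert \<nu> F)
    have "x \<in> span (eigenspace S \<nu> \<union> (\<Union>\<mu>\<in>F. eigenspace S \<mu>))"
      using insert.prems by (simp add: spectral_space_def)
    then obtain a b where ab: "a \<in> eigenspace S \<nu>" "b \<in> spectral_space S F" "x = a + b"
      unfolding span_Un spectral_space_def span_eq_iff[THEN iffD2, OF subspace_eigenspace] by auto
    obtain y where y: "\<forall>\<mu>\<in>F. y \<mu> \<in> eigenspace S \<mu>" "b = (\<Sum>\<mu>\<in>F. y \<mu>)"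
      using insert.IH[OF ab(2)] by auto
    have "(\<Sum>\<mu>\<in>insert \<nu> F. (y(\<nu> := a)) \<mu>) = a + (\<Sum>\<mu>\<in>F. (y(\<nu> := a)) \<mu>)"
      using insert.hyps by simp
    also have "(\<Sum>\<mu>\<in>F. (y(\<nu> := a)) \<mu>) = b"
      unfolding y(2) by (rule sum.cong) (use insert.hyps in auto)
    finally have "x = (\<Sum>\<mu>\<in>insert \<nu> F. (y(\<nu> := a)) \<mu>)" using ab(3) by simp
    then show ?case using y ab by (intro exI[of _ "y(\<nu> := a)"]) auto
  qed
  then show ?thesis using that by blast
qed

lemma eigen_sum_mult:
  assumes "\<And>\<mu>. \<mu> \<in> F \<Longrightarrow> y \<mu> \<in> eigenspace S \<mu>"
  shows "S *v (\<Sum>\<mu>\<in>F. y \<mu>) = (\<Sum>\<mu>\<in>F. \<mu> *\<^sub>R y \<mu>)"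
  unfolding linear_sum[OF matrix_vector_mul_linear]
  by (rule sum.cong) (use assms in \<open>auto simp: eigenspace_def\<close>)

lemma eigen_sum_inner:
  assumes S: "transpose S = S" and F: "finite F" and y: "\<And>\<mu>. \<mu> \<in> F \<Longrightarrow> y \<mu> \<in> eigenspace S \<mu>"
  shows "(\<Sum>\<mu>\<in>F. a \<mu> *\<^sub>R y \<mu>) \<bullet> (\<Sum>\<mu>\<in>F. b \<mu> *\<^sub>R y \<mu>) = (\<Sum>\<mu>\<in>F. a \<mu> * b \<mu> * (norm (y \<mu>))\<^sup>2)"
proof -
  have "(\<Sum>\<mu>\<in>F. a \<mu> *\<^sub>R y \<mu>) \<bullet> (\<Sum>\<mu>\<in>F. b \<mu> *\<^sub>R y \<mu>) =
      (\<Sum>\<mu>\<in>F. \<Sum>\<nu>\<in>F. a \<mu> * b \<nu> * (y \<mu> \<bullet> y \<nu>))"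
    unfolding inner_sum_left unfolding inner_sum_right by (simp add: mult.assoc mult.left_commute)
  also have "\<dots> = (\<Sum>\<mu>\<in>F. \<Sum>\<nu>\<in>F. if \<nu> = \<mu> then a \<mu> * b \<nu> * (y \<mu> \<bullet> y \<nu>) else 0)"
    using eigenspace_orthogonal[OF S] y by (intro sum.cong refl) force
  also have "\<dots> = (\<Sum>\<mu>\<in>F. a \<mu> * b \<mu> * (norm (y \<mu>))\<^sup>2)"
    using F by (simp add: dot_square_norm)
  finally show ?thesis .
qed

section \<open>Ordered eigenvalues and the dimensions they count\<close>

definition eig_mset :: "real^'d^'d \<Rightarrow> real multiset" where
  "eig_mset S = (\<Sum>\<mu>\<in>real_spectrum S. replicate_mset (dim (eigenspace S \<mu>)) \<mu>)"

text \<open>The bridge from the sorted list to linear algebra: multiplicities of the selected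
  eigenvalues are dimensions of orthogonal summands.\<close>

lemma size_filter_eig_mset:
  assumes S: "transpose S = S"
  shows "size (filter_mset P (eig_mset S)) = dim (spectral_space S {\<mu>\<in>real_spectrum S. P \<mu>})"
proof -
  have fin: "finite (real_spectrum S)" by (rule finite_real_spectrum[OF S])
  have "size (filter_mset P (\<Sum>\<mu>\<in>F. replicate_mset (dim (eigenspace S \<mu>)) \<mu>)) =
      (\<Sum>\<mu>\<in>{\<mu>\<in>F. P \<mu>}. dim (eigenspace S \<mu>))" if "finite F" for F
    using that
  proof induction
    case (insert \<nu> F)
    have "{\<mu>\<in>insert \<nu> F. P \<mu>} = (if P \<nu> then insert \<nu> {\<mu>\<in>F. P \<mu>} else {\<mu>\<in>F. P \<mu>})" by auto
    moreover have "filter_mset P (replicate_mset k \<nu>) = (if P \<nu> then replicate_mset k \<nu> else {#})" for k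
      by (induction k) auto
    ultimately show ?case using insert by auto
  qed simp
  then show ?thesis using fin spectral_space_dim[OF S, of "{\<mu>\<in>real_spectrum S. P \<mu>}"]
    by (simp add: eig_mset_def)
qed

lemma eigvals_mset: "mset (eigvals S) = eig_mset S"
  by (simp add: eigvals_def eig_mset_def)

lemma length_eigvals:
  fixes S :: "real^'d^'d"
  assumes S: "transpose S = S"
  shows "length (eigvals S) = CARD('d)"
proof -
  have "length (eigvals S) = size (filter_mset (\<lambda>_. True) (eig_mset S))"
    by (metis eigvals_mset filter_mset_True size_mset)
  also have "\<dots> = CARD('d)"
    using size_filter_eig_mset[OF S, of "\<lambda>_. True"] spectral_space_spectrum[OF S] by simp
  finally show ?thesis .
qed

lemma eigval_in_spectrum:
  fixes S :: "real^'d^'d"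
  assumes S: "transpose S = S" and k: "1 \<le> k" "k \<le> CARD('d)"
  shows "eigval k S \<in> real_spectrum S"
proof -
  have "eigval k S \<in># eig_mset S"
    unfolding eigvals_mset[symmetric] eigval_def
    using k length_eigvals[OF S] by (simp add: set_mset_mset)
  then show ?thesis using finite_real_spectrum[OF S]
    by (auto simp: eig_mset_def set_mset_sum in_replicate_mset split: if_splits)
qed

text \<open>The list is decreasing, so its first \<open>k\<close> entries all pass the filter, and
  the length of the filtered list is a dimension.\<close>

lemma dim_spectral_space_ge_eigval:
  fixes S :: "real^'d^'d"
  assumes S: "transpose S = S" and k: "1 \<le> k" "k \<le> CARD('d)"
  shows "k \<le> dim (spectral_space S {\<mu>\<in>real_spectrum S. eigval k S \<le> \<mu>})"
proof -
  let ?l = "eigvals S"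
  have srt: "sorted (rev ?l)" by (simp add: eigvals_def)
  have "eigval k S \<le> x" if "x \<in> set (take k ?l)" for x
  proof -
    obtain i where i: "i < k" "x = ?l ! i" using \<open>x \<in> _\<close> by (auto simp: in_set_conv_nth)
    then show ?thesis using sorted_rev_nth_mono[OF srt, of i "k - 1"] k length_eigvals[OF S]
      by (simp add: eigval_def)
  qed
  then have "filter ((\<le>) (eigval k S)) (take k ?l) = take k ?l" by (simp add: filter_True)
  then have "k \<le> length (filter ((\<le>) (eigval k S)) ?l)"
    using k length_eigvals[OF S]
    by (metis append_take_drop_id filter_append length_append length_take le_add1 min.absorb2)
  also have "\<dots> = size (filter_mset ((\<le>) (eigval k S)) (eig_mset S))"
    by (metis eigvals_mset mset_filter size_mset)
  finally show ?thesis using size_filter_eig_mset[OF S] by simp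
qed

lemma eigval_nonneg:
  fixes S :: "real^'d^'d"
  assumes S: "psd S" and k: "1 \<le> k" "k \<le> CARD('d)"
  shows "0 \<le> eigval k S"
proof -
  obtain x where x: "x \<noteq> 0" "S *v x = eigval k S *\<^sub>R x"
    using eigval_in_spectrum[of S k] S k by (auto simp: psd_def real_spectrum_def eigenspace_def)
  have "0 \<le> x \<bullet> (S *v x)" using S by (simp add: psd_def)
  moreover have "0 < x \<bullet> x" using x by simp
  ultimately show ?thesis using x by (simp add: zero_le_mult_iff)
qed

text \<open>One half of the Courant-Fischer principle. The eigenspaces for eigenvalues at least
  \<open>eigval k S\<close> span a space of dimension at least \<open>k\<close>, which must meet
  \<open>U\<close> outside zero; on it the Rayleigh quotient is at least
  \<open>eigval k S\<close>.\<close>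

lemma eigval_le_quadratic_form:
  fixes S :: "real^'d^'d"
  assumes S: "transpose S = S" and k: "1 \<le> k" "k \<le> CARD('d)"
    and U: "subspace U" "CARD('d) < dim U + k"
  obtains u where "u \<in> U" "norm u = 1" "eigval k S \<le> u \<bullet> (S *v u)"
proof -
  define F where "F = {\<mu>\<in>real_spectrum S. eigval k S \<le> \<mu>}"
  define W where "W = spectral_space S F"
  have F: "finite F" using finite_real_spectrum[OF S] by (simp add: F_def)
  have W: "subspace W" "k \<le> dim W"
    using dim_spectral_space_ge_eigval[OF S k] by (auto simp: W_def F_def spectral_space_def)
  have "dim {x + y |x y. x \<in> W \<and> y \<in> U} \<le> CARD('d)" by (rule dim_subset_UNIV_cart)
  then have "dim (W \<inter> U) \<noteq> 0" using dim_sums_Int[OF W(1) U(1)] W(2) U(2) by linarith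
  then have "\<not> W \<inter> U \<subseteq> {0}" unfolding dim_eq_0 .
  then obtain w where w: "w \<in> W" "w \<in> U" "w \<noteq> 0" by blast
  obtain y where y: "\<And>\<mu>. \<mu> \<in> F \<Longrightarrow> y \<mu> \<in> eigenspace S \<mu>" "w = (\<Sum>\<mu>\<in>F. y \<mu>)"
    using spectral_space_decomp[OF F] w(1) by (auto simp: W_def)
  have "eigval k S * (w \<bullet> w) = (\<Sum>\<mu>\<in>F. eigval k S * (norm (y \<mu>))\<^sup>2)"
    using eigen_sum_inner[OF S F y(1), of "\<lambda>_. 1" "\<lambda>_. 1"] y(2) by (simp add: sum_distrib_left)
  also have "\<dots> \<le> (\<Sum>\<mu>\<in>F. \<mu> * (norm (y \<mu>))\<^sup>2)"
    by (intro sum_mono mult_right_mono) (auto simp: F_def)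
  also have "\<dots> = w \<bullet> (S *v w)"
    using eigen_sum_inner[OF S F y(1), of "\<lambda>_. 1" "\<lambda>\<mu>. \<mu>"] y eigen_sum_mult[OF y(1)] by simp
  finally have *: "eigval k S * (norm w)\<^sup>2 \<le> w \<bullet> (S *v w)" by (simp add: dot_square_norm)
  let ?u = "w /\<^sub>R norm w"
  have "eigval k S \<le> (w \<bullet> (S *v w)) / (norm w)\<^sup>2"
    using * w(3) by (simp add: le_divide_eq)
  also have "\<dots> = ?u \<bullet> (S *v ?u)"
    by (simp add: matrix_vector_mult_scaleR power2_eq_square divide_inverse mult.commute mult.left_commute)
  finally have "eigval k S \<le> ?u \<bullet> (S *v ?u)" .
  then show ?thesis using that[of ?u] w U(1) by (simp add: subspace_scale)
qed

text \<open>Without eigenvalues in the gap \<open>(0, lam)\<close>, every eigenvalue satisfies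
  \<open>lam * \<mu> \<le> \<mu>\<^sup>2\<close>.\<close>

lemma quadratic_form_le_spectral_gap:
  fixes S :: "real^'d^'d"
  assumes S: "psd S" and r: "1 \<le> r" "r \<le> CARD('d)" and rank: "rank S \<le> r"
    and lam: "0 < lam" "lam \<le> eigval r S"
  shows "lam * (x \<bullet> (S *v x)) \<le> (norm (S *v x))\<^sup>2"
proof -
  have sym: "transpose S = S" using S by (simp add: psd_def)
  define F where "F = real_spectrum S"
  have F: "finite F" using finite_real_spectrum[OF sym] by (simp add: F_def)
  have gap: "\<mu> = 0 \<or> lam \<le> \<mu>" if \<mu>: "\<mu> \<in> F" for \<mu>
  proof (rule ccontr)
    \<comment> \<open>Such a \<open>\<mu>\<close> would add a dimension to the at least
      \<open>r\<close> dimensions counted by \<open>G\<close>. All these eigenspaces lie in the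
      range of \<open>S\<close>, whose dimension is at most \<open>r\<close>.\<close>
    assume neg: "\<not> (\<mu> = 0 \<or> lam \<le> \<mu>)"
    define G where "G = {\<nu>\<in>F. eigval r S \<le> \<nu>}"
    have notin: "\<mu> \<notin> G" "finite G" using neg lam F by (auto simp: G_def)
    obtain v where v: "v \<noteq> 0" "v \<in> eigenspace S \<mu>" using \<mu> by (auto simp: F_def real_spectrum_def)
    have "1 \<le> dim (eigenspace S \<mu>)"
      using v by (metis dim_eq_0 empty_iff insert_iff less_one not_le subsetD)
    moreover have "r \<le> (\<Sum>\<nu>\<in>G. dim (eigenspace S \<nu>))"
      using dim_spectral_space_ge_eigval[OF sym r] spectral_space_dim[OF sym notin(2)]
      by (simp add: G_def F_def)
    ultimately have "r + 1 \<le> dim (spectral_space S (insert \<mu> G))"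
      using spectral_space_dim[OF sym, of "insert \<mu> G"] notin by simp
    also have "\<dots> \<le> dim (range (\<lambda>x. S *v x))"
    proof (rule dim_subset)
      have "eigenspace S \<nu> \<subseteq> range (\<lambda>x. S *v x)" if "\<nu> \<in> insert \<mu> G" for \<nu>
      proof
        fix y assume "y \<in> eigenspace S \<nu>"
        moreover have "\<nu> \<noteq> 0" using that neg lam by (auto simp: G_def)
        ultimately have "S *v (y /\<^sub>R \<nu>) = y" by (simp add: eigenspace_def matrix_vector_mult_scaleR)
        then show "y \<in> range (\<lambda>x. S *v x)" by (metis rangeI)
      qed
      moreover have "subspace (range (\<lambda>x. S *v x))"
        by (rule linear_subspace_image) auto
      ultimately show "spectral_space S (insert \<mu> G) \<subseteq> range (\<lambda>x. S *v x)"
        unfolding spectral_space_def by (intro span_minimal) blast+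
    qed
    also have "\<dots> \<le> r" using rank by (simp add: rank_dim_range)
    finally show False by simp
  qed
  have "x \<in> spectral_space S F" using spectral_space_spectrum[OF sym] by (simp add: F_def)
  then obtain y where y: "\<And>\<mu>. \<mu> \<in> F \<Longrightarrow> y \<mu> \<in> eigenspace S \<mu>" "x = (\<Sum>\<mu>\<in>F. y \<mu>)"
    using spectral_space_decomp[OF F] by blast
  have Sx: "S *v x = (\<Sum>\<mu>\<in>F. \<mu> *\<^sub>R y \<mu>)" using eigen_sum_mult[OF y(1)] y(2) by simp
  have "lam * (x \<bullet> (S *v x)) = (\<Sum>\<mu>\<in>F. lam * \<mu> * (norm (y \<mu>))\<^sup>2)"
    using eigen_sum_inner[OF sym F y(1), of "\<lambda>_. 1" "\<lambda>\<mu>. \<mu>"] Sx y(2)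
    by (simp add: sum_distrib_left mult.assoc)
  also have "\<dots> \<le> (\<Sum>\<mu>\<in>F. \<mu> * \<mu> * (norm (y \<mu>))\<^sup>2)"
  proof (rule sum_mono, rule mult_right_mono)
    fix \<mu> assume "\<mu> \<in> F"
    with gap[of \<mu>] lam(1) show "lam * \<mu> \<le> \<mu> * \<mu>" by (auto intro: mult_right_mono)
  qed auto
  also have "\<dots> = (norm (S *v x))\<^sup>2"
    using eigen_sum_inner[OF sym F y(1), of "\<lambda>\<mu>. \<mu>" "\<lambda>\<mu>. \<mu>"] Sx by (simp add: dot_square_norm)
  finally show ?thesis .
qed

section \<open>A statistic for approximate linear dependence\<close>

text \<open>One coefficient is required to equal one, instead of fixing the Euclidean norm of the
  coefficients. By density of the rationals, \<open>degeneracy\<close> is then the least squared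
  distance of one of the vectors to the span of the others, which suits an argument that conditions
  on all vectors but one. Extensionality on a finite index set keeps the family countable.\<close>

definition unit_combinations :: "nat \<Rightarrow> (nat \<Rightarrow> real) set" where
  "unit_combinations K = {c \<in> {..<K} \<rightarrow>\<^sub>E \<rat>. \<exists>i<K. c i = 1}"

text \<open>Comparable to the smallest eigenvalue of the Gram matrix; restricting the infimum to
  rational coefficients makes measurability evident.\<close>

definition degeneracy :: "nat \<Rightarrow> (nat \<Rightarrow> 'a::euclidean_space) \<Rightarrow> real" where
  "degeneracy K x = (INF c\<in>unit_combinations K. (norm (\<Sum>l<K. c l *\<^sub>R x l))\<^sup>2)"

lemma countable_unit_combinations: "countable (unit_combinations K)"
proof -
  have "countable ({..<K} \<rightarrow>\<^sub>E (\<rat> :: real set))"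
    by (intro countable_PiE) (auto simp: countable_rat)
  then show ?thesis by (rule countable_subset[rotated]) (auto simp: unit_combinations_def)
qed

lemma unit_combinations_nonempty: "0 < K \<Longrightarrow> unit_combinations K \<noteq> {}"
  by (auto simp: unit_combinations_def restrict_def PiE_def intro!: exI[of _ "\<lambda>l\<in>{..<K}. 1"]
      split: if_splits)

lemma degeneracy_bdd: "bdd_below ((\<lambda>c. (norm (\<Sum>l<K. c l *\<^sub>R x l))\<^sup>2) ` unit_combinations K)"
  by (rule bdd_belowI2[of _ 0]) simp

lemma degeneracy_nonneg: "0 < K \<Longrightarrow> 0 \<le> degeneracy K x"
  unfolding degeneracy_def using unit_combinations_nonempty by (intro cINF_greatest) auto

lemma degeneracy_less_iff:
  "0 < K \<Longrightarrow> degeneracy K x < s \<longleftrightarrow> (\<exists>c\<in>unit_combinations K. (norm (\<Sum>l<K. c l *\<^sub>R x l))\<^sup>2 < s)"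
  unfolding degeneracy_def using unit_combinations_nonempty degeneracy_bdd by (intro cINF_less_iff) auto

lemma borel_measurable_degeneracy:
  assumes "0 < K" "\<And>l. l < K \<Longrightarrow> (\<lambda>\<omega>. X \<omega> l) \<in> borel_measurable M"
  shows "(\<lambda>\<omega>. degeneracy K (X \<omega>)) \<in> borel_measurable M"
  unfolding degeneracy_def
  by (rule borel_measurable_cINF)
    (use assms countable_unit_combinations degeneracy_bdd in auto)

text \<open>A single combination witnesses that the infimum is below \<open>s\<close>, and the same
  coefficients still do so for nearby vectors.\<close>

lemma degeneracy_upper_semicontinuous:
  assumes K: "0 < K" and lim: "\<And>l. l < K \<Longrightarrow> ((\<lambda>k. X k l) \<longlongrightarrow> x l) F" and s: "degeneracy K x < s"
  shows "\<forall>\<^sub>F k in F. degeneracy K (X k) < s"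
proof -
  obtain c where c: "c \<in> unit_combinations K" "(norm (\<Sum>l<K. c l *\<^sub>R x l))\<^sup>2 < s"
    using s degeneracy_less_iff[OF K] by blast
  have "((\<lambda>k. (norm (\<Sum>l<K. c l *\<^sub>R X k l))\<^sup>2) \<longlongrightarrow> (norm (\<Sum>l<K. c l *\<^sub>R x l))\<^sup>2) F"
    by (intro tendsto_intros lim) auto
  then have "\<forall>\<^sub>F k in F. (norm (\<Sum>l<K. c l *\<^sub>R X k l))\<^sup>2 < s" using c(2) by (rule order_tendstoD)
  then show ?thesis by eventually_elim (use c(1) degeneracy_less_iff[OF K] in blast)
qed

text \<open>Rational coefficients approximate real ones, so the restriction in the infimum is
  harmless.\<close>

lemma degeneracy_le_combination:
  assumes i: "i < K" "c i = 1"
  shows "degeneracy K x \<le> (norm (\<Sum>l<K. c l *\<^sub>R x l))\<^sup>2"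
proof -
  \<comment> \<open>The coefficient of \<open>i\<close> stays exactly one, so that membership in
    \<open>unit_combinations\<close> survives; the others are rounded down to multiples of
    \<open>1 / Suc m\<close>.\<close>
  define q :: "nat \<Rightarrow> nat \<Rightarrow> real"
    where "q m = (\<lambda>l\<in>{..<K}. if l = i then 1 else of_int \<lfloor>of_nat (Suc m) * c l\<rfloor> / of_nat (Suc m))" for m
  have q_unit: "q m \<in> unit_combinations K" for m
    using i(1) by (auto simp: unit_combinations_def q_def intro!: exI[of _ i])
  have lim: "(\<lambda>m. q m l) \<longlonglongrightarrow> c l" if l: "l < K" for l
  proof (cases "l = i")
    case False
    have "(\<lambda>m. q m l - c l) \<longlonglongrightarrow> 0"
    proof (rule Lim_null_comparison)
      show "\<forall>\<^sub>F m in sequentially. norm (q m l - c l) \<le> 1 / real (Suc m)"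
      proof (intro always_eventually allI)
        fix m
        have "\<bar>of_int \<lfloor>real (Suc m) * c l\<rfloor> - real (Suc m) * c l\<bar> \<le> 1" by linarith
        then have "\<bar>of_int \<lfloor>real (Suc m) * c l\<rfloor> - real (Suc m) * c l\<bar> / real (Suc m) \<le> 1 / real (Suc m)"
          by (intro divide_right_mono) auto
        moreover have "q m l - c l = (of_int \<lfloor>real (Suc m) * c l\<rfloor> - real (Suc m) * c l) / real (Suc m)"
          using l False by (simp add: q_def diff_divide_distrib del: of_nat_Suc)
        ultimately show "norm (q m l - c l) \<le> 1 / real (Suc m)"
          by (simp add: abs_divide del: of_nat_Suc)
      qed
      show "(\<lambda>m. 1 / real (Suc m)) \<longlonglongrightarrow> 0" using LIMSEQ_inverse_real_of_nat by (simp add: inverse_eq_divide)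
    qed
    then show ?thesis by (simp add: LIM_zero_iff)
  qed (use l i in \<open>simp add: q_def\<close>)
  have "(\<lambda>m. (norm (\<Sum>l<K. q m l *\<^sub>R x l))\<^sup>2) \<longlonglongrightarrow> (norm (\<Sum>l<K. c l *\<^sub>R x l))\<^sup>2"
    by (intro tendsto_intros lim) auto
  then show ?thesis
    by (rule LIMSEQ_le_const)
      (use q_unit degeneracy_bdd in \<open>auto simp: degeneracy_def intro!: exI[of _ 0] cINF_lower\<close>)
qed

text \<open>More vectors than dimensions are dependent. Since dependence of a set does not see
  repetitions, a family that repeats a vector is treated separately, by subtracting the vector from
  its copy.\<close>

lemma exists_vanishing_combination:
  fixes p :: "nat \<Rightarrow> 'a::euclidean_space"
  assumes V: "subspace V" "\<And>l. l < K \<Longrightarrow> p l \<in> V" "dim V < K"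
  obtains c :: "nat \<Rightarrow> real" where "(\<Sum>l<K. c l *\<^sub>R p l) = 0" "\<exists>l<K. c l \<noteq> 0"
proof (cases "inj_on p {..<K}")
  case True
  have "dependent (p ` {..<K})"
  proof (rule ccontr)
    assume "\<not> dependent (p ` {..<K})"
    then have "card (p ` {..<K}) \<le> dim V" using V by (intro independent_card_le_dim) auto
    then show False using V(3) by (simp add: card_image[OF True])
  qed
  then obtain u where u: "\<exists>v\<in>p ` {..<K}. u v \<noteq> 0" "(\<Sum>v\<in>p ` {..<K}. u v *\<^sub>R v) = 0"
    by (subst (asm) dependent_finite) auto
  have "(\<Sum>l<K. u (p l) *\<^sub>R p l) = 0" using u(2) by (simp add: sum.reindex[OF True])
  then show ?thesis using that[of "\<lambda>l. u (p l)"] u(1) by auto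
next
  case False
  then obtain i j where ij: "i < K" "j < K" "i \<noteq> j" "p i = p j" by (auto simp: inj_on_def)
  define c where "c l = (if l = i then 1 else if l = j then -1 else 0 :: real)" for l
  have "(\<Sum>l<K. c l *\<^sub>R p l) = (\<Sum>l<K. (if l = i then p i else 0) - (if l = j then p j else 0))"
    by (rule sum.cong) (use ij in \<open>auto simp: c_def\<close>)
  also have "\<dots> = 0" using ij by (simp add: sum_subtractf)
  finally have "(\<Sum>l<K. c l *\<^sub>R p l) = 0" .
  moreover have "c i \<noteq> 0" by (simp add: c_def)
  ultimately show ?thesis using that ij(1) by blast
qed

section \<open>Orthonormal projections and upper bounds for the degeneracy\<close>

lemma orthonormal_basis_coefficients:
  fixes B :: "'a::euclidean_space set"
  assumes B: "pairwise orthogonal B" "\<And>b. b \<in> B \<Longrightarrow> norm b = 1" "independent B" and w: "w \<in> span B"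
  shows "w = (\<Sum>b\<in>B. (b \<bullet> w) *\<^sub>R b)"
proof -
  have fin: "finite B" using B(3) by (rule independent_imp_finite)
  obtain a where a: "w = (\<Sum>b\<in>B. a b *\<^sub>R b)" using w span_finite[OF fin] by auto
  have "b \<bullet> w = a b" if b: "b \<in> B" for b
  proof -
    have "b \<bullet> w = (\<Sum>c\<in>B. if c = b then a c else 0)"
      unfolding a inner_sum_right using B b
      by (intro sum.cong) (auto simp: pairwise_def orthogonal_def dot_square_norm inner_commute)
    then show ?thesis using fin b by simp
  qed
  then show ?thesis by (subst a) (rule sum.cong, auto)
qed

lemma norm_sum_orthonormal_basis:
  fixes B :: "'a::euclidean_space set"
  assumes B: "pairwise orthogonal B" "\<And>b. b \<in> B \<Longrightarrow> norm b = 1" "independent B" and w: "w \<in> span B"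
  shows "(norm w)\<^sup>2 = (\<Sum>b\<in>B. (b \<bullet> w)\<^sup>2)"
proof -
  have "w \<bullet> w = (\<Sum>b\<in>B. (b \<bullet> w) *\<^sub>R b) \<bullet> w"
    by (rule arg_cong[where f="\<lambda>v. v \<bullet> w", OF orthonormal_basis_coefficients[OF B w]])
  then show ?thesis by (simp add: dot_square_norm inner_sum_left power2_eq_square)
qed

text \<open>Modulo \<open>U\<close> there is room for fewer than \<open>K\<close> independent vectors, so some normalised
  combination of the \<open>x l\<close> falls into \<open>U\<close>.\<close>

lemma degeneracy_le_projections:
  fixes x :: "nat \<Rightarrow> 'a::euclidean_space"
  assumes U: "DIM('a) < dim (span B) + K"
    and B: "pairwise orthogonal B" "\<And>b. b \<in> B \<Longrightarrow> norm b = 1" "independent B"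
  shows "degeneracy K x \<le> real K * (\<Sum>l<K. \<Sum>b\<in>B. (b \<bullet> x l)\<^sup>2)"
proof -
  define V where "V = {y. \<forall>b\<in>span B. orthogonal b y}"
  have V: "subspace V" by (auto simp: V_def subspace_def orthogonal_def inner_add_right)
  have "dim V + dim (span B) = DIM('a)"
    using dim_subspace_orthogonal_to_vectors[of "span B" UNIV] by (simp add: V_def)
  then have dimV: "dim V < K" using U by simp
  have "\<exists>p. p \<in> V \<and> x l - p \<in> span B" for l
  proof -
    obtain y z where "x l = y + z" "y \<in> span B" "\<And>w. w \<in> span B \<Longrightarrow> orthogonal z w"
      using orthogonal_subspace_decomp_exists[of B "x l"] by blast
    then show ?thesis by (intro exI[of _ z]) (auto simp: V_def orthogonal_commute)
  qed
  then obtain p where p: "\<And>l. p l \<in> V" "\<And>l. x l - p l \<in> span B" by metis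
  obtain c where c: "(\<Sum>l<K. c l *\<^sub>R p l) = 0" "\<exists>l<K. c l \<noteq> 0"
    using exists_vanishing_combination[OF V, of K p] p dimV by blast
  have "Max ((\<lambda>l. \<bar>c l\<bar>) ` {..<K}) \<in> (\<lambda>l. \<bar>c l\<bar>) ` {..<K}" using c(2) by (intro Max_in) auto
  then obtain i where i: "i < K" "\<bar>c i\<bar> = Max ((\<lambda>l. \<bar>c l\<bar>) ` {..<K})" by auto
  have max: "\<bar>c l\<bar> \<le> \<bar>c i\<bar>" if "l < K" for l using that by (simp add: i(2))
  have ci: "c i \<noteq> 0" using c(2) max by fastforce
  define e where "e l = c l / c i" for l
  have e: "e i = 1" "\<And>l. l < K \<Longrightarrow> \<bar>e l\<bar> \<le> 1" using ci max by (auto simp: e_def abs_divide)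
  define w where "w = (\<Sum>l<K. e l *\<^sub>R x l)"
  have "(\<Sum>l<K. e l *\<^sub>R p l) = (1 / c i) *\<^sub>R (\<Sum>l<K. c l *\<^sub>R p l)"
    by (simp add: e_def scaleR_sum_right)
  then have "w = (\<Sum>l<K. e l *\<^sub>R (x l - p l))"
    using c(1) by (simp add: w_def scaleR_diff_right sum_subtractf)
  then have w: "w \<in> span B" using p(2) by (simp add: span_sum span_scale)
  have "degeneracy K x \<le> (norm w)\<^sup>2"
    unfolding w_def by (rule degeneracy_le_combination[of i K e, OF i(1) e(1)])
  also have "\<dots> = (\<Sum>b\<in>B. (b \<bullet> w)\<^sup>2)" by (rule norm_sum_orthonormal_basis[OF B w])
  also have "\<dots> \<le> (\<Sum>b\<in>B. real K * (\<Sum>l<K. (b \<bullet> x l)\<^sup>2))"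
  proof (rule sum_mono)
    fix b
    have "(b \<bullet> w)\<^sup>2 = (\<Sum>l<K. e l * (b \<bullet> x l))\<^sup>2" by (simp add: w_def inner_sum_right)
    also have "\<dots> \<le> real K * (\<Sum>l<K. (e l * (b \<bullet> x l))\<^sup>2)"
      using sum_squared_le_sum_of_squares[of "\<lambda>l. e l * (b \<bullet> x l)" "{..<K}"] by (simp add: mult.commute)
    also have "\<dots> \<le> real K * (\<Sum>l<K. (b \<bullet> x l)\<^sup>2)"
    proof (intro mult_left_mono sum_mono)
      fix l assume "l \<in> {..<K}"
      then have "(e l)\<^sup>2 \<le> 1" using e(2) by (simp add: abs_square_le_1)
      then show "(e l * (b \<bullet> x l))\<^sup>2 \<le> (b \<bullet> x l)\<^sup>2"
        by (simp add: power_mult_distrib mult_left_le_one_le)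
    qed simp
    finally show "(b \<bullet> w)\<^sup>2 \<le> real K * (\<Sum>l<K. (b \<bullet> x l)\<^sup>2)" .
  qed
  also have "\<dots> = real K * (\<Sum>l<K. \<Sum>b\<in>B. (b \<bullet> x l)\<^sup>2)"
    unfolding sum_distrib_left[symmetric] by (subst sum.swap) (rule refl)
  finally show ?thesis .
qed

text \<open>Block \<open>j\<close> consists of the \<open>K\<close> increments that start at index
  \<open>j * K\<close>; the last \<open>n mod K\<close> increments are discarded. Blocks are
  disjoint, so their contributions are independent when the increments are.\<close>

definition rank_statistic :: "nat \<Rightarrow> nat \<Rightarrow> (nat \<Rightarrow> 'a::euclidean_space) \<Rightarrow> real" where
  "rank_statistic K n y = (\<Sum>j<n div K. degeneracy K (\<lambda>l. y (Suc (j * K + l)) - y (j * K + l)))"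

lemma block_index_less: "j < n div K \<Longrightarrow> l < K \<Longrightarrow> j * K + l < (n::nat)"
proof -
  assume j: "j < n div K" and l: "l < K"
  have "j * K + l < Suc j * K" using l by simp
  also have "\<dots> \<le> n div K * K" using j by (intro mult_right_mono) auto
  also have "\<dots> \<le> n" by simp
  finally show ?thesis .
qed

lemma borel_measurable_rank_statistic:
  fixes Y :: "'w \<Rightarrow> nat \<Rightarrow> 'a::euclidean_space"
  assumes "0 < K" "\<And>i. i \<le> n \<Longrightarrow> (\<lambda>\<omega>. Y \<omega> i) \<in> borel_measurable M"
  shows "(\<lambda>\<omega>. rank_statistic K n (Y \<omega>)) \<in> borel_measurable M"
  unfolding rank_statistic_def
  by (intro borel_measurable_sum borel_measurable_degeneracy borel_measurable_diff assms)
    (use block_index_less[of _ n K] in \<open>auto simp: Suc_le_eq intro: less_imp_le\<close>)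

text \<open>Convergence is asked of increments, not of values, because the approximating step
  integrals start at zero and do not reproduce the initial value of the process.\<close>

lemma rank_statistic_upper_semicontinuous:
  fixes x :: "nat \<Rightarrow> 'a::euclidean_space"
  assumes K: "0 < K" and lim: "\<And>i. i < n \<Longrightarrow> ((\<lambda>k. X k (Suc i) - X k i) \<longlongrightarrow> x (Suc i) - x i) F"
    and s: "rank_statistic K n x < s"
  shows "\<forall>\<^sub>F k in F. rank_statistic K n (X k) < s"
proof -
  define D where "D y j = degeneracy K (\<lambda>l. y (Suc (j * K + l)) - y (j * K + l) :: 'a)" for y j
  \<comment> \<open>The slack is shared among the blocks; \<open>Suc\<close> avoids division by zero
    and leaves one share over, which makes the final inequality strict.\<close>
  define g where "g = (s - rank_statistic K n x) / real (Suc (n div K))"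
  have g: "0 < g" using s by (simp add: g_def)
  have "\<forall>\<^sub>F k in F. D (X k) j < D x j + g" if j: "j < n div K" for j
    unfolding D_def
  proof (rule degeneracy_upper_semicontinuous[OF K])
    show "((\<lambda>k. X k (Suc (j * K + l)) - X k (j * K + l)) \<longlongrightarrow> x (Suc (j * K + l)) - x (j * K + l)) F"
      if "l < K" for l using lim block_index_less[OF j that] .
  qed (use g in simp)
  then have "\<forall>\<^sub>F k in F. \<forall>j\<in>{..<n div K}. D (X k) j < D x j + g"
    by (intro eventually_ball_finite) auto
  then show ?thesis
  proof eventually_elim
    case (elim k)
    have "rank_statistic K n (X k) \<le> (\<Sum>j<n div K. D x j + g)"
      unfolding rank_statistic_def D_def[symmetric] using elim by (intro sum_mono) (auto intro: less_imp_le)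
    also have "\<dots> = rank_statistic K n x + real (n div K) * g"
      by (simp add: sum.distrib rank_statistic_def D_def)
    also have "\<dots> < rank_statistic K n x + real (Suc (n div K)) * g" using g by simp
    also have "\<dots> = s" by (simp add: g_def)
    finally show ?case .
  qed
qed

section \<open>Independent increments with spread-out directions\<close>

lemma sets_Collect_countable_Bex:
  assumes C: "countable C" and P: "\<And>c. c \<in> C \<Longrightarrow> {x\<in>space M. P c x} \<in> sets M"
  shows "{x\<in>space M. \<exists>c\<in>C. P c x} \<in> sets M"
proof -
  have "{x\<in>space M. \<exists>c\<in>C. P c x} = (\<Union>c\<in>C. {x\<in>space M. P c x})" by auto
  then show ?thesis using C P by (simp only:) (rule sets.countable_UN', auto)
qed

context prob_space
begin

text \<open>Fubini in place of conditioning on \<open>Y\<close>: by independence the joint law is a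
  product, and a bound valid for every section integrates to the same bound.\<close>

lemma prob_le_of_sections:
  assumes ind: "indep_var N X N' Y" and A: "A \<in> sets (N \<Otimes>\<^sub>M N')" and p: "0 \<le> p"
    and sec: "\<And>y. y \<in> space N' \<Longrightarrow> prob {\<omega>\<in>space M. (X \<omega>, y) \<in> A} \<le> p"
  shows "prob {\<omega>\<in>space M. (X \<omega>, Y \<omega>) \<in> A} \<le> p"
proof -
  note [measurable] = indep_var_rv1[OF ind] indep_var_rv2[OF ind]
  interpret PX: prob_space "distr M N X" by (rule prob_space_distr) simp
  interpret PY: prob_space "distr M N' Y" by (rule prob_space_distr) simp
  interpret P: pair_prob_space "distr M N X" "distr M N' Y" ..
  have "emeasure M {\<omega>\<in>space M. (X \<omega>, Y \<omega>) \<in> A} = emeasure (distr M (N \<Otimes>\<^sub>M N') (\<lambda>\<omega>. (X \<omega>, Y \<omega>))) A"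
    using A by (subst emeasure_distr) (auto intro!: arg_cong2[where f=emeasure])
  also have "\<dots> = emeasure (distr M N X \<Otimes>\<^sub>M distr M N' Y) A"
    using ind by (simp add: indep_var_distribution_eq)
  also have "\<dots> = (\<integral>\<^sup>+y. emeasure (distr M N X) ((\<lambda>x. (x, y)) -` A) \<partial>distr M N' Y)"
    using A by (intro P.emeasure_pair_measure_alt2) simp
  also have "\<dots> \<le> (\<integral>\<^sup>+y. ennreal p \<partial>distr M N' Y)"
  proof (rule nn_integral_mono)
    fix y assume "y \<in> space (distr M N' Y)"
    then have y: "y \<in> space N'" by simp
    have "(\<lambda>x. (x, y)) -` A \<in> sets N" using A by (rule sets_Pair2)
    then have "emeasure (distr M N X) ((\<lambda>x. (x, y)) -` A) = emeasure M {\<omega>\<in>space M. (X \<omega>, y) \<in> A}"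
      by (subst emeasure_distr) (auto intro!: arg_cong2[where f=emeasure])
    also have "\<dots> \<le> ennreal p" using sec[OF y] by (simp add: emeasure_eq_measure ennreal_leI)
    finally show "emeasure (distr M N X) ((\<lambda>x. (x, y)) -` A) \<le> ennreal p" .
  qed
  also have "\<dots> = ennreal p" using PY.emeasure_space_1 by simp
  finally show ?thesis using p by (simp add: emeasure_eq_measure)
qed

text \<open>If \<open>c i = 1\<close> and \<open>\<Sum>l. c l *\<^sub>R X l\<close> is short, then so is \<open>u \<bullet> X i\<close> for every unit
  vector \<open>u\<close> orthogonal to the other vectors, and those are independent of \<open>X i\<close>.\<close>

lemma prob_degeneracy_small:
  fixes X :: "nat \<Rightarrow> 'a \<Rightarrow> 'b::euclidean_space"
  assumes K: "0 < K" and ind: "indep_vars (\<lambda>_. borel) X {p..<p+K}" and q: "0 \<le> q" and d: "0 < \<delta>"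
    and spread: "\<And>l U. l < K \<Longrightarrow> subspace U \<Longrightarrow> DIM('b) < dim U + K \<Longrightarrow>
      \<exists>u\<in>U. norm u = 1 \<and> (\<forall>m. prob {\<omega>\<in>space M. \<bar>u \<bullet> X (p + l) \<omega> + m\<bar> < \<delta>} \<le> q)"
  shows "prob {\<omega>\<in>space M. degeneracy K (\<lambda>l. X (p + l) \<omega>) < \<delta>\<^sup>2} \<le> real K * q"
proof -
  \<comment> \<open>Unit combinations are sorted by an index whose coefficient is one. The union
    bound over these indices is the origin of the factor \<open>K\<close>.\<close>
  define C where "C i = {c\<in>unit_combinations K. c i = 1}" for i
  have Ccount: "countable (C i)" for i
    by (rule countable_subset[OF _ countable_unit_combinations]) (auto simp: C_def)
  define E where "E i = {\<omega>\<in>space M. \<exists>c\<in>C i. (norm (\<Sum>l<K. c l *\<^sub>R X (p + l) \<omega>))\<^sup>2 < \<delta>\<^sup>2}" for i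
  have X [measurable]: "X (p + l) \<in> borel_measurable M" if "l < K" for l
    using ind that by (auto simp: indep_vars_def)
  have E_prob: "prob (E i) \<le> q" if i: "i < K" for i
  proof -
    let ?B = "{p..<p+K} - {p + i}"
    let ?N = "PiM {p + i} (\<lambda>_. borel :: 'b measure)" and ?N' = "PiM ?B (\<lambda>_. borel :: 'b measure)"
    define A where "A = {z\<in>space (?N \<Otimes>\<^sub>M ?N').
      \<exists>c\<in>C i. (norm (fst z (p + i) + (\<Sum>l\<in>{..<K} - {i}. c l *\<^sub>R snd z (p + l))))\<^sup>2 < \<delta>\<^sup>2}"
    have [measurable]: "(\<lambda>z. fst z (p + i)) \<in> borel_measurable (?N \<Otimes>\<^sub>M ?N')"
      by (rule measurable_compose[OF measurable_fst measurable_component_singleton]) simp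
    have comp2 [measurable]: "(\<lambda>z. snd z (p + l)) \<in> borel_measurable (?N \<Otimes>\<^sub>M ?N')" if "l \<in> {..<K} - {i}" for l
      by (rule measurable_compose[OF measurable_snd measurable_component_singleton]) (use that in simp)
    have A: "A \<in> sets (?N \<Otimes>\<^sub>M ?N')"
      unfolding A_def using Ccount by (intro sets_Collect_countable_Bex) measurable
    let ?R1 = "\<lambda>\<omega>. \<lambda>l\<in>{p + i}. X l \<omega>" and ?R2 = "\<lambda>\<omega>. \<lambda>l\<in>?B. X l \<omega>"
    have ind2: "indep_var ?N ?R1 ?N' ?R2"
      by (rule indep_var_restrict[OF ind]) (use i in auto)
    have R: "(?R1 \<omega>, ?R2 \<omega>) \<in> space (?N \<Otimes>\<^sub>M ?N')" for \<omega>
      by (auto simp: space_pair_measure space_PiM)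
    have split: "(\<Sum>l<K. c l *\<^sub>R X (p + l) \<omega>) = X (p + i) \<omega> + (\<Sum>l\<in>{..<K} - {i}. c l *\<^sub>R X (p + l) \<omega>)"
      if "c \<in> C i" for c \<omega>
      using i that by (subst sum.remove[of _ i]) (auto simp: C_def)
    have rest: "(\<Sum>l\<in>{..<K} - {i}. c l *\<^sub>R ?R2 \<omega> (p + l)) = (\<Sum>l\<in>{..<K} - {i}. c l *\<^sub>R X (p + l) \<omega>)" for c \<omega>
      by (rule sum.cong) auto
    have "(?R1 \<omega>, ?R2 \<omega>) \<in> A \<longleftrightarrow> (\<exists>c\<in>C i. (norm (\<Sum>l<K. c l *\<^sub>R X (p + l) \<omega>))\<^sup>2 < \<delta>\<^sup>2)" for \<omega>
    proof -
      have "(?R1 \<omega>, ?R2 \<omega>) \<in> A \<longleftrightarrow>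
          (\<exists>c\<in>C i. (norm (?R1 \<omega> (p + i) + (\<Sum>l\<in>{..<K} - {i}. c l *\<^sub>R ?R2 \<omega> (p + l))))\<^sup>2 < \<delta>\<^sup>2)"
        unfolding A_def using R[of \<omega>] by (simp only: mem_Collect_eq fst_conv snd_conv simp_thms)
      also have "\<dots> \<longleftrightarrow> (\<exists>c\<in>C i. (norm (\<Sum>l<K. c l *\<^sub>R X (p + l) \<omega>))\<^sup>2 < \<delta>\<^sup>2)"
        by (rule bex_cong[OF refl]) (simp only: rest split, simp)
      finally show ?thesis .
    qed
    then have "E i = {\<omega>\<in>space M. (?R1 \<omega>, ?R2 \<omega>) \<in> A}" by (simp only: E_def)
    moreover have "prob {\<omega>\<in>space M. (?R1 \<omega>, ?R2 \<omega>) \<in> A} \<le> q"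
    proof (rule prob_le_of_sections[OF ind2 A q])
      fix y assume "y \<in> space ?N'"
      \<comment> \<open>\<open>?W\<close> is spanned by at most \<open>K - 1\<close> vectors, so its
        complement \<open>U\<close> meets the dimension condition of \<open>spread\<close>. Once
        \<open>y\<close> is fixed, the direction obtained there is not random.\<close>
      let ?W = "span ((\<lambda>l. y (p + l)) ` ({..<K} - {i}))"
      define U where "U = {v. \<forall>w\<in>?W. orthogonal w v}"
      have U: "subspace U" by (auto simp: U_def subspace_def orthogonal_def inner_add_right)
      have "dim ?W \<le> card ((\<lambda>l. y (p + l)) ` ({..<K} - {i}))"
        unfolding dim_span by (rule dim_le_card') auto
      also have "\<dots> \<le> card ({..<K} - {i})" by (rule card_image_le) auto
      also have "\<dots> < K" using i by simp
      finally have "dim ?W < K" .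
      moreover have "dim U + dim ?W = DIM('b)"
        using dim_subspace_orthogonal_to_vectors[of ?W UNIV] by (simp add: U_def)
      ultimately have "DIM('b) < dim U + K" by simp
      then obtain u where u: "u \<in> U" "norm u = 1" and u_prob: "\<And>m. prob {\<omega>\<in>space M. \<bar>u \<bullet> X (p + i) \<omega> + m\<bar> < \<delta>} \<le> q"
        using spread[OF i U] by blast
      have "{\<omega>\<in>space M. (?R1 \<omega>, y) \<in> A} \<subseteq> {\<omega>\<in>space M. \<bar>u \<bullet> X (p + i) \<omega> + 0\<bar> < \<delta>}"
      proof safe
        fix \<omega> assume "\<omega> \<in> space M" "(?R1 \<omega>, y) \<in> A"
        then obtain c where c: "(norm (X (p + i) \<omega> + (\<Sum>l\<in>{..<K} - {i}. c l *\<^sub>R y (p + l))))\<^sup>2 < \<delta>\<^sup>2"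
          by (auto simp: A_def)
        let ?v = "\<Sum>l\<in>{..<K} - {i}. c l *\<^sub>R y (p + l)"
        have "?v \<in> ?W" by (intro span_sum span_scale span_base) auto
        then have "u \<bullet> ?v = 0" using u(1) by (auto simp: U_def orthogonal_def inner_commute)
        then have "\<bar>u \<bullet> X (p + i) \<omega> + 0\<bar> = \<bar>u \<bullet> (X (p + i) \<omega> + ?v)\<bar>" by (simp add: inner_add_right)
        also have "\<dots> \<le> norm (X (p + i) \<omega> + ?v)" using Cauchy_Schwarz_ineq2[of u] u(2) by simp
        also have "\<dots> < \<delta>" using c d by (meson less_le_not_le not_le power2_less_imp_less)
        finally show "\<bar>u \<bullet> X (p + i) \<omega> + 0\<bar> < \<delta>" .
      qed
      then have "prob {\<omega>\<in>space M. (?R1 \<omega>, y) \<in> A} \<le> prob {\<omega>\<in>space M. \<bar>u \<bullet> X (p + i) \<omega> + 0\<bar> < \<delta>}"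
        using i by (intro finite_measure_mono) measurable
      then show "prob {\<omega>\<in>space M. (?R1 \<omega>, y) \<in> A} \<le> q" using u_prob[of 0] by linarith
    qed
    ultimately show ?thesis by (simp only:)
  qed
  have comb_meas: "(\<lambda>\<omega>. \<Sum>l<K. c l *\<^sub>R X (p + l) \<omega>) \<in> borel_measurable M" for c
    by (intro borel_measurable_sum borel_measurable_scaleR borel_measurable_const X) simp
  have E_meas: "E i \<in> events" for i
    unfolding E_def
    by (rule sets_Collect_countable_Bex[OF Ccount])
      (intro borel_measurable_less borel_measurable_power borel_measurable_const
        measurable_compose[OF comb_meas borel_measurable_norm] measurable_ident_sets refl)
  have "{\<omega>\<in>space M. degeneracy K (\<lambda>l. X (p + l) \<omega>) < \<delta>\<^sup>2} \<subseteq> (\<Union>i<K. E i)"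
  proof
    fix \<omega> assume "\<omega> \<in> {\<omega>\<in>space M. degeneracy K (\<lambda>l. X (p + l) \<omega>) < \<delta>\<^sup>2}"
    then have \<omega>: "\<omega> \<in> space M" "degeneracy K (\<lambda>l. X (p + l) \<omega>) < \<delta>\<^sup>2" by auto
    then obtain c where c: "c \<in> unit_combinations K" "(norm (\<Sum>l<K. c l *\<^sub>R X (p + l) \<omega>))\<^sup>2 < \<delta>\<^sup>2"
      unfolding degeneracy_less_iff[OF K] by blast
    then obtain i where i: "i < K" "c \<in> C i" by (auto simp: C_def unit_combinations_def)
    then show "\<omega> \<in> (\<Union>i<K. E i)" using c(2) \<omega>(1) unfolding E_def by blast
  qed
  then have "prob {\<omega>\<in>space M. degeneracy K (\<lambda>l. X (p + l) \<omega>) < \<delta>\<^sup>2} \<le> prob (\<Union>i<K. E i)"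
    using E_meas by (intro finite_measure_mono) auto
  also have "\<dots> \<le> (\<Sum>i<K. prob (E i))"
    using E_meas by (intro finite_measure_subadditive_finite) auto
  also have "\<dots> \<le> real K * q" using E_prob sum_mono[of "{..<K}" "\<lambda>i. prob (E i)" "\<lambda>_. q"] by simp
  finally show ?thesis .
qed

text \<open>A Chernoff bound at rate \<open>2 / s\<close>. Each factor has mean at most
  \<open>1 / 5 + exp (-2) \<le> exp (-1)\<close>, according to whether \<open>D j\<close> is below
  \<open>s\<close> or not; the threshold \<open>s * card J / 4\<close> costs
  \<open>exp (card J / 2)\<close>, which leaves half of the exponent.\<close>

lemma prob_sum_small:
  fixes D :: "nat \<Rightarrow> 'a \<Rightarrow> real"
  assumes J: "finite J" and ind: "indep_vars (\<lambda>_. borel) D J"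
    and D: "\<And>j \<omega>. j \<in> J \<Longrightarrow> 0 \<le> D j \<omega>" and s: "0 < s"
    and small: "\<And>j. j \<in> J \<Longrightarrow> prob {\<omega>\<in>space M. D j \<omega> < s} \<le> 1 / 5"
  shows "prob {\<omega>\<in>space M. (\<Sum>j\<in>J. D j \<omega>) < s * real (card J) / 4} \<le> exp (- real (card J) / 2)"
proof -
  define f where "f x = exp (- (2 / s) * x)" for x :: real
  have D_meas [measurable]: "D j \<in> borel_measurable M" if "j \<in> J" for j
    using ind that by (auto simp: indep_vars_def)
  have f_meas [measurable]: "f \<in> borel_measurable borel" unfolding f_def by measurable
  have e2: "2 \<le> exp (1::real)" using exp_ge_add_one_self[of "1::real"] by simp
  have num: "1 / 5 + exp (-2) \<le> exp (-1::real)"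
  proof -
    define t where "t = exp (-1::real)"
    have t: "1 / 3 \<le> t" "t \<le> 1 / 2"
      using exp_le e2 by (auto simp: t_def exp_minus field_simps)
    have "exp (-2::real) = t * t" by (simp add: t_def exp_add[symmetric])
    \<comment> \<open>The product bounds \<open>t * t\<close> by its chord on
      \<open>[1/3, 1/2]\<close>, which reduces the claim to a linear inequality in
      \<open>t\<close>.\<close>
    moreover have "0 \<le> (t - 1/3) * (1/2 - t)" using t by simp
    ultimately show ?thesis using t unfolding t_def[symmetric] by (simp add: algebra_simps)
  qed
  have single: "(\<integral>\<^sup>+\<omega>. ennreal (f (D j \<omega>)) \<partial>M) \<le> ennreal (exp (-1))" if j: "j \<in> J" for j
  proof -
    have [measurable]: "D j \<in> borel_measurable M" using j by simp
    have "(\<integral>\<^sup>+\<omega>. ennreal (f (D j \<omega>)) \<partial>M) \<le>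
        (\<integral>\<^sup>+\<omega>. indicator {\<omega>\<in>space M. D j \<omega> < s} \<omega> + ennreal (exp (-2)) \<partial>M)"
    proof (rule nn_integral_mono)
      fix \<omega> assume \<omega>: "\<omega> \<in> space M"
      show "ennreal (f (D j \<omega>)) \<le> indicator {\<omega>\<in>space M. D j \<omega> < s} \<omega> + ennreal (exp (-2))"
      proof (cases "D j \<omega> < s")
        case True
        have "f (D j \<omega>) \<le> 1" using D[OF j] s by (simp add: f_def)
        then have "ennreal (f (D j \<omega>)) \<le> 1" by (simp add: ennreal_le_1)
        then show ?thesis using True \<omega> by (simp add: add_increasing2)
      next
        case False
        then have "f (D j \<omega>) \<le> exp (-2)" using s by (simp add: f_def field_simps)
        then show ?thesis using False by (simp add: ennreal_leI)
      qed
    qed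
    also have "\<dots> = ennreal (prob {\<omega>\<in>space M. D j \<omega> < s}) + ennreal (exp (-2))"
      by (subst nn_integral_add) (auto simp: emeasure_eq_measure prob_space)
    also have "\<dots> = ennreal (prob {\<omega>\<in>space M. D j \<omega> < s} + exp (-2))" by simp
    also have "\<dots> \<le> ennreal (exp (-1))" using small[OF j] num by (intro ennreal_leI) linarith
    finally show ?thesis .
  qed
  let ?m = "real (card J)"
  have "ennreal (prob {\<omega>\<in>space M. (\<Sum>j\<in>J. D j \<omega>) < s * ?m / 4}) =
      (\<integral>\<^sup>+\<omega>. indicator {\<omega>\<in>space M. (\<Sum>j\<in>J. D j \<omega>) < s * ?m / 4} \<omega> \<partial>M)"
    by (simp add: emeasure_eq_measure)
  also have "\<dots> \<le> (\<integral>\<^sup>+\<omega>. ennreal (exp (?m / 2)) * (\<Prod>j\<in>J. ennreal (f (D j \<omega>))) \<partial>M)"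
  proof (rule nn_integral_mono)
    fix \<omega>
    have "indicator {\<omega>\<in>space M. (\<Sum>j\<in>J. D j \<omega>) < s * ?m / 4} \<omega> \<le> ennreal (exp (?m / 2 - 2 / s * (\<Sum>j\<in>J. D j \<omega>)))"
    proof (cases "(\<Sum>j\<in>J. D j \<omega>) < s * ?m / 4")
      case True
      then have "0 \<le> ?m / 2 - 2 / s * (\<Sum>j\<in>J. D j \<omega>)" using s by (simp add: field_simps)
      then have "1 \<le> exp (?m / 2 - 2 / s * (\<Sum>j\<in>J. D j \<omega>))" by simp
      then show ?thesis by (simp add: indicator_def)
    qed simp
    also have "exp (?m / 2 - 2 / s * (\<Sum>j\<in>J. D j \<omega>)) = exp (?m / 2) * (\<Prod>j\<in>J. f (D j \<omega>))"
      by (simp add: f_def exp_sum[OF J, symmetric] exp_add[symmetric] sum_distrib_left sum_negf)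
    finally show "indicator {\<omega>\<in>space M. (\<Sum>j\<in>J. D j \<omega>) < s * ?m / 4} \<omega> \<le>
        ennreal (exp (?m / 2)) * (\<Prod>j\<in>J. ennreal (f (D j \<omega>)))"
      by (simp add: ennreal_mult prod_ennreal prod_nonneg f_def)
  qed
  also have "\<dots> = ennreal (exp (?m / 2)) * (\<Prod>j\<in>J. \<integral>\<^sup>+\<omega>. ennreal (f (D j \<omega>)) \<partial>M)"
  proof -
    have "indep_vars (\<lambda>_. borel) (\<lambda>j \<omega>. ennreal (f (D j \<omega>))) J"
      by (rule indep_vars_compose2[OF ind, where Y="\<lambda>_ x. ennreal (f x)"]) simp
    then show ?thesis
      using J by (subst nn_integral_cmult) (auto intro!: indep_vars_nn_integral arg_cong2[where f="(*)"])
  qed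
  also have "\<dots> \<le> ennreal (exp (?m / 2)) * (\<Prod>j\<in>J. ennreal (exp (-1)))"
    using single by (intro mult_left_mono prod_mono_ennreal) auto
  also have "\<dots> = ennreal (exp (- ?m / 2))"
    by (simp add: ennreal_power ennreal_mult[symmetric] exp_of_nat_mult[symmetric] exp_add[symmetric])
  finally show ?thesis by simp
qed

text \<open>With the increments \<open>Z\<close> held fixed, the blocks are built from
  \<open>S\<close> shifted by constants. This is why \<open>spread\<close> is uniform in the shift
  \<open>m\<close>, and why nothing but independence from \<open>S\<close> is asked of
  \<open>Z\<close>.\<close>

lemma prob_rank_statistic_small:
  fixes S Z :: "nat \<Rightarrow> 'a \<Rightarrow> 'b::euclidean_space" and Y :: "'a \<Rightarrow> nat \<Rightarrow> 'b"
  assumes K: "0 < K" and J: "J \<subseteq> {..<n div K}" and d: "0 < \<delta>"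
    and SZ: "indep_var (PiM {..<n} (\<lambda>_. borel)) (\<lambda>\<omega>. \<lambda>i\<in>{..<n}. S i \<omega>)
                       (PiM {..<n} (\<lambda>_. borel)) (\<lambda>\<omega>. \<lambda>i\<in>{..<n}. Z i \<omega>)"
    and S: "indep_vars (\<lambda>_. borel) S {..<n}"
    and spread: "\<And>j l U. j \<in> J \<Longrightarrow> l < K \<Longrightarrow> subspace U \<Longrightarrow> DIM('b) < dim U + K \<Longrightarrow>
      \<exists>u\<in>U. norm u = 1 \<and> (\<forall>m. prob {\<omega>\<in>space M. \<bar>u \<bullet> S (j * K + l) \<omega> + m\<bar> < \<delta>} \<le> 1 / (5 * real K))"
    and Y: "\<And>i \<omega>. i < n \<Longrightarrow> Y \<omega> (Suc i) - Y \<omega> i = S i \<omega> + Z i \<omega>"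
  shows "prob {\<omega>\<in>space M. rank_statistic K n (Y \<omega>) < \<delta>\<^sup>2 * real (card J) / 4} \<le> exp (- real (card J) / 2)"
proof -
  let ?N = "PiM {..<n} (\<lambda>_. borel :: 'b measure)"
  define T where "T x z = (\<Sum>j\<in>J. degeneracy K (\<lambda>l. x (j * K + l) + z (j * K + l) :: 'b))"
    for x z :: "nat \<Rightarrow> 'b"
  have fin: "finite J" using J finite_subset by blast
  have idx: "j * K + l \<in> {..<n}" if "j \<in> J" "l < K" for j l
    using block_index_less[of j n K l] subsetD[OF J that(1)] that(2) by simp
  let ?s = "\<delta>\<^sup>2 * real (card J) / 4"
  let ?A = "{w\<in>space (?N \<Otimes>\<^sub>M ?N). T (fst w) (snd w) < ?s}"
  have "(\<lambda>w. T (fst w) (snd w)) \<in> borel_measurable (?N \<Otimes>\<^sub>M ?N)"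
    unfolding T_def
  proof (intro borel_measurable_sum borel_measurable_degeneracy[OF K] borel_measurable_add)
    fix j l assume "j \<in> J" "l < K"
    note comp = measurable_component_singleton[OF idx[OF this], of "\<lambda>_. borel :: 'b measure"]
    show "(\<lambda>x. fst x (j * K + l)) \<in> borel_measurable (?N \<Otimes>\<^sub>M ?N)"
      by (rule measurable_compose[OF measurable_fst comp])
    show "(\<lambda>x. snd x (j * K + l)) \<in> borel_measurable (?N \<Otimes>\<^sub>M ?N)"
      by (rule measurable_compose[OF measurable_snd comp])
  qed
  then have A: "?A \<in> sets (?N \<Otimes>\<^sub>M ?N)" by measurable
  let ?RS = "\<lambda>\<omega>. \<lambda>i\<in>{..<n}. S i \<omega>" and ?RZ = "\<lambda>\<omega>. \<lambda>i\<in>{..<n}. Z i \<omega>"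
  have T_eq: "T (?RS \<omega>) z = (\<Sum>j\<in>J. degeneracy K (\<lambda>l. S (j * K + l) \<omega> + z (j * K + l)))" for \<omega> z
    unfolding T_def degeneracy_def
    by (intro sum.cong INF_cong arg_cong[where f="\<lambda>v. (norm v)\<^sup>2"] refl) (use idx in auto)
  have "prob {\<omega>\<in>space M. (?RS \<omega>, ?RZ \<omega>) \<in> ?A} \<le> exp (- real (card J) / 2)"
  proof (rule prob_le_of_sections[OF SZ A])
    fix z assume "z \<in> space ?N"
    define X where "X i \<omega> = S i \<omega> + z i" for i \<omega>
    define D where "D j \<omega> = degeneracy K (\<lambda>l. X (j * K + l) \<omega>)" for j \<omega>
    have X: "indep_vars (\<lambda>_. borel) X {..<n}"
      unfolding X_def by (rule indep_vars_compose2[OF S]) simp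
    have block: "{j * K..<j * K + K} \<subseteq> {..<n}" if "j \<in> J" for j
    proof
      fix i assume "i \<in> {j * K..<j * K + K}"
      then show "i \<in> {..<n}" using idx[OF that, of "i - j * K"] by auto
    qed
    have D_ind: "indep_vars (\<lambda>_. borel) D J"
    proof -
      have "disjoint_family_on (\<lambda>j. {j * K..<j * K + K}) J"
      proof (unfold disjoint_family_on_def, safe)
        fix i j x assume "i \<noteq> j" "x \<in> {i * K..<i * K + K}" "x \<in> {j * K..<j * K + K}"
        then have "x div K = i" "x div K = j" by (auto intro!: div_nat_eqI simp: mult.commute)
        then show "x \<in> {}" using \<open>i \<noteq> j\<close> by simp
      qed
      then have "indep_vars (\<lambda>j. PiM {j * K..<j * K + K} (\<lambda>_. borel))
          (\<lambda>j \<omega>. restrict (\<lambda>i. X i \<omega>) {j * K..<j * K + K}) J"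
        using block by (intro indep_vars_restrict[OF X]) auto
      then have "indep_vars (\<lambda>_. borel)
          (\<lambda>j \<omega>. degeneracy K (\<lambda>l. restrict (\<lambda>i. X i \<omega>) {j * K..<j * K + K} (j * K + l))) J"
        by (rule indep_vars_compose2[where Y="\<lambda>j x. degeneracy K (\<lambda>l. x (j * K + l))"])
          (intro borel_measurable_degeneracy[OF K] measurable_component_singleton, auto)
      also have "(\<lambda>j \<omega>. degeneracy K (\<lambda>l. restrict (\<lambda>i. X i \<omega>) {j * K..<j * K + K} (j * K + l))) = D"
        unfolding D_def degeneracy_def
        by (intro ext INF_cong arg_cong[where f="\<lambda>v. (norm v)\<^sup>2"] sum.cong refl) auto
      finally show ?thesis .
    qed
    have "prob {\<omega>\<in>space M. D j \<omega> < \<delta>\<^sup>2} \<le> 1 / 5" if j: "j \<in> J" for j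
    proof -
      \<comment> \<open>The bound \<open>1 / (5 * real K)\<close> per increment is chosen so that
        the union bound over a block gives the \<open>1 / 5\<close> required by
        \<open>prob_sum_small\<close>.\<close>
      have "prob {\<omega>\<in>space M. degeneracy K (\<lambda>l. X (j * K + l) \<omega>) < \<delta>\<^sup>2} \<le> real K * (1 / (5 * real K))"
      proof (rule prob_degeneracy_small[OF K _ _ d])
        show "indep_vars (\<lambda>_. borel) X {j * K..<j * K + K}" by (rule indep_vars_subset[OF X block[OF j]])
        fix l and U :: "'b set" assume "l < K" "subspace U" "DIM('b) < dim U + K"
        then obtain u where u: "u \<in> U" "norm u = 1"
          "\<And>m. prob {\<omega>\<in>space M. \<bar>u \<bullet> S (j * K + l) \<omega> + m\<bar> < \<delta>} \<le> 1 / (5 * real K)"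
          using spread[OF j] by blast
        have "prob {\<omega>\<in>space M. \<bar>u \<bullet> X (j * K + l) \<omega> + m\<bar> < \<delta>} \<le> 1 / (5 * real K)" for m
          using u(3)[of "u \<bullet> z (j * K + l) + m"] by (simp add: X_def inner_add_right add.assoc)
        then show "\<exists>u\<in>U. norm u = 1 \<and>
            (\<forall>m. prob {\<omega>\<in>space M. \<bar>u \<bullet> X (j * K + l) \<omega> + m\<bar> < \<delta>} \<le> 1 / (5 * real K))"
          using u by blast
      qed simp
      then show ?thesis using K by (simp add: D_def)
    qed
    then have "prob {\<omega>\<in>space M. (\<Sum>j\<in>J. D j \<omega>) < ?s} \<le> exp (- real (card J) / 2)"
      using d K by (intro prob_sum_small fin D_ind) (auto simp: D_def degeneracy_nonneg)
    moreover have "{\<omega>\<in>space M. (?RS \<omega>, z) \<in> ?A} = {\<omega>\<in>space M. (\<Sum>j\<in>J. D j \<omega>) < ?s}"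
      using \<open>z \<in> space ?N\<close> T_eq by (auto simp: space_pair_measure space_PiM D_def X_def)
    ultimately show "prob {\<omega>\<in>space M. (?RS \<omega>, z) \<in> ?A} \<le> exp (- real (card J) / 2)" by simp
  qed simp
  moreover have "prob {\<omega>\<in>space M. rank_statistic K n (Y \<omega>) < ?s} \<le> prob {\<omega>\<in>space M. (?RS \<omega>, ?RZ \<omega>) \<in> ?A}"
  proof (rule finite_measure_mono)
    show "{\<omega>\<in>space M. (?RS \<omega>, ?RZ \<omega>) \<in> ?A} \<in> events"
      using measurable_sets[OF measurable_Pair[OF indep_var_rv1[OF SZ] indep_var_rv2[OF SZ]] A]
      by (simp only: vimage_def Int_def mem_Collect_eq conj_commute)
    \<comment> \<open>Blocks outside \<open>J\<close> contribute nonnegative terms, so discarding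
      them only lowers the sum.\<close>
    have "T (?RS \<omega>) (?RZ \<omega>) \<le> rank_statistic K n (Y \<omega>)" for \<omega>
    proof -
      have "T (?RS \<omega>) (?RZ \<omega>) = (\<Sum>j\<in>J. degeneracy K (\<lambda>l. Y \<omega> (Suc (j * K + l)) - Y \<omega> (j * K + l)))"
        unfolding T_eq degeneracy_def
        by (intro sum.cong INF_cong arg_cong[where f="\<lambda>v. (norm v)\<^sup>2"] refl) (use idx Y in auto)
      also have "\<dots> \<le> rank_statistic K n (Y \<omega>)"
        unfolding rank_statistic_def using J K by (intro sum_mono2) (auto simp: degeneracy_nonneg)
      finally show ?thesis .
    qed
    then have "rank_statistic K n (Y \<omega>) < ?s \<Longrightarrow> T (?RS \<omega>) (?RZ \<omega>) < ?s" for \<omega>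
      by (rule le_less_trans)
    then show "{\<omega>\<in>space M. rank_statistic K n (Y \<omega>) < ?s} \<subseteq> {\<omega>\<in>space M. (?RS \<omega>, ?RZ \<omega>) \<in> ?A}"
      by (auto simp: space_pair_measure space_PiM)
  qed
  ultimately show ?thesis by linarith
qed

end

section \<open>Step integrals of Brownian motion\<close>

abbreviation grid_cell :: "nat \<Rightarrow> nat \<Rightarrow> real set" where
  "grid_cell n i \<equiv> {real i / real n<..real (Suc i) / real n}"

abbreviation step_increment ::
    "(real \<Rightarrow> 'w \<Rightarrow> real^'k) \<Rightarrow> ('k::finite, 'd::finite) step \<Rightarrow> nat \<Rightarrow> nat \<Rightarrow> 'w \<Rightarrow> real^'d" where
  "step_increment W xs n i \<omega> \<equiv>
    step_integral W xs (real (Suc i) / real n) \<omega> - step_integral W xs (real i / real n) \<omega>"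

abbreviation sampled_sum ::
    "nat \<Rightarrow> (real \<Rightarrow> 'w \<Rightarrow> real^'d) \<Rightarrow> (real \<Rightarrow> 'w \<Rightarrow> real^'d) \<Rightarrow> 'w \<Rightarrow> nat \<Rightarrow> real^'d" where
  "sampled_sum n X Z \<omega> \<equiv> \<lambda>i. X (real i / real n) \<omega> + Z (real i / real n) \<omega>"

lemma step_integral_Cons:
  "step_integral W ((a, b, c) # xs) t \<omega> = c *v (W (min b t) \<omega> - W (min a t) \<omega>) + step_integral W xs t \<omega>"
  by (simp add: step_integral_def)

lemma step_fun_Cons: "step_fun ((a, b, c) # xs) t = indicator {a<..b} t *\<^sub>R c + step_fun xs t"
  by (simp add: step_fun_def)

lemma borel_measurable_step_fun [measurable]: "step_fun xs \<in> borel_measurable borel"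
proof (induction xs)
  case Nil
  then show ?case by (simp add: step_fun_def[abs_def])
next
  case (Cons x xs)
  obtain a b c where x: "x = (a, b, c)" by (cases x)
  note [measurable] = Cons.IH
  show ?case unfolding x step_fun_Cons[abs_def] by measurable
qed

text \<open>No breakpoint of \<open>xs\<close> lies strictly between \<open>s\<close> and
  \<open>t\<close>, so the step function is constant on the half-open interval and its integral
  there is one matrix times one Brownian increment.\<close>

definition subordinate :: "('k::finite, 'd::finite) step \<Rightarrow> real \<Rightarrow> real \<Rightarrow> bool" where
  "subordinate xs s t \<longleftrightarrow> (\<forall>(a, b, c)\<in>set xs. (a \<le> s \<or> t \<le> a) \<and> (b \<le> s \<or> t \<le> b))"

lemma step_integral_increment:
  assumes "is_step xs" "subordinate xs s t" "s < t"
  shows "step_integral W xs t \<omega> - step_integral W xs s \<omega> = step_fun xs t *v (W t \<omega> - W s \<omega>)"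
  using assms(1,2)
proof (induction xs)
  case Nil
  then show ?case by (simp add: step_integral_def step_fun_def)
next
  case (Cons x xs)
  obtain a b c where x: "x = (a, b, c)" by (cases x)
  have "is_step xs" "subordinate xs s t" "a \<le> b"
    using Cons.prems by (auto simp: subordinate_def is_step_def x)
  then have IH: "step_integral W xs t \<omega> - step_integral W xs s \<omega> = step_fun xs t *v (W t \<omega> - W s \<omega>)"
    by (intro Cons.IH)
  have ab: "a \<le> s \<or> t \<le> a" "b \<le> s \<or> t \<le> b" using Cons.prems by (auto simp: subordinate_def x)
  have "c *v (W (min b t) \<omega> - W (min a t) \<omega>) - c *v (W (min b s) \<omega> - W (min a s) \<omega>) =
      indicator {a<..b} t *\<^sub>R (c *v (W t \<omega> - W s \<omega>))"
    using ab \<open>s < t\<close> \<open>a \<le> b\<close>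
    by (auto simp: min_def indicator_def matrix_vector_mult_diff_distrib[symmetric])
  then show ?case
    using IH unfolding x step_integral_Cons step_fun_Cons matrix_vector_mult_add_rdistrib
    by (simp add: scaleR_matrix_vector_assoc algebra_simps)
qed

lemma step_fun_const:
  assumes "subordinate xs s t" "s < r" "r \<le> t"
  shows "step_fun xs r = step_fun xs t"
  using assms(1)
proof (induction xs)
  case (Cons x xs)
  obtain a b c where x: "x = (a, b, c)" by (cases x)
  have ab: "a \<le> s \<or> t \<le> a" "b \<le> s \<or> t \<le> b" using Cons.prems by (auto simp: subordinate_def x)
  have "indicator {a<..b} r = (indicator {a<..b} t :: real)"
    using ab assms(2,3) by (auto simp: indicator_def)
  then show ?case using Cons by (simp add: x step_fun_Cons subordinate_def)
qed (simp add: step_fun_def)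

text \<open>Common refinement of the breakpoints of \<open>xs\<close> and a finite set
  \<open>G\<close>, later the observation grid. It expresses all observed increments through the
  same independent Brownian increments.\<close>

lemma step_partition:
  assumes xs: "is_step xs" and G: "finite G" "G \<subseteq> {0..1}"
  obtains N \<tau> where "0 \<le> \<tau> 0" "\<And>j. j < N \<Longrightarrow> \<tau> j < \<tau> (Suc j)" "\<tau> N \<le> (1::real)"
    "G \<subseteq> \<tau> ` {..N}" "\<And>j. j < N \<Longrightarrow> subordinate xs (\<tau> j) (\<tau> (Suc j))"
proof -
  \<comment> \<open>Inserting 0 keeps \<open>P\<close> nonempty, so its sorted list has length
    \<open>Suc N\<close> for some \<open>N\<close>.\<close>
  define P where "P = insert 0 (G \<union> fst ` set xs \<union> (\<lambda>x. fst (snd x)) ` set xs)"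
  have P: "finite P" "P \<subseteq> {0..1}" "P \<noteq> {}" using G xs by (auto simp: P_def is_step_def)
  define L where "L = sorted_list_of_set P"
  define N where "N = length L - 1"
  have L: "set L = P" "sorted_wrt (<) L" using P by (auto simp: L_def)
  have len: "length L = Suc N" using L P by (cases L) (auto simp: N_def)
  have mem: "L ! j \<in> P" if "j \<le> N" for j using L(1) len that by (metis le_imp_less_Suc nth_mem)
  have mono: "L ! i < L ! j" if "i < j" "j \<le> N" for i j
    using sorted_wrt_nth_less[OF L(2) that(1)] that len by simp
  have img: "P = (!) L ` {..N}"
    unfolding L(1)[symmetric] set_conv_nth len by (auto simp: less_Suc_eq_le)
  have gap: "p \<le> L ! j \<or> L ! Suc j \<le> p" if "p \<in> P" "j < N" for p j
  proof -
    obtain i where i: "i \<le> N" "p = L ! i" using \<open>p \<in> P\<close> img by auto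
    show ?thesis
    proof (cases "i \<le> j")
      case True
      then have "L ! i \<le> L ! j" using mono[of i j] that by (cases "i = j") auto
      then show ?thesis by (simp add: i)
    next
      case False
      then have "L ! Suc j \<le> L ! i" using mono[of "Suc j" i] i by (cases "i = Suc j") auto
      then show ?thesis by (simp add: i)
    qed
  qed
  show ?thesis
  proof (rule that[of "(!) L" N])
    show "0 \<le> L ! 0" "L ! N \<le> 1" using mem[of 0] mem[of N] P(2) by auto
    show "L ! j < L ! Suc j" if "j < N" for j using mono that by simp
    show "G \<subseteq> (!) L ` {..N}" unfolding img[symmetric] by (auto simp: P_def)
    show "subordinate xs (L ! j) (L ! Suc j)" if "j < N" for j
      unfolding subordinate_def
    proof (rule ballI, clarify)
      fix a b c assume abc: "(a, b, c) \<in> set xs"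
      have "fst (a, b, c) \<in> P" "fst (snd (a, b, c)) \<in> P" unfolding P_def using abc by blast+
      then show "(a \<le> L ! j \<or> L ! Suc j \<le> a) \<and> (b \<le> L ! j \<or> L ! Suc j \<le> b)"
        using gap[OF _ that] by (simp only: fst_conv snd_conv)
    qed
  qed
qed

context
  fixes xs :: "('k::finite, 'd::finite) step" and \<tau> :: "nat \<Rightarrow> real" and N :: nat
  assumes xs: "is_step xs" and \<tau>: "\<And>j. j < N \<Longrightarrow> \<tau> j < \<tau> (Suc j)"
    and sub: "\<And>j. j < N \<Longrightarrow> subordinate xs (\<tau> j) (\<tau> (Suc j))"
begin

lemma partition_less: "p < q \<Longrightarrow> q \<le> N \<Longrightarrow> \<tau> p < \<tau> q"
proof (induction q)
  case (Suc q)
  then show ?case using \<tau>[of q] by (cases "p = q") force+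
qed simp

lemma partition_le: "p \<le> q \<Longrightarrow> q \<le> N \<Longrightarrow> \<tau> p \<le> \<tau> q"
  using partition_less[of p q] by (cases "p = q") auto

lemma step_integral_diff:
  "p \<le> q \<Longrightarrow> q \<le> N \<Longrightarrow> step_integral W xs (\<tau> q) \<omega> - step_integral W xs (\<tau> p) \<omega> =
    (\<Sum>j\<in>{p..<q}. step_fun xs (\<tau> (Suc j)) *v (W (\<tau> (Suc j)) \<omega> - W (\<tau> j) \<omega>))"
proof (induction q rule: dec_induct)
  case (step q)
  then show ?case
    using step_integral_increment[OF xs sub[of q] \<tau>[of q], of W \<omega>] by (simp add: algebra_simps)
qed simp

lemma nn_integral_step_fun:
  assumes f [measurable]: "f \<in> borel_measurable borel" and pq: "p \<le> q" "q \<le> N"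
  shows "(\<integral>\<^sup>+s\<in>{\<tau> p<..\<tau> q}. ennreal (f (step_fun xs s)) \<partial>lborel) =
    (\<Sum>j\<in>{p..<q}. ennreal (f (step_fun xs (\<tau> (Suc j)))) * ennreal (\<tau> (Suc j) - \<tau> j))"
  using pq
proof (induction q rule: dec_induct)
  case (step q)
  have "\<tau> p \<le> \<tau> q" "\<tau> q \<le> \<tau> (Suc q)" using partition_le step by auto
  then have "indicator {\<tau> p<..\<tau> (Suc q)} s = (indicator {\<tau> p<..\<tau> q} s + indicator {\<tau> q<..\<tau> (Suc q)} s :: ennreal)" for s
    by (auto simp: indicator_def)
  then have "(\<integral>\<^sup>+s\<in>{\<tau> p<..\<tau> (Suc q)}. ennreal (f (step_fun xs s)) \<partial>lborel) =
      (\<integral>\<^sup>+s\<in>{\<tau> p<..\<tau> q}. ennreal (f (step_fun xs s)) \<partial>lborel) +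
      (\<integral>\<^sup>+s\<in>{\<tau> q<..\<tau> (Suc q)}. ennreal (f (step_fun xs s)) \<partial>lborel)"
    by (simp add: distrib_left nn_integral_add)
  also have "(\<integral>\<^sup>+s\<in>{\<tau> q<..\<tau> (Suc q)}. ennreal (f (step_fun xs s)) \<partial>lborel) =
      (\<integral>\<^sup>+s. ennreal (f (step_fun xs (\<tau> (Suc q)))) * indicator {\<tau> q<..\<tau> (Suc q)} s \<partial>lborel)"
  proof (rule nn_integral_cong)
    fix s
    have "step_fun xs s = step_fun xs (\<tau> (Suc q))" if "\<tau> q < s" "s \<le> \<tau> (Suc q)"
      using step_fun_const[OF sub that] step by simp
    then show "ennreal (f (step_fun xs s)) * indicator {\<tau> q<..\<tau> (Suc q)} s =
        ennreal (f (step_fun xs (\<tau> (Suc q)))) * indicator {\<tau> q<..\<tau> (Suc q)} s"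
      by (cases "s \<in> {\<tau> q<..\<tau> (Suc q)}") auto
  qed
  also have "\<dots> = ennreal (f (step_fun xs (\<tau> (Suc q)))) * ennreal (\<tau> (Suc q) - \<tau> q)"
    using \<open>\<tau> q \<le> \<tau> (Suc q)\<close> by (simp add: nn_integral_cmult_indicator)
  finally show ?case using step by simp
qed simp

end

section \<open>Gaussian linear combinations, second moments and small balls\<close>

context prob_space
begin

lemma normal_linear_combination:
  assumes I: "finite I" and ind: "indep_vars (\<lambda>_. borel) X I"
    and X: "\<And>i. i \<in> I \<Longrightarrow> 0 < \<sigma> i \<and> distributed M lborel (X i) (normal_density 0 (\<sigma> i))"
    and V: "0 < (\<Sum>i\<in>I. (a i)\<^sup>2 * (\<sigma> i)\<^sup>2)"
  shows "distributed M lborel (\<lambda>\<omega>. \<Sum>i\<in>I. a i * X i \<omega>)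
    (normal_density 0 (sqrt (\<Sum>i\<in>I. (a i)\<^sup>2 * (\<sigma> i)\<^sup>2)))"
proof -
  \<comment> \<open>Terms with coefficient zero are removed first: they have standard deviation zero
    and hence no normal density.\<close>
  define I' where "I' = {i\<in>I. a i \<noteq> 0}"
  have I': "finite I'" "I' \<subseteq> I" using I by (auto simp: I'_def)
  have sum_eq: "(\<Sum>i\<in>I. (a i)\<^sup>2 * (\<sigma> i)\<^sup>2) = (\<Sum>i\<in>I'. (\<bar>a i\<bar> * \<sigma> i)\<^sup>2)"
    using I by (intro sum.mono_neutral_cong_right) (auto simp: I'_def power_mult_distrib)
  have sum_eq': "(\<Sum>i\<in>I. a i * X i \<omega>) = (\<Sum>i\<in>I'. a i * X i \<omega>)" for \<omega>
    using I by (intro sum.mono_neutral_right) (auto simp: I'_def)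
  have "distributed M lborel (\<lambda>\<omega>. \<Sum>i\<in>I'. a i * X i \<omega>)
      (normal_density (\<Sum>i\<in>I'. 0) (sqrt (\<Sum>i\<in>I'. (\<bar>a i\<bar> * \<sigma> i)\<^sup>2)))"
  proof (rule sum_indep_normal[OF I'(1)])
    show "I' \<noteq> {}" using V unfolding sum_eq by auto
    show "indep_vars (\<lambda>_. borel) (\<lambda>i \<omega>. a i * X i \<omega>) I'"
      by (rule indep_vars_compose2[OF indep_vars_subset[OF ind I'(2)], where Y="\<lambda>i x. a i * x"]) simp
    fix i assume i: "i \<in> I'"
    then have "i \<in> I" "a i \<noteq> 0" by (auto simp: I'_def)
    then show "0 < \<bar>a i\<bar> * \<sigma> i" using X by simp
    show "distributed M lborel (\<lambda>\<omega>. a i * X i \<omega>) (normal_density 0 (\<bar>a i\<bar> * \<sigma> i))"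
      using normal_density_affine[of "X i" 0 "\<sigma> i" "a i" 0] X[OF \<open>i \<in> I\<close>] \<open>a i \<noteq> 0\<close> by simp
  qed
  then show ?thesis by (simp add: sum_eq sum_eq')
qed

lemma normal_second_moment:
  assumes s: "0 < \<sigma>" and X: "distributed M lborel X (normal_density 0 \<sigma>)"
  shows "(\<integral>\<^sup>+\<omega>. ennreal ((X \<omega>)\<^sup>2) \<partial>M) = ennreal (\<sigma>\<^sup>2)"
proof -
  have "has_bochner_integral lborel (\<lambda>x. normal_density 0 \<sigma> x * (x - 0)^(2 * 1)) (fact (2 * 1) / ((2 / \<sigma>\<^sup>2)^1 * fact 1))"
    using s by (rule normal_moment_even)
  then have "has_bochner_integral lborel (\<lambda>x. normal_density 0 \<sigma> x * x\<^sup>2) (\<sigma>\<^sup>2)" by simp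
  then have "(\<integral>\<^sup>+x. ennreal (normal_density 0 \<sigma> x * x\<^sup>2) \<partial>lborel) = ennreal (\<sigma>\<^sup>2)"
    by (subst nn_integral_eq_integral) (auto simp: has_bochner_integral_iff normal_density_nonneg)
  moreover have "(\<integral>\<^sup>+\<omega>. ennreal ((X \<omega>)\<^sup>2) \<partial>M) = (\<integral>\<^sup>+x. ennreal (normal_density 0 \<sigma> x) * ennreal (x\<^sup>2) \<partial>lborel)"
    by (rule distributed_nn_integral[OF X, symmetric]) simp
  ultimately show ?thesis by (simp add: ennreal_mult normal_density_nonneg)
qed

text \<open>The density is at most \<open>1 / (2 * \<sigma>)\<close>, since
  \<open>sqrt (2 * pi)\<close> is at least 2, and the interval has length
  \<open>2 * \<delta>\<close> for any shift \<open>m\<close>.\<close>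

lemma normal_small_ball:
  assumes s: "0 < \<sigma>" and X: "distributed M lborel X (normal_density 0 \<sigma>)" and d: "0 \<le> \<delta>"
  shows "prob {\<omega>\<in>space M. \<bar>X \<omega> + m\<bar> < \<delta>} \<le> \<delta> / \<sigma>"
proof -
  have pi: "2 \<le> sqrt (2 * pi)" using pi_ge_two by (intro real_le_rsqrt) simp
  have dens: "normal_density 0 \<sigma> x \<le> 1 / (2 * \<sigma>)" for x
  proof -
    have "normal_density 0 \<sigma> x \<le> 1 / sqrt (2 * pi * \<sigma>\<^sup>2)"
      by (simp add: normal_density_def mult_left_le divide_right_mono)
    also have "\<dots> = 1 / (sqrt (2 * pi) * \<sigma>)" using s by (simp add: real_sqrt_mult)
    also have "\<dots> \<le> 1 / (2 * \<sigma>)" using pi s by (intro divide_left_mono mult_right_mono) auto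
    finally show ?thesis .
  qed
  have eq: "{\<omega>\<in>space M. \<bar>X \<omega> + m\<bar> < \<delta>} = X -` {-m-\<delta><..<-m+\<delta>} \<inter> space M" by auto
  have "emeasure M {\<omega>\<in>space M. \<bar>X \<omega> + m\<bar> < \<delta>} =
      (\<integral>\<^sup>+x. ennreal (normal_density 0 \<sigma> x) * indicator {-m-\<delta><..<-m+\<delta>} x \<partial>lborel)"
    unfolding eq by (rule distributed_emeasure[OF X]) simp
  also have "\<dots> \<le> (\<integral>\<^sup>+x. ennreal (1 / (2 * \<sigma>)) * indicator {-m-\<delta><..<-m+\<delta>} x \<partial>lborel)"
    using dens by (intro nn_integral_mono mult_right_mono ennreal_leI) auto
  also have "\<dots> = ennreal (1 / (2 * \<sigma>)) * ennreal (2 * \<delta>)"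
    using d by (simp add: nn_integral_cmult_indicator)
  also have "\<dots> = ennreal (\<delta> / \<sigma>)" using d s by (simp add: ennreal_mult[symmetric])
  finally show ?thesis using d s by (simp add: emeasure_eq_measure)
qed

end

lemma borel_measurable_transpose_mult [measurable]:
  "(\<lambda>A :: real^'k^'d. (norm (transpose A *v u))\<^sup>2) \<in> borel_measurable borel"
proof -
  have "linear (\<lambda>A :: real^'k^'d. transpose A *v u)"
    by (rule linearI) (simp_all add: transpose_def matrix_vector_mult_def vec_eq_iff algebra_simps
        sum.distrib sum_distrib_left)
  then have "continuous_on UNIV (\<lambda>A :: real^'k^'d. transpose A *v u)"
    by (simp add: linear_continuous_on linear_conv_bounded_linear)
  then have "continuous_on UNIV (\<lambda>A :: real^'k^'d. (norm (transpose A *v u))\<^sup>2)"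
    by (intro continuous_intros)
  then show ?thesis by (rule borel_measurable_continuous_onI)
qed

lemma borel_measurable_matrix_vector_mult [measurable (raw)]:
  fixes C :: "real^'k^'d"
  shows "X \<in> borel_measurable M \<Longrightarrow> (\<lambda>x. C *v X x) \<in> borel_measurable M"
  by (rule measurable_compose[OF _ borel_measurable_continuous_onI[OF matrix_vector_mult_linear_continuous_on]])

context prob_space
begin

text \<open>Each observed increment is a linear combination of independent centred Gaussian scalars,
  taken from the cells of a refined partition within one observation interval. Distinct intervals
  use disjoint cells, and the variance in direction \<open>u\<close> is the integral
  \<open>Q\<close>.\<close>

lemma step_integral_increments:
  fixes W :: "real \<Rightarrow> 'a \<Rightarrow> real^'k::finite" and xs :: "('k, 'd::finite) step"
  assumes W: "standard_brownian_motion M W" and xs: "is_step xs" and n: "1 \<le> n"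
  defines "S \<equiv> \<lambda>i \<omega>. step_increment W xs n i \<omega>"
    and "Q \<equiv> \<lambda>i u. \<integral>\<^sup>+s\<in>(grid_cell n i).
      ennreal ((norm (transpose (step_fun xs s) *v u))\<^sup>2) \<partial>lborel"
  shows step_increments_indep: "indep_vars (\<lambda>_. borel) S {..<n}"
    and step_increments_second_moment:
      "\<And>i u. i < n \<Longrightarrow> (\<integral>\<^sup>+\<omega>. ennreal ((u \<bullet> S i \<omega>)\<^sup>2) \<partial>M) = Q i u"
    and step_increments_small_ball:
      "\<And>i u \<gamma> \<delta> m. i < n \<Longrightarrow> 0 < \<gamma> \<Longrightarrow> 0 \<le> \<delta> \<Longrightarrow> ennreal \<gamma> \<le> Q i u \<Longrightarrow>
        prob {\<omega>\<in>space M. \<bar>u \<bullet> S i \<omega> + m\<bar> < \<delta>} \<le> \<delta> / sqrt \<gamma>"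
proof -
  have "(\<lambda>i. real i / real n) ` {..n} \<subseteq> {0..1}" using n by auto
  then obtain N \<tau> where \<tau>: "0 \<le> \<tau> 0" "\<And>j. j < N \<Longrightarrow> \<tau> j < \<tau> (Suc j)" "\<tau> N \<le> 1"
    and grid: "(\<lambda>i. real i / real n) ` {..n} \<subseteq> \<tau> ` {..N}"
    and sub: "\<And>j. j < N \<Longrightarrow> subordinate xs (\<tau> j) (\<tau> (Suc j))"
    by (rule step_partition[OF xs finite_imageI[OF finite_atMost]]) blast
  note part_le = partition_le[where \<tau>=\<tau> and N=N, OF xs \<tau>(2) sub]
  \<comment> \<open>\<open>p i\<close> will be the position of the grid point \<open>i / n\<close>
    in the partition, so the cells of observation interval \<open>i\<close> are those from
    \<open>p i\<close> to \<open>p (Suc i) - 1\<close>.\<close>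
  have "\<exists>k. i \<le> n \<longrightarrow> k \<le> N \<and> \<tau> k = real i / real n" for i
    using grid by (cases "i \<le> n") force+
  then obtain p where p: "\<And>i. i \<le> n \<Longrightarrow> p i \<le> N \<and> \<tau> (p i) = real i / real n" by metis
  have p_less: "p i < p j" if "i < j" "j \<le> n" for i j
  proof (rule ccontr)
    assume "\<not> p i < p j"
    then have "\<tau> (p j) \<le> \<tau> (p i)" using p[of i] that by (intro part_le) auto
    then show False using p[of i] p[of j] that n by (simp add: divide_le_cancel)
  qed
  have p_le: "p i \<le> p j" if "i \<le> j" "j \<le> n" for i j
    using p_less[of i j] that by (cases "i = j") auto
  define X where "X = (\<lambda>(j, l) \<omega>. (W (\<tau> (Suc j)) \<omega> - W (\<tau> j) \<omega>) $ l)"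
  define C where "C j = step_fun xs (\<tau> (Suc j))" for j
  define I where "I i = {p i..<p (Suc i)} \<times> (UNIV :: 'k set)" for i
  have I_sub: "I i \<subseteq> {..<N} \<times> UNIV" if "i < n" for i
    using p[of "Suc i"] that by (auto simp: I_def)
  have X_ind: "indep_vars (\<lambda>_. borel) X ({..<N} \<times> UNIV)"
    using W \<tau> unfolding standard_brownian_motion_def X_def by blast
  have tau01: "0 \<le> \<tau> j" "\<tau> (Suc j) \<le> 1" if "j < N" for j
    using part_le[of 0 j] part_le[of "Suc j" N] \<tau>(1,3) that by auto
  have X_normal: "0 < sqrt (\<tau> (Suc j) - \<tau> j) \<and>
      distributed M lborel (X (j, l)) (normal_density 0 (sqrt (\<tau> (Suc j) - \<tau> j)))" if "j < N" for j l
    using W \<tau>(2)[OF that] tau01[OF that] unfolding standard_brownian_motion_def X_def by auto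
  have S_eq: "S i \<omega> = (\<Sum>j\<in>{p i..<p (Suc i)}. C j *v (\<chi> l. X (j, l) \<omega>))" if i: "i < n" for i \<omega>
  proof -
    have "S i \<omega> = step_integral W xs (\<tau> (p (Suc i))) \<omega> - step_integral W xs (\<tau> (p i)) \<omega>"
      using p[of i] p[of "Suc i"] i by (simp add: S_def)
    also have "\<dots> = (\<Sum>j\<in>{p i..<p (Suc i)}. C j *v (W (\<tau> (Suc j)) \<omega> - W (\<tau> j) \<omega>))"
      unfolding C_def using p_le[of i "Suc i"] p[of "Suc i"] i by (intro step_integral_diff[where \<tau>=\<tau> and N=N, OF xs \<tau>(2) sub]) auto
    also have "\<dots> = (\<Sum>j\<in>{p i..<p (Suc i)}. C j *v (\<chi> l. X (j, l) \<omega>))"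
      by (intro sum.cong arg_cong2[where f="(*v)"] refl) (simp add: X_def vec_eq_iff)
    finally show ?thesis .
  qed
  show S_ind: "indep_vars (\<lambda>_. borel) S {..<n}"
  proof -
    have "disjoint_family_on I {..<n}"
    proof (unfold disjoint_family_on_def, intro ballI impI)
      fix i j assume ij: "i \<in> {..<n}" "j \<in> {..<n}" "i \<noteq> j"
      have "p (Suc i) \<le> p j \<or> p (Suc j) \<le> p i" using ij p_le[of "Suc i" j] p_le[of "Suc j" i] by force
      then show "I i \<inter> I j = {}" by (auto simp: I_def)
    qed
    then have "indep_vars (\<lambda>i. PiM (I i) (\<lambda>_. borel)) (\<lambda>i \<omega>. restrict (\<lambda>x. X x \<omega>) (I i)) {..<n}"
      using I_sub by (intro indep_vars_restrict[OF X_ind]) auto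
    then have "indep_vars (\<lambda>_. borel)
        (\<lambda>i \<omega>. \<Sum>j\<in>{p i..<p (Suc i)}. C j *v (\<chi> l. restrict (\<lambda>x. X x \<omega>) (I i) (j, l))) {..<n}"
    proof (rule indep_vars_compose2[where Y="\<lambda>i x. \<Sum>j\<in>{p i..<p (Suc i)}. C j *v (\<chi> l. x (j, l))"])
      fix i
      show "(\<lambda>x. \<Sum>j\<in>{p i..<p (Suc i)}. C j *v (\<chi> l. x (j, l))) \<in> borel_measurable (PiM (I i) (\<lambda>_. borel))"
      proof (intro borel_measurable_sum borel_measurable_matrix_vector_mult)
        fix j assume "j \<in> {p i..<p (Suc i)}"
        then have "(\<lambda>x. x (j, l)) \<in> borel_measurable (PiM (I i) (\<lambda>_. borel :: real measure))" for l
          by (intro measurable_component_singleton) (simp add: I_def)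
        then show "(\<lambda>x. \<chi> l. x (j, l)) \<in> borel_measurable (PiM (I i) (\<lambda>_. borel :: real measure))"
          by (subst borel_measurable_euclidean_space) (auto simp: Basis_vec_def inner_axis)
      qed
    qed
    also have "?this \<longleftrightarrow> indep_vars (\<lambda>_. borel) S {..<n}"
      by (intro indep_vars_cong refl ext)
        (auto simp: S_eq I_def intro!: sum.cong arg_cong2[where f="(*v)"] simp: vec_eq_iff)
    finally show ?thesis .
  qed
  define a where "a u = (\<lambda>(j, l). (transpose (C j) *v u) $ l)" for u
  have uS: "u \<bullet> S i \<omega> = (\<Sum>x\<in>I i. a u x * X x \<omega>)" if i: "i < n" for i u \<omega>
  proof -
    have "u \<bullet> S i \<omega> = (\<Sum>j\<in>{p i..<p (Suc i)}. (transpose (C j) *v u) \<bullet> (\<chi> l. X (j, l) \<omega>))"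
      by (simp add: S_eq[OF i] inner_sum_right dot_lmul_matrix[symmetric] transpose_matrix_vector)
    also have "\<dots> = (\<Sum>j\<in>{p i..<p (Suc i)}. \<Sum>l\<in>UNIV. a u (j, l) * X (j, l) \<omega>)"
      by (simp add: inner_vec_def a_def)
    finally show ?thesis by (simp add: I_def sum.cartesian_product)
  qed
  define v where "v = (\<lambda>(j, l :: 'k). sqrt (\<tau> (Suc j) - \<tau> j))"
  have v: "0 < v x \<and> distributed M lborel (X x) (normal_density 0 (v x))" if "x \<in> {..<N} \<times> UNIV" for x
    using X_normal that by (auto simp: v_def)
  define V where "V i u = (\<Sum>x\<in>I i. (a u x)\<^sup>2 * (v x)\<^sup>2)" for i u
  have V_nonneg: "0 \<le> V i u" for i u unfolding V_def by (intro sum_nonneg) auto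
  have Q_eq: "Q i u = ennreal (V i u)" if i: "i < n" for i u
  proof -
    have "Q i u = (\<Sum>j\<in>{p i..<p (Suc i)}. ennreal ((norm (transpose (C j) *v u))\<^sup>2) * ennreal (\<tau> (Suc j) - \<tau> j))"
      using nn_integral_step_fun[where \<tau>=\<tau> and N=N, OF xs \<tau>(2) sub borel_measurable_transpose_mult, of "p i" "p (Suc i)" u]
        p[of i] p[of "Suc i"] p_le[of i "Suc i"] i by (simp add: Q_def C_def)
    also have "\<dots> = (\<Sum>j\<in>{p i..<p (Suc i)}. ennreal (\<Sum>l\<in>UNIV. (a u (j, l))\<^sup>2 * (v (j, l))\<^sup>2))"
    proof (rule sum.cong[OF refl])
      fix j assume "j \<in> {p i..<p (Suc i)}"
      then have "j < N" using p[of "Suc i"] i by simp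
      then have "0 \<le> \<tau> (Suc j) - \<tau> j" using \<tau>(2)[of j] by simp
      then show "ennreal ((norm (transpose (C j) *v u))\<^sup>2) * ennreal (\<tau> (Suc j) - \<tau> j) =
          ennreal (\<Sum>l\<in>UNIV. (a u (j, l))\<^sup>2 * (v (j, l))\<^sup>2)"
        by (simp add: a_def v_def norm_eq_sqrt_inner inner_vec_def sum_nonneg ennreal_mult[symmetric]
            sum_distrib_right power2_eq_square)
    qed
    also have "\<dots> = ennreal (V i u)"
      by (subst sum_ennreal) (auto simp: V_def I_def sum.cartesian_product intro!: sum_nonneg)
    finally show ?thesis .
  qed
  have I_fin: "finite (I i)" for i by (simp add: I_def)
  have normal: "distributed M lborel (\<lambda>\<omega>. u \<bullet> S i \<omega>) (normal_density 0 (sqrt (V i u)))"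
    if i: "i < n" and V: "0 < V i u" for i u
    unfolding uS[OF i] V_def
    using v I_sub[OF i] V by (intro normal_linear_combination indep_vars_subset[OF X_ind] I_fin) (auto simp: V_def)
  show "(\<integral>\<^sup>+\<omega>. ennreal ((u \<bullet> S i \<omega>)\<^sup>2) \<partial>M) = Q i u" if i: "i < n" for i u
  \<comment> \<open>A direction of zero variance has no density; there all coefficients vanish, and
    with them the component itself.\<close>
  proof (cases "V i u = 0")
    case True
    have "a u x = 0" if x: "x \<in> I i" for x
    proof -
      have "(a u x)\<^sup>2 * (v x)\<^sup>2 = 0"
        using True x I_fin unfolding V_def by (subst (asm) sum_nonneg_eq_0_iff) auto
      then show ?thesis using v[of x] I_sub[OF i] x by auto
    qed
    then show ?thesis using True by (simp add: uS[OF i] Q_eq[OF i])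
  next
    case False
    then have "0 < V i u" using V_nonneg[of i u] by simp
    then show ?thesis using normal_second_moment[OF _ normal[OF i]] V_nonneg by (simp add: Q_eq[OF i])
  qed
  show "prob {\<omega>\<in>space M. \<bar>u \<bullet> S i \<omega> + m\<bar> < \<delta>} \<le> \<delta> / sqrt \<gamma>"
    if i: "i < n" and g: "0 < \<gamma>" and d: "0 \<le> \<delta>" and Q: "ennreal \<gamma> \<le> Q i u" for i u \<gamma> \<delta> m
  proof -
    have V: "\<gamma> \<le> V i u" using Q V_nonneg by (simp add: Q_eq[OF i])
    have "prob {\<omega>\<in>space M. \<bar>u \<bullet> S i \<omega> + m\<bar> < \<delta>} \<le> \<delta> / sqrt (V i u)"
      using V g by (intro normal_small_ball normal[OF i] d) auto
    also have "\<dots> \<le> \<delta> / sqrt \<gamma>" using V g d by (intro divide_left_mono) auto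
    finally show ?thesis .
  qed
qed

end

text \<open>The step integral of the coordinate process \<open>\<lambda>t x. x t\<close> is a functional on path space.\<close>

definition step_increments :: "nat \<Rightarrow> ('k::finite, 'd::finite) step \<Rightarrow> (real \<Rightarrow> real^'k) \<Rightarrow> nat \<Rightarrow> real^'d" where
  "step_increments n xs x = (\<lambda>i\<in>{..<n}. step_integral (\<lambda>t x. x t) xs (real (Suc i) / real n) x -
    step_integral (\<lambda>t x. x t) xs (real i / real n) x)"

lemma is_step_Cons: "is_step ((a, b, c) # xs) \<longleftrightarrow> 0 \<le> a \<and> a \<le> b \<and> b \<le> 1 \<and> is_step xs"
  by (auto simp: is_step_def)

lemma borel_measurable_step_integral_path:
  assumes "is_step xs" "t \<in> {0..1}"
  shows "(\<lambda>x. step_integral (\<lambda>t x. x t) xs t x) \<in> borel_measurable (PiM {0..1} (\<lambda>_. borel))"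
  using assms(1)
proof (induction xs)
  case Nil
  then show ?case by (simp add: step_integral_def)
next
  case (Cons z xs)
  obtain a b c where z: "z = (a, b, c)" by (cases z)
  have "min a t \<in> {0..1}" "min b t \<in> {0..1}" "is_step xs"
    using Cons.prems assms(2) by (auto simp: is_step_Cons z)
  then show ?case unfolding z step_integral_Cons
    by (intro borel_measurable_add borel_measurable_matrix_vector_mult borel_measurable_diff
        measurable_component_singleton Cons.IH)
qed

lemma step_integral_path:
  assumes "is_step xs" "t \<in> {0..1}"
  shows "step_integral (\<lambda>t x. x t) xs t (\<lambda>t\<in>{0..1}. W t \<omega>) = step_integral W xs t \<omega>"
  using assms(1)
proof (induction xs)
  case (Cons z xs)
  obtain a b c where z: "z = (a, b, c)" by (cases z)
  have "min a t \<in> {0..1}" "min b t \<in> {0..1}" "is_step xs"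
    using Cons.prems assms(2) by (auto simp: is_step_Cons z)
  then show ?case using Cons.IH by (simp add: z step_integral_Cons)
qed (simp add: step_integral_def)

lemma grid_in_unit_interval: "i < n \<Longrightarrow> real (Suc i) / real n \<in> {0..1}" "i < n \<Longrightarrow> real i / real n \<in> {0..1}"
  by auto

lemma measurable_step_increments:
  "is_step xs \<Longrightarrow> step_increments n xs \<in> measurable (PiM {0..1} (\<lambda>_. borel)) (PiM {..<n} (\<lambda>_. borel))"
  unfolding step_increments_def
  by (intro measurable_restrict borel_measurable_diff borel_measurable_step_integral_path)
    (auto intro: grid_in_unit_interval simp del: of_nat_Suc)

lemma step_increments_path:
  "is_step xs \<Longrightarrow> step_increments n xs (\<lambda>t\<in>{0..1}. W t \<omega>) =
    (\<lambda>i\<in>{..<n}. step_increment W xs n i \<omega>)"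
  unfolding step_increments_def
  by (intro restrict_ext) (simp only: step_integral_path grid_in_unit_interval lessThan_iff)

context prob_space
begin

lemma measurable_path:
  fixes W :: "real \<Rightarrow> 'a \<Rightarrow> real^'k::finite"
  assumes "standard_brownian_motion M W"
  shows "(\<lambda>\<omega>. \<lambda>t\<in>{0..1}. W t \<omega>) \<in> measurable M (PiM {0..1} (\<lambda>_. borel))"
  using assms by (intro measurable_restrict) (auto simp: standard_brownian_motion_def)

text \<open>\<open>indep_var\<close> refers to generated sigma-algebras, whereas the model states
  independence of the families of preimages; the two agree because preimages already form a
  sigma-algebra.\<close>

lemma sigma_sets_process_events:
  fixes W :: "real \<Rightarrow> 'a \<Rightarrow> real^'k::finite"
  assumes W: "standard_brownian_motion M W"
  shows "sigma_sets (space M) (process_events M W) = process_events M W"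
proof -
  have "process_events M W = sets (vimage_algebra (space M) (\<lambda>\<omega>. \<lambda>t\<in>{0..1}. W t \<omega>) (PiM {0..1} (\<lambda>_. borel)))"
    unfolding process_events_def using measurable_space[OF measurable_path[OF W]]
    by (subst sets_vimage_algebra2) auto
  then show ?thesis by (metis sets.sigma_sets_eq space_vimage_algebra)
qed

lemma sigma_sets_step_increments:
  fixes W :: "real \<Rightarrow> 'a \<Rightarrow> real^'k::finite" and xs :: "('k, 'd::finite) step"
  assumes W: "standard_brownian_motion M W" and xs: "is_step xs"
  shows "sigma_sets (space M) {(\<lambda>\<omega>. step_increments n xs (\<lambda>t\<in>{0..1}. W t \<omega>)) -` A \<inter> space M |A.
    A \<in> sets (PiM {..<n} (\<lambda>_. borel))} \<subseteq> process_events M W"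
proof -
  let ?P = "\<lambda>\<omega>. \<lambda>t\<in>{0..1}. W t \<omega>"
  have "(\<lambda>\<omega>. step_increments n xs (?P \<omega>)) -` A \<inter> space M \<in> process_events M W"
    if A: "A \<in> sets (PiM {..<n} (\<lambda>_. borel))" for A
  proof -
    let ?A = "step_increments n xs -` A \<inter> space (PiM {0..1} (\<lambda>_. borel :: (real^'k) measure))"
    have "?A \<in> sets (PiM {0..1} (\<lambda>_. borel))" by (rule measurable_sets[OF measurable_step_increments[OF xs] A])
    moreover have "(\<lambda>\<omega>. step_increments n xs (?P \<omega>)) -` A \<inter> space M = ?P -` ?A \<inter> space M"
      using measurable_space[OF measurable_path[OF W]] by auto
    ultimately show ?thesis unfolding process_events_def by blast
  qed
  then have "{(\<lambda>\<omega>. step_increments n xs (?P \<omega>)) -` A \<inter> space M |A. A \<in> sets (PiM {..<n} (\<lambda>_. borel))}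
      \<subseteq> process_events M W" by blast
  from sigma_sets_mono'[OF this, of "space M"] show ?thesis unfolding sigma_sets_process_events[OF W] .
qed

text \<open>All increments of one process jointly are a measurable functional of its path, so their
  events form a subfamily of its process events and independence is inherited.\<close>

lemma step_increments_indep_processes:
  fixes W :: "real \<Rightarrow> 'a \<Rightarrow> real^'k::finite" and W' :: "real \<Rightarrow> 'a \<Rightarrow> real^'l::finite"
    and xs :: "('k, 'd::finite) step" and ys :: "('l, 'd) step"
  assumes W: "standard_brownian_motion M W" "standard_brownian_motion M W'"
    and ind: "indep_set (process_events M W) (process_events M W')"
    and xs: "is_step xs" and ys: "is_step ys"
  shows "indep_var
    (PiM {..<n} (\<lambda>_. borel)) (\<lambda>\<omega>. \<lambda>i\<in>{..<n}. step_increment W xs n i \<omega>)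
    (PiM {..<n} (\<lambda>_. borel)) (\<lambda>\<omega>. \<lambda>i\<in>{..<n}. step_increment W' ys n i \<omega>)"
proof -
  let ?N = "PiM {..<n} (\<lambda>_. borel :: (real^'d) measure)"
  let ?X = "\<lambda>\<omega>. step_increments n xs (\<lambda>t\<in>{0..1}. W t \<omega>)"
  let ?Y = "\<lambda>\<omega>. step_increments n ys (\<lambda>t\<in>{0..1}. W' t \<omega>)"
  let ?\<sigma> = "\<lambda>X. sigma_sets (space M) {X -` A \<inter> space M |A. A \<in> sets ?N}"
  have "indep_set (?\<sigma> ?X) (?\<sigma> ?Y)"
    using ind sigma_sets_step_increments[OF W(1) xs, of n] sigma_sets_step_increments[OF W(2) ys, of n]
    unfolding indep_set_def by (elim indep_sets_mono_sets) (auto split: bool.splits)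
  then have "indep_var ?N ?X ?N ?Y"
    using measurable_compose[OF measurable_path[OF W(1)] measurable_step_increments[OF xs, of n]]
      measurable_compose[OF measurable_path[OF W(2)] measurable_step_increments[OF ys, of n]]
    by (simp add: indep_var_eq)
  then show ?thesis unfolding step_increments_path[OF xs] step_increments_path[OF ys] .
qed

end

section \<open>Increments of Ito integrals\<close>

lemma norm_matrix_vector_mult_le: "norm (A *v x) \<le> norm A * norm x" for A :: "real^'k^'d"
proof -
  have "(norm (A *v x))\<^sup>2 = (\<Sum>i\<in>UNIV. (A $ i \<bullet> x)\<^sup>2)"
    unfolding power2_norm_eq_inner unfolding inner_vec_def[of "A *v x"]
    by (simp add: matrix_vector_mul_component power2_eq_square)
  also have "\<dots> \<le> (\<Sum>i\<in>UNIV. (norm (A $ i))\<^sup>2 * (norm x)\<^sup>2)"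
  proof (rule sum_mono)
    fix i
    show "(A $ i \<bullet> x)\<^sup>2 \<le> (norm (A $ i))\<^sup>2 * (norm x)\<^sup>2"
      using power_mono[OF Cauchy_Schwarz_ineq2[of "A $ i" x] abs_ge_zero, of 2] by (simp add: power_mult_distrib)
  qed
  also have "\<dots> = (norm A * norm x)\<^sup>2"
    by (simp add: power_mult_distrib sum_distrib_right[symmetric] power2_norm_eq_inner inner_vec_def[of A])
  finally show ?thesis by (simp add: abs_le_square_iff[symmetric])
qed

lemma norm_transpose: "norm (transpose A) = norm A" for A :: "real^'k^'d"
proof -
  have "(norm (transpose A))\<^sup>2 = (norm A)\<^sup>2"
    unfolding power2_norm_eq_inner inner_vec_def transpose_def by (simp, subst sum.swap) simp
  then show ?thesis by simp
qed

text \<open>The variance of the \<open>u\<close>-component of the Ito increment over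
  \<open>I\<close>: by \<open>transpose_mult_covariance\<close> the integrand is the quadratic form
  of the covariance at \<open>u\<close>.\<close>

definition quad_var :: "(real \<Rightarrow> real^'k^'d) \<Rightarrow> real set \<Rightarrow> real^'d \<Rightarrow> ennreal" where
  "quad_var \<sigma> I u = (\<integral>\<^sup>+s\<in>I. ennreal ((norm (transpose (\<sigma> s) *v u))\<^sup>2) \<partial>lborel)"

lemma transpose_mult_covariance: "(norm (transpose (\<sigma> t) *v u))\<^sup>2 = u \<bullet> (covariance \<sigma> t *v u)"
  unfolding covariance_def matrix_vector_mul_assoc[symmetric] power2_norm_eq_inner
  by (simp add: dot_lmul_matrix transpose_matrix_vector)

text \<open>Follows from the inequality
  \<open>(a + b)\<^sup>2 \<le> 2 * a\<^sup>2 + 2 * b\<^sup>2\<close>. It is applied in both roles,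
  bounding a step integrand by \<sigma> under the null hypothesis and \<sigma> by a step integrand
  under the alternative.\<close>

lemma quad_var_le:
  fixes \<sigma> \<rho> :: "real \<Rightarrow> real^'k::finite^'d::finite"
  assumes \<sigma>: "set_borel_measurable lborel {0..1} \<sigma>" and \<rho>: "set_borel_measurable lborel {0..1} \<rho>"
    and I: "I \<in> sets borel" "I \<subseteq> {0..1}"
  shows "quad_var \<sigma> I u \<le> 2 * quad_var \<rho> I u +
    ennreal (2 * (norm u)\<^sup>2) * (\<integral>\<^sup>+s\<in>{0..1}. ennreal ((norm (\<sigma> s - \<rho> s))\<^sup>2) \<partial>lborel)"
proof -
  \<comment> \<open>Measurability is known on \<open>{0..1}\<close> only, so both integrands are cut
    off outside.\<close>
  define \<sigma>' where "\<sigma>' s = indicator {0..1} s *\<^sub>R \<sigma> s" for s :: real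
  define \<rho>' where "\<rho>' s = indicator {0..1} s *\<^sub>R \<rho> s" for s :: real
  have [measurable]: "\<sigma>' \<in> borel_measurable lborel" "\<rho>' \<in> borel_measurable lborel"
    using \<sigma> \<rho> unfolding \<sigma>'_def[abs_def] \<rho>'_def[abs_def] set_borel_measurable_def by auto
  have [measurable]: "I \<in> sets lborel" using I by simp
  have "quad_var \<sigma> I u \<le> (\<integral>\<^sup>+s. 2 * (ennreal ((norm (transpose (\<rho>' s) *v u))\<^sup>2) * indicator I s) +
      ennreal (2 * (norm u)\<^sup>2) * (ennreal ((norm (\<sigma>' s - \<rho>' s))\<^sup>2) * indicator {0..1} s) \<partial>lborel)"
    unfolding quad_var_def
  proof (rule nn_integral_mono)
    fix s
    show "ennreal ((norm (transpose (\<sigma> s) *v u))\<^sup>2) * indicator I s \<le>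
      2 * (ennreal ((norm (transpose (\<rho>' s) *v u))\<^sup>2) * indicator I s) +
      ennreal (2 * (norm u)\<^sup>2) * (ennreal ((norm (\<sigma>' s - \<rho>' s))\<^sup>2) * indicator {0..1} s)"
    proof (cases "s \<in> I")
      case True
      then have s: "s \<in> {0..1}" using I by auto
      let ?a = "transpose (\<sigma> s) *v u" and ?b = "transpose (\<rho> s) *v u"
      have "transpose (\<sigma> s - \<rho> s) = transpose (\<sigma> s) - transpose (\<rho> s)"
        by (simp add: transpose_def vec_eq_iff)
      then have ab: "?a - ?b = transpose (\<sigma> s - \<rho> s) *v u"
        by (simp add: matrix_vector_mult_diff_rdistrib)
      have "norm (?a - ?b) \<le> norm (\<sigma> s - \<rho> s) * norm u"
        unfolding ab using norm_matrix_vector_mult_le[of "transpose (\<sigma> s - \<rho> s)" u] by (simp only: norm_transpose)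
      then have d: "(norm (?a - ?b))\<^sup>2 \<le> (norm (\<sigma> s - \<rho> s))\<^sup>2 * (norm u)\<^sup>2"
        by (metis norm_ge_zero power_mono power_mult_distrib)
      have "norm ?a \<le> norm ?b + norm (?a - ?b)" by (metis add.commute diff_add_cancel norm_triangle_ineq)
      then have "(norm ?a)\<^sup>2 \<le> (norm ?b + norm (?a - ?b))\<^sup>2" by (rule power_mono) simp
      also have "\<dots> \<le> 2 * (norm ?b)\<^sup>2 + 2 * (norm (?a - ?b))\<^sup>2"
        using sum_squares_bound[of "norm ?b" "norm (?a - ?b)"] by (simp add: power2_sum)
      finally have "(norm ?a)\<^sup>2 \<le> 2 * (norm ?b)\<^sup>2 + (2 * (norm u)\<^sup>2) * (norm (\<sigma> s - \<rho> s))\<^sup>2"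
        using d by (simp add: mult.commute mult.left_commute)
      then have "ennreal ((norm ?a)\<^sup>2) \<le> ennreal (2 * (norm ?b)\<^sup>2 + (2 * (norm u)\<^sup>2) * (norm (\<sigma> s - \<rho> s))\<^sup>2)"
        by (rule ennreal_leI)
      also have "\<dots> = 2 * ennreal ((norm ?b)\<^sup>2) + ennreal (2 * (norm u)\<^sup>2) * ennreal ((norm (\<sigma> s - \<rho> s))\<^sup>2)"
        by (simp add: ennreal_plus ennreal_mult)
      finally show ?thesis using True s by (simp add: \<sigma>'_def \<rho>'_def)
    qed simp
  qed
  also have "\<dots> = 2 * (\<integral>\<^sup>+s. ennreal ((norm (transpose (\<rho>' s) *v u))\<^sup>2) * indicator I s \<partial>lborel) +
      ennreal (2 * (norm u)\<^sup>2) * (\<integral>\<^sup>+s. ennreal ((norm (\<sigma>' s - \<rho>' s))\<^sup>2) * indicator {0..1} s \<partial>lborel)"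
  proof -
    let ?f = "\<lambda>s. ennreal ((norm (transpose (\<rho>' s) *v u))\<^sup>2) * indicator I s"
    let ?g = "\<lambda>s. ennreal ((norm (\<sigma>' s - \<rho>' s))\<^sup>2) * indicator {0..1::real} s"
    have "\<rho>' \<in> borel_measurable lborel" by measurable
    then have "(\<lambda>s. (norm (transpose (\<rho>' s) *v u))\<^sup>2) \<in> borel_measurable lborel"
      by (rule measurable_compose[OF _ borel_measurable_transpose_mult])
    then have m1: "?f \<in> borel_measurable lborel"
      using I by (intro borel_measurable_times_ennreal borel_measurable_indicator)
        (auto intro: measurable_compose[OF _ measurable_ennreal])
    have m2: "?g \<in> borel_measurable lborel" by measurable
    have "(\<integral>\<^sup>+s. 2 * ?f s + ennreal (2 * (norm u)\<^sup>2) * ?g s \<partial>lborel) =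
        (\<integral>\<^sup>+s. 2 * ?f s \<partial>lborel) + (\<integral>\<^sup>+s. ennreal (2 * (norm u)\<^sup>2) * ?g s \<partial>lborel)"
      by (rule nn_integral_add; rule borel_measurable_times_ennreal[OF borel_measurable_const]; rule m1 m2)
    then show ?thesis unfolding nn_integral_cmult[OF m1] nn_integral_cmult[OF m2] .
  qed
  also have "(\<integral>\<^sup>+s. ennreal ((norm (transpose (\<rho>' s) *v u))\<^sup>2) * indicator I s \<partial>lborel) = quad_var \<rho> I u"
    unfolding quad_var_def using I by (intro nn_integral_cong) (auto simp: \<rho>'_def indicator_def)
  also have "(\<integral>\<^sup>+s. ennreal ((norm (\<sigma>' s - \<rho>' s))\<^sup>2) * indicator {0..1} s \<partial>lborel) =
      (\<integral>\<^sup>+s\<in>{0..1}. ennreal ((norm (\<sigma> s - \<rho> s))\<^sup>2) \<partial>lborel)"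
    by (intro nn_integral_cong) (auto simp: \<rho>'_def \<sigma>'_def indicator_def)
  finally show ?thesis .
qed

lemma set_borel_measurable_step_fun: "set_borel_measurable lborel {0..1} (step_fun xs)"
  unfolding set_borel_measurable_def by measurable

lemma grid_interval_subset:
  assumes "i < n"
  shows "(grid_cell n i) \<subseteq> {0..1}"
proof
  fix s assume "s \<in> (grid_cell n i)"
  moreover have "0 \<le> real i / real n" "real (Suc i) / real n \<le> 1" using assms by auto
  ultimately show "s \<in> {0..1}" unfolding greaterThanAtMost_iff atLeastAtMost_iff by linarith
qed

context prob_space
begin

lemma borel_measurable_step_integral:
  fixes W :: "real \<Rightarrow> 'a \<Rightarrow> real^'k::finite"
  assumes "standard_brownian_motion M W" "is_step xs" "t \<in> {0..1}"
  shows "(\<lambda>\<omega>. step_integral W xs t \<omega>) \<in> borel_measurable M"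
  using measurable_compose[OF measurable_path[OF assms(1)] borel_measurable_step_integral_path[OF assms(2,3)]]
  unfolding step_integral_path[OF assms(2,3)] .

lemma nn_integral_norm_add_sq_le:
  fixes f g :: "'a \<Rightarrow> 'b::euclidean_space"
  assumes [measurable]: "f \<in> borel_measurable M" "g \<in> borel_measurable M"
  shows "(\<integral>\<^sup>+\<omega>. ennreal ((norm (f \<omega> + g \<omega>))\<^sup>2) \<partial>M) \<le>
    2 * (\<integral>\<^sup>+\<omega>. ennreal ((norm (f \<omega>))\<^sup>2) \<partial>M) + 2 * (\<integral>\<^sup>+\<omega>. ennreal ((norm (g \<omega>))\<^sup>2) \<partial>M)"
proof -
  have "ennreal ((norm (x + y))\<^sup>2) \<le> 2 * ennreal ((norm x)\<^sup>2) + 2 * ennreal ((norm y)\<^sup>2)" for x y :: 'b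
  proof -
    have "(norm (x + y))\<^sup>2 \<le> (norm x + norm y)\<^sup>2" by (intro power_mono norm_triangle_ineq) simp
    also have "\<dots> \<le> 2 * (norm x)\<^sup>2 + 2 * (norm y)\<^sup>2"
      using sum_squares_bound[of "norm x" "norm y"] by (simp add: power2_sum)
    finally have "ennreal ((norm (x + y))\<^sup>2) \<le> ennreal (2 * (norm x)\<^sup>2 + 2 * (norm y)\<^sup>2)"
      by (rule ennreal_leI)
    then show ?thesis by (simp add: ennreal_plus ennreal_mult)
  qed
  then have "(\<integral>\<^sup>+\<omega>. ennreal ((norm (f \<omega> + g \<omega>))\<^sup>2) \<partial>M) \<le>
      (\<integral>\<^sup>+\<omega>. 2 * ennreal ((norm (f \<omega>))\<^sup>2) + 2 * ennreal ((norm (g \<omega>))\<^sup>2) \<partial>M)"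
    by (intro nn_integral_mono) auto
  also have "\<dots> = 2 * (\<integral>\<^sup>+\<omega>. ennreal ((norm (f \<omega>))\<^sup>2) \<partial>M) + 2 * (\<integral>\<^sup>+\<omega>. ennreal ((norm (g \<omega>))\<^sup>2) \<partial>M)"
    by (simp add: nn_integral_add nn_integral_cmult)
  finally show ?thesis .
qed

text \<open>A one-sided form of the Ito isometry. The factor 4 comes from two splittings of a
  square: the increment into step integral and remainder, and the step integrand into \<sigma> and
  an error.\<close>

lemma ito_increment_second_moment_le:
  fixes W :: "real \<Rightarrow> 'a \<Rightarrow> real^'k::finite" and X :: "real \<Rightarrow> 'a \<Rightarrow> real^'d::finite"
  assumes W: "standard_brownian_motion M W" and X: "ito_differential M W \<sigma> X" and i: "i < n"
  shows "(\<integral>\<^sup>+\<omega>. ennreal ((u \<bullet> (X (real (Suc i) / real n) \<omega> - X (real i / real n) \<omega>))\<^sup>2) \<partial>M) \<le>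
    4 * quad_var \<sigma> (grid_cell n i) u"
proof -
  let ?t = "real (Suc i) / real n" and ?s = "real i / real n"
  let ?I = "{?s<..?t}"
  have ts: "?t \<in> {0..1}" "?s \<in> {0..1}" using grid_in_unit_interval[OF i] .
  obtain xs :: "nat \<Rightarrow> ('k, 'd) step" where xs: "\<And>k. is_step (xs k)"
    and lim\<sigma>: "(\<lambda>k. \<integral>\<^sup>+s\<in>{0..1}. ennreal ((norm (\<sigma> s - step_fun (xs k) s))\<^sup>2) \<partial>lborel) \<longlonglongrightarrow> 0"
    and limX: "\<And>t. t \<in> {0..1} \<Longrightarrow>
      (\<lambda>k. \<integral>\<^sup>+\<omega>. ennreal ((norm (X t \<omega> - X 0 \<omega> - step_integral W (xs k) t \<omega>))\<^sup>2) \<partial>M) \<longlonglongrightarrow> 0"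
    using X unfolding ito_differential_def by blast
  have \<sigma>: "set_borel_measurable lborel {0..1} \<sigma>"
    using X by (simp add: ito_differential_def square_integrable_def)
  have X_meas: "X t \<in> borel_measurable M" if "t \<in> {0..1}" for t
    using X that by (simp add: ito_differential_def)
  define D where "D k = (\<integral>\<^sup>+s\<in>{0..1}. ennreal ((norm (\<sigma> s - step_fun (xs k) s))\<^sup>2) \<partial>lborel)" for k
  define R where "R k t \<omega> = X t \<omega> - X 0 \<omega> - step_integral W (xs k) t \<omega>" for k t \<omega>
  define E where "E k t = (\<integral>\<^sup>+\<omega>. ennreal ((norm (R k t \<omega>))\<^sup>2) \<partial>M)" for k t
  define S where "S k \<omega> = step_integral W (xs k) ?t \<omega> - step_integral W (xs k) ?s \<omega>" for k \<omega>
  have S_meas [measurable]: "S k \<in> borel_measurable M" for k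
    unfolding S_def[abs_def]
    by (intro borel_measurable_diff borel_measurable_step_integral[OF W xs] ts)
  have R_meas: "R k t \<in> borel_measurable M" if "t \<in> {0..1}" for k t
    unfolding R_def[abs_def] using that
    by (intro borel_measurable_diff borel_measurable_step_integral[OF W xs] X_meas) auto
  let ?c = "ennreal ((norm u)\<^sup>2)"
  have bound: "(\<integral>\<^sup>+\<omega>. ennreal ((u \<bullet> (X ?t \<omega> - X ?s \<omega>))\<^sup>2) \<partial>M) \<le>
      4 * quad_var \<sigma> ?I u + 2 * (ennreal (2 * (norm u)\<^sup>2) * D k) + 2 * (?c * (2 * E k ?t + 2 * E k ?s))" for k
  proof -
    have split: "u \<bullet> (X ?t \<omega> - X ?s \<omega>) = u \<bullet> S k \<omega> + u \<bullet> (R k ?t \<omega> + - R k ?s \<omega>)" for \<omega>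
      by (simp add: S_def R_def inner_diff_right inner_add_right)
    have Rd: "(\<lambda>\<omega>. R k ?t \<omega> + - R k ?s \<omega>) \<in> borel_measurable M"
      by (intro borel_measurable_add borel_measurable_uminus R_meas ts)
    have "(\<integral>\<^sup>+\<omega>. ennreal ((u \<bullet> (X ?t \<omega> - X ?s \<omega>))\<^sup>2) \<partial>M) \<le>
        2 * (\<integral>\<^sup>+\<omega>. ennreal ((u \<bullet> S k \<omega>)\<^sup>2) \<partial>M) + 2 * (\<integral>\<^sup>+\<omega>. ennreal ((u \<bullet> (R k ?t \<omega> + - R k ?s \<omega>))\<^sup>2) \<partial>M)"
    proof -
      have "(\<lambda>\<omega>. u \<bullet> S k \<omega>) \<in> borel_measurable M" "(\<lambda>\<omega>. u \<bullet> (R k ?t \<omega> + - R k ?s \<omega>)) \<in> borel_measurable M"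
        by (intro borel_measurable_inner borel_measurable_const S_meas Rd)+
      from nn_integral_norm_add_sq_le[OF this] show ?thesis
        unfolding split by (simp only: real_norm_def power2_abs)
    qed
    also have "(\<integral>\<^sup>+\<omega>. ennreal ((u \<bullet> S k \<omega>)\<^sup>2) \<partial>M) = quad_var (step_fun (xs k)) ?I u"
      unfolding quad_var_def S_def using i by (intro step_increments_second_moment[OF W xs]) auto
    also have "quad_var (step_fun (xs k)) ?I u \<le> 2 * quad_var \<sigma> ?I u + ennreal (2 * (norm u)\<^sup>2) * D k"
      unfolding D_def
      using quad_var_le[OF set_borel_measurable_step_fun \<sigma> _ grid_interval_subset[OF i], of "xs k" u]
      by (simp add: norm_minus_commute)
    also have "(\<integral>\<^sup>+\<omega>. ennreal ((u \<bullet> (R k ?t \<omega> + - R k ?s \<omega>))\<^sup>2) \<partial>M) \<le>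
        (\<integral>\<^sup>+\<omega>. ?c * ennreal ((norm (R k ?t \<omega> + - R k ?s \<omega>))\<^sup>2) \<partial>M)"
    proof (rule nn_integral_mono)
      fix \<omega>
      have "(u \<bullet> (R k ?t \<omega> + - R k ?s \<omega>))\<^sup>2 \<le> (norm u * norm (R k ?t \<omega> + - R k ?s \<omega>))\<^sup>2"
        using Cauchy_Schwarz_ineq2[of u "R k ?t \<omega> + - R k ?s \<omega>"] by (metis power2_abs power_mono abs_ge_zero)
      then show "ennreal ((u \<bullet> (R k ?t \<omega> + - R k ?s \<omega>))\<^sup>2) \<le>
          ?c * ennreal ((norm (R k ?t \<omega> + - R k ?s \<omega>))\<^sup>2)"
        by (simp add: ennreal_mult[symmetric] power_mult_distrib ennreal_leI)
    qed
    also have "\<dots> = ?c * (\<integral>\<^sup>+\<omega>. ennreal ((norm (R k ?t \<omega> + - R k ?s \<omega>))\<^sup>2) \<partial>M)"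
      by (intro nn_integral_cmult measurable_compose[OF _ measurable_ennreal] borel_measurable_power
          measurable_compose[OF Rd borel_measurable_norm])
    also have "(\<integral>\<^sup>+\<omega>. ennreal ((norm (R k ?t \<omega> + - R k ?s \<omega>))\<^sup>2) \<partial>M) \<le> 2 * E k ?t + 2 * E k ?s"
      unfolding E_def using nn_integral_norm_add_sq_le[OF R_meas[OF ts(1)] borel_measurable_uminus[OF R_meas[OF ts(2)]]]
      by (simp only: norm_minus_cancel)
    finally show ?thesis by (simp add: distrib_left mult.assoc[symmetric] add_mono mult_left_mono)
  qed
  \<comment> \<open>The left side of \<open>bound\<close> is free of \<open>k\<close>, so the
    approximation errors \<open>D\<close> and \<open>E\<close> can be sent to zero on the
    right.\<close>
  have "(\<lambda>k. 4 * quad_var \<sigma> ?I u + 2 * (ennreal (2 * (norm u)\<^sup>2) * D k) + 2 * (?c * (2 * E k ?t + 2 * E k ?s)))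
      \<longlonglongrightarrow> 4 * quad_var \<sigma> ?I u + 2 * (ennreal (2 * (norm u)\<^sup>2) * 0) + 2 * (?c * (2 * 0 + 2 * 0))"
    using lim\<sigma> limX[OF ts(1)] limX[OF ts(2)] unfolding D_def[symmetric] R_def[symmetric] E_def[symmetric]
    by (intro tendsto_add tendsto_const ennreal_tendsto_cmult) auto
  then have "(\<lambda>k. 4 * quad_var \<sigma> ?I u + 2 * (ennreal (2 * (norm u)\<^sup>2) * D k) + 2 * (?c * (2 * E k ?t + 2 * E k ?s)))
      \<longlonglongrightarrow> 4 * quad_var \<sigma> ?I u" by simp
  then show ?thesis by (rule LIMSEQ_le_const) (use bound in blast)
qed

lemma L1_null_AE_subseq:
  fixes g :: "nat \<Rightarrow> 'a \<Rightarrow> real"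
  assumes g: "\<And>k. g k \<in> borel_measurable M" "\<And>k \<omega>. 0 \<le> g k \<omega>"
    and lim: "(\<lambda>k. \<integral>\<^sup>+\<omega>. ennreal (g k \<omega>) \<partial>M) \<longlonglongrightarrow> 0"
  obtains r :: "nat \<Rightarrow> nat" where "strict_mono r" "AE \<omega> in M. (\<lambda>k. g (r k) \<omega>) \<longlonglongrightarrow> 0"
proof -
  \<comment> \<open>The first integrals may be infinite; dropping an initial segment makes every
    remaining term integrable.\<close>
  have "\<forall>\<^sub>F k in sequentially. (\<integral>\<^sup>+\<omega>. ennreal (g k \<omega>) \<partial>M) < 1"
    using lim by (rule order_tendstoD) simp
  then obtain k0 where k0: "\<And>k. k0 \<le> k \<Longrightarrow> (\<integral>\<^sup>+\<omega>. ennreal (g k \<omega>) \<partial>M) < 1"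
    by (auto simp: eventually_sequentially)
  define u where "u k = g (k + k0)" for k
  have fin: "(\<integral>\<^sup>+\<omega>. ennreal (u k \<omega>) \<partial>M) < 1" for k using k0 by (simp add: u_def)
  have int: "integrable M (u k)" for k
    using g fin[of k] by (intro integrableI_nonneg) (auto simp: u_def intro: less_trans)
  have "(\<integral>\<omega>. norm (u k \<omega>) \<partial>M) = enn2real (\<integral>\<^sup>+\<omega>. ennreal (g (k + k0) \<omega>) \<partial>M)" for k
    using g by (simp add: u_def integral_eq_nn_integral)
  moreover have "(\<lambda>k. enn2real (\<integral>\<^sup>+\<omega>. ennreal (g (k + k0) \<omega>) \<partial>M)) \<longlonglongrightarrow> enn2real 0"
    using LIMSEQ_ignore_initial_segment[OF lim, of k0] by (intro tendsto_enn2real) auto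
  ultimately have "(\<lambda>k. \<integral>\<omega>. norm (u k \<omega>) \<partial>M) \<longlonglongrightarrow> 0" by simp
  then obtain r where r: "strict_mono r" "AE \<omega> in M. (\<lambda>k. u (r k) \<omega>) \<longlonglongrightarrow> 0"
    using tendsto_L1_AE_subseq[of M u, OF int] by blast
  show ?thesis
    by (rule that[of "\<lambda>k. r k + k0"]) (use r in \<open>auto simp: strict_mono_def u_def\<close>)
qed

text \<open>Fatou's lemma: almost everywhere the indicator of \<open>A\<close> is at most the lower
  limit of the indicators of \<open>B k\<close>.\<close>

lemma prob_le_of_eventually:
  assumes A: "A \<in> events" and B: "\<And>k. B k \<in> events" and p: "0 \<le> p"
    and ae: "AE \<omega> in M. \<omega> \<in> A \<longrightarrow> (\<forall>\<^sub>F k in sequentially. \<omega> \<in> B k)"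
    and le: "\<And>k::nat. prob (B k) \<le> p"
  shows "prob A \<le> p"
proof -
  have "emeasure M A = (\<integral>\<^sup>+\<omega>. indicator A \<omega> \<partial>M)" using A by simp
  also have "\<dots> \<le> (\<integral>\<^sup>+\<omega>. liminf (\<lambda>k. indicator (B k) \<omega>) \<partial>M)"
  proof (rule nn_integral_mono_AE)
    show "AE \<omega> in M. indicator A \<omega> \<le> liminf (\<lambda>k. indicator (B k) \<omega> :: ennreal)"
      using ae
    proof eventually_elim
      case (elim \<omega>)
      show ?case
      proof (cases "\<omega> \<in> A")
        case True
        then have "\<forall>\<^sub>F k in sequentially. (1::ennreal) \<le> indicator (B k) \<omega>"
          using elim by (auto elim: eventually_mono)
        then have "1 \<le> liminf (\<lambda>k. indicator (B k) \<omega> :: ennreal)" by (rule Liminf_bounded)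
        then show ?thesis using True by simp
      qed simp
    qed
  qed
  also have "\<dots> \<le> liminf (\<lambda>k. \<integral>\<^sup>+\<omega>. indicator (B k) \<omega> \<partial>M)" using B by (intro nn_integral_liminf) auto
  also have "\<dots> \<le> liminf (\<lambda>k. ennreal p)"
    using le B by (intro Liminf_mono always_eventually) (auto simp: emeasure_eq_measure ennreal_leI)
  also have "\<dots> = ennreal p" by (simp add: Liminf_const)
  finally show ?thesis using p by (simp add: emeasure_eq_measure)
qed

text \<open>For step integrands all increments are explicit Gaussian vectors. Since the statistic is upper
  semicontinuous, the bound survives the passage to the limit along an a.e. convergent subsequence.\<close>

lemma prob_rank_statistic_ito:
  fixes B :: "real \<Rightarrow> 'a \<Rightarrow> real^'m::finite" and BZ :: "real \<Rightarrow> 'a \<Rightarrow> real^'d::finite"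
  assumes model: "diffusion_model M B BZ \<sigma>X \<sigma>Z X Z"
    and K: "0 < K" and n: "1 \<le> n" and J: "J \<subseteq> {..<n div K}" and g: "0 < \<gamma>"
    and spread: "\<And>j l U. j \<in> J \<Longrightarrow> l < K \<Longrightarrow> subspace U \<Longrightarrow> CARD('d) < dim U + K \<Longrightarrow>
      \<exists>u\<in>U. norm u = 1 \<and> ennreal \<gamma> \<le> quad_var \<sigma>X (grid_cell n (j * K + l)) u"
    and \<kappa>: "\<kappa> < \<gamma> * real (card J) / (400 * (real K)\<^sup>2)"
  shows "prob {\<omega>\<in>space M. rank_statistic K n (sampled_sum n X Z \<omega>) \<le> \<kappa>}
    \<le> exp (- real (card J) / 2)"
proof -
  have BM: "standard_brownian_motion M B" "standard_brownian_motion M BZ"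
    and ind: "indep_set (process_events M B) (process_events M BZ)"
    and X: "ito_differential M B \<sigma>X X" and Z: "ito_differential M BZ \<sigma>Z Z"
    using model by (auto simp: diffusion_model_def)
  obtain xs :: "nat \<Rightarrow> ('m, 'd) step" where xs: "\<And>k. is_step (xs k)"
    and lim\<sigma>: "(\<lambda>k. \<integral>\<^sup>+s\<in>{0..1}. ennreal ((norm (\<sigma>X s - step_fun (xs k) s))\<^sup>2) \<partial>lborel) \<longlonglongrightarrow> 0"
    and limX: "\<And>t. t \<in> {0..1} \<Longrightarrow>
      (\<lambda>k. \<integral>\<^sup>+\<omega>. ennreal ((norm (X t \<omega> - X 0 \<omega> - step_integral B (xs k) t \<omega>))\<^sup>2) \<partial>M) \<longlonglongrightarrow> 0"
    using X unfolding ito_differential_def by blast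
  obtain zs :: "nat \<Rightarrow> ('d, 'd) step" where zs: "\<And>k. is_step (zs k)"
    and limZ: "\<And>t. t \<in> {0..1} \<Longrightarrow>
      (\<lambda>k. \<integral>\<^sup>+\<omega>. ennreal ((norm (Z t \<omega> - Z 0 \<omega> - step_integral BZ (zs k) t \<omega>))\<^sup>2) \<partial>M) \<longlonglongrightarrow> 0"
    using Z unfolding ito_differential_def by blast
  have \<sigma>: "set_borel_measurable lborel {0..1} \<sigma>X"
    using X by (simp add: ito_differential_def square_integrable_def)
  have X_meas: "X t \<in> borel_measurable M" and Z_meas: "Z t \<in> borel_measurable M" if "t \<in> {0..1}" for t
    using X Z that by (simp_all add: ito_differential_def)
  have grid: "real i / real n \<in> {0..1}" if "i \<le> n" for i using that n by auto
  define Y where "Y \<omega> i = X (real i / real n) \<omega> + Z (real i / real n) \<omega>" for \<omega> i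
  define Yk where "Yk k \<omega> i = step_integral B (xs k) (real i / real n) \<omega> + step_integral BZ (zs k) (real i / real n) \<omega>"
    for k \<omega> i
  define RX where "RX k i \<omega> = X (real i / real n) \<omega> - X 0 \<omega> - step_integral B (xs k) (real i / real n) \<omega>" for k i \<omega>
  define RZ where "RZ k i \<omega> = Z (real i / real n) \<omega> - Z 0 \<omega> - step_integral BZ (zs k) (real i / real n) \<omega>" for k i \<omega>
  have R_meas: "RX k i \<in> borel_measurable M" "RZ k i \<in> borel_measurable M" if "i \<le> n" for k i
    unfolding RX_def[abs_def] RZ_def[abs_def] using grid[OF that]
    by (intro borel_measurable_diff borel_measurable_step_integral[OF BM(1) xs]
        borel_measurable_step_integral[OF BM(2) zs] X_meas Z_meas; simp)+
  \<comment> \<open>All approximation errors, at every grid point and for both processes, are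
    collected in one variable, so that a single subsequence serves them all.\<close>
  define gk where "gk k \<omega> = (\<Sum>i\<le>n. (norm (RX k i \<omega>))\<^sup>2 + (norm (RZ k i \<omega>))\<^sup>2)" for k \<omega>
  have gk_meas: "gk k \<in> borel_measurable M" for k
    unfolding gk_def[abs_def] using R_meas by (intro borel_measurable_sum borel_measurable_add
        borel_measurable_power measurable_compose[OF _ borel_measurable_norm]) auto
  have "(\<integral>\<^sup>+\<omega>. ennreal (gk k \<omega>) \<partial>M) =
      (\<Sum>i\<le>n. (\<integral>\<^sup>+\<omega>. ennreal ((norm (RX k i \<omega>))\<^sup>2) \<partial>M) + (\<integral>\<^sup>+\<omega>. ennreal ((norm (RZ k i \<omega>))\<^sup>2) \<partial>M))" for k
  proof -
    have sq_meas: "(\<lambda>\<omega>. ennreal ((norm (RX k i \<omega>))\<^sup>2)) \<in> borel_measurable M"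
      "(\<lambda>\<omega>. ennreal ((norm (RZ k i \<omega>))\<^sup>2)) \<in> borel_measurable M" if "i \<le> n" for i
      using R_meas[OF that, of k] by (auto intro!: measurable_compose[OF _ measurable_ennreal]
          borel_measurable_power measurable_compose[OF _ borel_measurable_norm])
    have "ennreal (gk k \<omega>) = (\<Sum>i\<le>n. ennreal ((norm (RX k i \<omega>))\<^sup>2) + ennreal ((norm (RZ k i \<omega>))\<^sup>2))" for \<omega>
      by (simp add: gk_def sum_ennreal[symmetric] ennreal_plus del: sum_ennreal)
    then have "(\<integral>\<^sup>+\<omega>. ennreal (gk k \<omega>) \<partial>M) =
        (\<Sum>i\<le>n. \<integral>\<^sup>+\<omega>. ennreal ((norm (RX k i \<omega>))\<^sup>2) + ennreal ((norm (RZ k i \<omega>))\<^sup>2) \<partial>M)"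
      using sq_meas by (simp only:) (rule nn_integral_sum, auto)
    then show ?thesis using sq_meas by (simp add: nn_integral_add)
  qed
  moreover have "(\<lambda>k. \<Sum>i\<le>n. (\<integral>\<^sup>+\<omega>. ennreal ((norm (RX k i \<omega>))\<^sup>2) \<partial>M) + (\<integral>\<^sup>+\<omega>. ennreal ((norm (RZ k i \<omega>))\<^sup>2) \<partial>M))
      \<longlonglongrightarrow> (\<Sum>i\<le>n. 0 + 0)"
    unfolding RX_def RZ_def using limX limZ grid by (intro tendsto_sum tendsto_add) auto
  ultimately have gk_lim: "(\<lambda>k. \<integral>\<^sup>+\<omega>. ennreal (gk k \<omega>) \<partial>M) \<longlonglongrightarrow> 0" by simp
  have gk_nonneg: "0 \<le> gk k \<omega>" for k \<omega> unfolding gk_def by (intro sum_nonneg) auto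
  \<comment> \<open>From \<open>k0\<close> on, the step integrands are close enough in mean square
    that a variance of at least \<gamma> in a unit direction drops to no less than \<gamma> /
    4.\<close>
  have "\<forall>\<^sub>F k in sequentially. (\<integral>\<^sup>+s\<in>{0..1}. ennreal ((norm (\<sigma>X s - step_fun (xs k) s))\<^sup>2) \<partial>lborel) < ennreal (\<gamma> / 4)"
    using lim\<sigma> g by (intro order_tendstoD) auto
  then obtain k0 where k0: "\<And>k. k0 \<le> k \<Longrightarrow>
      (\<integral>\<^sup>+s\<in>{0..1}. ennreal ((norm (\<sigma>X s - step_fun (xs k) s))\<^sup>2) \<partial>lborel) < ennreal (\<gamma> / 4)"
    by (auto simp: eventually_sequentially)
  obtain r where r: "strict_mono r" "AE \<omega> in M. (\<lambda>k. gk (r k) \<omega>) \<longlonglongrightarrow> 0"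
    using L1_null_AE_subseq[OF gk_meas gk_nonneg gk_lim] by blast
  \<comment> \<open>The solution of
    \<open>\<delta> / sqrt (\<gamma> / 4) = 1 / (5 * real K)\<close>, with the small-ball bound on
    the left and the probability allowed per increment on the right.\<close>
  define \<delta> where "\<delta> = sqrt (\<gamma> / 4) / (5 * real K)"
  have d: "0 < \<delta>" using g K by (simp add: \<delta>_def)
  \<comment> \<open>This is the upper bound assumed for \<open>\<kappa>\<close>, with
    \<open>400 = 4 * 25 * 4\<close>. The strict gap lets upper semicontinuity turn
    \<open>\<le> \<kappa>\<close> in the limit into \<open>< \<kappa>'\<close> for the
    approximations.\<close>
  define \<kappa>' where "\<kappa>' = \<delta>\<^sup>2 * real (card J) / 4"
  have \<kappa>': "\<kappa> < \<kappa>'"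
    using \<kappa> g K by (simp add: \<kappa>'_def \<delta>_def power_divide power_mult_distrib)
  define A where "A = {\<omega>\<in>space M. rank_statistic K n (Y \<omega>) \<le> \<kappa>}"
  define B' where "B' k = {\<omega>\<in>space M. rank_statistic K n (Yk (r (k + k0)) \<omega>) < \<kappa>'}" for k
  have "(\<lambda>\<omega>. rank_statistic K n (Y \<omega>)) \<in> borel_measurable M"
    using grid X_meas Z_meas by (intro borel_measurable_rank_statistic[OF K]) (auto simp: Y_def)
  then have A_ev: "A \<in> events" unfolding A_def by measurable
  have B_ev: "B' k \<in> events" for k
  proof -
    have "(\<lambda>\<omega>. rank_statistic K n (Yk (r (k + k0)) \<omega>)) \<in> borel_measurable M"
      unfolding Yk_def
      by (intro borel_measurable_rank_statistic[OF K] borel_measurable_add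
          borel_measurable_step_integral[OF BM(1) xs] borel_measurable_step_integral[OF BM(2) zs] grid)
    then show ?thesis unfolding B'_def by measurable
  qed
  have ae: "AE \<omega> in M. \<omega> \<in> A \<longrightarrow> (\<forall>\<^sub>F k in sequentially. \<omega> \<in> B' k)"
    using r(2)
  proof eventually_elim
    case (elim \<omega>)
    show ?case
    proof
      assume \<omega>: "\<omega> \<in> A"
      have lim: "(\<lambda>k. gk (r (k + k0)) \<omega>) \<longlonglongrightarrow> 0" by (rule LIMSEQ_ignore_initial_segment[OF elim])
      have null: "(\<lambda>k. R (r (k + k0))) \<longlonglongrightarrow> 0"
        if "\<And>k. (norm (R k))\<^sup>2 \<le> gk k \<omega>" for R :: "nat \<Rightarrow> real^'d"
      proof -
        have "(\<lambda>k. (norm (R (r (k + k0))))\<^sup>2) \<longlonglongrightarrow> 0"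
          by (rule tendsto_sandwich[OF _ _ tendsto_const lim]) (use that in auto)
        then have "(\<lambda>k. sqrt ((norm (R (r (k + k0))))\<^sup>2)) \<longlonglongrightarrow> sqrt 0" by (rule tendsto_real_sqrt)
        then show ?thesis by (simp add: tendsto_norm_zero_iff)
      qed
      have le: "(norm (RX k i \<omega>))\<^sup>2 \<le> gk k \<omega>" "(norm (RZ k i \<omega>))\<^sup>2 \<le> gk k \<omega>" if "i \<le> n" for k i
      proof -
        have "(norm (RX k i \<omega>))\<^sup>2 + (norm (RZ k i \<omega>))\<^sup>2 \<le> gk k \<omega>"
          unfolding gk_def using that by (intro member_le_sum) auto
        then show "(norm (RX k i \<omega>))\<^sup>2 \<le> gk k \<omega>" "(norm (RZ k i \<omega>))\<^sup>2 \<le> gk k \<omega>"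
          using zero_le_power2[of "norm (RX k i \<omega>)"] zero_le_power2[of "norm (RZ k i \<omega>)"] by linarith+
      qed
      have "\<forall>\<^sub>F k in sequentially. rank_statistic K n (Yk (r (k + k0)) \<omega>) < \<kappa>'"
      proof (rule rank_statistic_upper_semicontinuous[OF K])
        show "rank_statistic K n (Y \<omega>) < \<kappa>'" using \<omega> \<kappa>' by (simp add: A_def)
        fix i assume i: "i < n"
        have "(\<lambda>k. (Y \<omega> (Suc i) - Y \<omega> i) - (RX (r (k + k0)) (Suc i) \<omega> + RZ (r (k + k0)) (Suc i) \<omega>)
            + (RX (r (k + k0)) i \<omega> + RZ (r (k + k0)) i \<omega>)) \<longlonglongrightarrow> (Y \<omega> (Suc i) - Y \<omega> i) - (0 + 0) + (0 + 0)"
          using i le by (intro tendsto_intros null) auto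
        also have "(\<lambda>k. (Y \<omega> (Suc i) - Y \<omega> i) - (RX (r (k + k0)) (Suc i) \<omega> + RZ (r (k + k0)) (Suc i) \<omega>)
            + (RX (r (k + k0)) i \<omega> + RZ (r (k + k0)) i \<omega>)) =
            (\<lambda>k. Yk (r (k + k0)) \<omega> (Suc i) - Yk (r (k + k0)) \<omega> i)"
          by (rule ext) (simp add: Y_def Yk_def RX_def RZ_def del: of_nat_Suc)
        finally show "(\<lambda>k. Yk (r (k + k0)) \<omega> (Suc i) - Yk (r (k + k0)) \<omega> i) \<longlonglongrightarrow> Y \<omega> (Suc i) - Y \<omega> i"
          by simp
      qed
      then show "\<forall>\<^sub>F k in sequentially. \<omega> \<in> B' k" using \<omega> by (simp add: B'_def A_def)
    qed
  qed
  have B_prob: "prob (B' k) \<le> exp (- real (card J) / 2)" for k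
  proof -
    let ?k = "r (k + k0)"
    have "k + k0 \<le> ?k" by (rule seq_suble[OF r(1)])
    then have k: "k0 \<le> ?k" by simp
    let ?S = "\<lambda>i \<omega>. step_increment B (xs ?k) n i \<omega>"
    let ?Z = "\<lambda>i \<omega>. step_increment BZ (zs ?k) n i \<omega>"
    show ?thesis
      unfolding B'_def \<kappa>'_def
    proof (rule prob_rank_statistic_small[OF K J d, where S="?S" and Z="?Z"])
      show "indep_var (PiM {..<n} (\<lambda>_. borel)) (\<lambda>\<omega>. \<lambda>i\<in>{..<n}. ?S i \<omega>) (PiM {..<n} (\<lambda>_. borel)) (\<lambda>\<omega>. \<lambda>i\<in>{..<n}. ?Z i \<omega>)"
        by (rule step_increments_indep_processes[OF BM ind xs zs])
      show "indep_vars (\<lambda>_. borel) ?S {..<n}"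
        by (rule step_increments_indep[OF BM(1) xs n])
      show "Yk ?k \<omega> (Suc i) - Yk ?k \<omega> i = ?S i \<omega> + ?Z i \<omega>" for i \<omega> by (simp add: Yk_def del: of_nat_Suc)
      fix j l and U :: "(real^'d) set"
      assume j: "j \<in> J" and l: "l < K" and U: "subspace U" "DIM(real^'d) < dim U + K"
      let ?i = "j * K + l"
      let ?I = "(grid_cell n ?i)"
      have i: "?i < n" using block_index_less[of j n K l] J j l by auto
      obtain u where u: "u \<in> U" "norm u = 1" "ennreal \<gamma> \<le> quad_var \<sigma>X ?I u"
        using spread[OF j l U(1)] U(2) by auto
      \<comment> \<open>With \<open>q\<close> for the step variance, \<open>quad_var_le\<close>
        gives \<gamma> \<le> 2 q + 2 (\<gamma> / 4), that is q \<ge> \<gamma> / 4.\<close>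
      have "ennreal (\<gamma> / 4) \<le> quad_var (step_fun (xs ?k)) ?I u"
      proof (cases "quad_var (step_fun (xs ?k)) ?I u")
        case (real q)
        have "ennreal \<gamma> \<le> 2 * quad_var (step_fun (xs ?k)) ?I u + ennreal (2 * (norm u)\<^sup>2) *
            (\<integral>\<^sup>+s\<in>{0..1}. ennreal ((norm (\<sigma>X s - step_fun (xs ?k) s))\<^sup>2) \<partial>lborel)"
          using u(3) quad_var_le[OF \<sigma> set_borel_measurable_step_fun _ grid_interval_subset[OF i], of u "xs ?k"]
          by (rule order_trans) simp
        also have "\<dots> \<le> 2 * ennreal q + ennreal 2 * ennreal (\<gamma> / 4)"
          using less_imp_le[OF k0[OF k]] u(2) real by (intro add_mono mult_mono) auto
        also have "2 * ennreal q = ennreal (2 * q)" using real ennreal_mult[of 2 q] by simp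
        also have "ennreal 2 * ennreal (\<gamma> / 4) = ennreal (2 * (\<gamma> / 4))"
          using g by (intro ennreal_mult[symmetric]) auto
        also have "ennreal (2 * q) + ennreal (2 * (\<gamma> / 4)) = ennreal (2 * q + 2 * (\<gamma> / 4))"
          using real g by (intro ennreal_plus[symmetric]) auto
        finally have "\<gamma> \<le> 2 * q + 2 * (\<gamma> / 4)" using real g by (subst (asm) ennreal_le_iff) auto
        then show ?thesis using real by (simp add: ennreal_leI)
      qed simp
      then have "prob {\<omega>\<in>space M. \<bar>u \<bullet> ?S ?i \<omega> + m\<bar> < \<delta>} \<le> \<delta> / sqrt (\<gamma> / 4)" for m
        using g d i unfolding quad_var_def
        by (intro step_increments_small_ball[OF BM(1) xs n]) auto
      also have "\<delta> / sqrt (\<gamma> / 4) = 1 / (5 * real K)" using g by (simp add: \<delta>_def)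
      finally show "\<exists>u\<in>U. norm u = 1 \<and> (\<forall>m. prob {\<omega>\<in>space M. \<bar>u \<bullet> ?S ?i \<omega> + m\<bar> < \<delta>} \<le> 1 / (5 * real K))"
        using u by blast
    qed
  qed
  have "prob A \<le> exp (- real (card J) / 2)"
    by (rule prob_le_of_eventually[OF A_ev B_ev _ ae B_prob]) simp
  then show ?thesis by (simp add: A_def Y_def[abs_def])
qed

end

section \<open>Expectation of the statistic\<close>

lemma borel_measurable_lborel_pair:
  "borel_measurable (lborel \<Otimes>\<^sub>M lborel) = borel_measurable (borel \<Otimes>\<^sub>M borel :: (real \<times> real) measure)"
  by (intro measurable_cong_sets sets_pair_measure_cong) simp_all

text \<open>Substituting \<open>s = t + v\<close> turns an integral over a strip around the diagonal into a
  superposition of increments over lags \<open>v\<close>.\<close>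

lemma nn_integral_near_diagonal:
  fixes G :: "real \<Rightarrow> real \<Rightarrow> ennreal"
  assumes G: "(\<lambda>p. G (fst p) (snd p)) \<in> borel_measurable (lborel \<Otimes>\<^sub>M lborel)"
    and sym: "\<And>s t. G s t = G t s" and h: "0 \<le> h"
    and D: "\<And>v. v \<in> {0..h} \<Longrightarrow> (\<integral>\<^sup>+t\<in>{0..1-v}. G (t + v) t \<partial>lborel) \<le> D"
  shows "(\<integral>\<^sup>+t. \<integral>\<^sup>+s. (if t \<in> {0..1} \<and> s \<in> {0..1} \<and> \<bar>s - t\<bar> \<le> h then G s t else 0) \<partial>lborel \<partial>lborel)
    \<le> 2 * ennreal h * D"
proof -
  \<comment> \<open>\<open>A\<close> lives on the half of the strip with \<open>t \<le> s\<close>;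
    the symmetry of \<open>G\<close> supplies the other half and the factor 2.\<close>
  define A where "A s t = (if 0 \<le> t \<and> s \<le> 1 \<and> 0 \<le> s - t \<and> s - t \<le> h then G s t else 0)" for s t
  have A: "(\<lambda>p. A (fst p) (snd p)) \<in> borel_measurable (lborel \<Otimes>\<^sub>M lborel)"
    using G unfolding A_def borel_measurable_lborel_pair by measurable
  have A1: "(\<lambda>(v, t). A (t + v) t) \<in> borel_measurable (lborel \<Otimes>\<^sub>M lborel)"
    using measurable_compose[OF _ A, of "\<lambda>p. (snd p + fst p, snd p)" "lborel \<Otimes>\<^sub>M lborel"]
    by (simp add: case_prod_unfold)
  have A_slice: "(\<lambda>s. A s t) \<in> borel_measurable lborel" "(\<lambda>s. A t s) \<in> borel_measurable lborel" for t
    using measurable_compose[OF _ A, of "\<lambda>s. (s, t)" lborel] measurable_compose[OF _ A, of "\<lambda>s. (t, s)" lborel]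
    by auto
  have A_swap: "(\<lambda>p. A (snd p) (fst p)) \<in> borel_measurable (lborel \<Otimes>\<^sub>M lborel)"
    using measurable_compose[OF _ A, of "\<lambda>p. (snd p, fst p)" "lborel \<Otimes>\<^sub>M lborel"] by simp
  have half: "(\<integral>\<^sup>+t. \<integral>\<^sup>+s. A s t \<partial>lborel \<partial>lborel) \<le> ennreal h * D"
  proof -
    have "(\<integral>\<^sup>+t. \<integral>\<^sup>+s. A s t \<partial>lborel \<partial>lborel) = (\<integral>\<^sup>+t. \<integral>\<^sup>+v. A (t + v) t \<partial>lborel \<partial>lborel)"
    proof (rule nn_integral_cong)
      fix t
      show "(\<integral>\<^sup>+s. A s t \<partial>lborel) = (\<integral>\<^sup>+v. A (t + v) t \<partial>lborel)"
        using nn_integral_real_affine[of "\<lambda>s. A s t" 1 t] A_slice(1)[of t] by simp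
    qed
    also have "\<dots> = (\<integral>\<^sup>+v. \<integral>\<^sup>+t. A (t + v) t \<partial>lborel \<partial>lborel)"
      by (rule lborel_pair.Fubini'[OF A1])
    also have "\<dots> \<le> (\<integral>\<^sup>+v. D * indicator {0..h} v \<partial>lborel)"
    proof (rule nn_integral_mono)
      fix v
      show "(\<integral>\<^sup>+t. A (t + v) t \<partial>lborel) \<le> D * indicator {0..h} v"
      proof (cases "v \<in> {0..h}")
        case True
        have "(\<integral>\<^sup>+t. A (t + v) t \<partial>lborel) = (\<integral>\<^sup>+t\<in>{0..1-v}. G (t + v) t \<partial>lborel)"
          using True by (intro nn_integral_cong) (auto simp: A_def indicator_def)
        then show ?thesis using D[OF True] True by simp
      next
        case False
        have "(\<integral>\<^sup>+t. A (t + v) t \<partial>lborel) = (\<integral>\<^sup>+t. 0 \<partial>(lborel :: real measure))"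
          using False by (intro nn_integral_cong) (auto simp: A_def)
        then show ?thesis by simp
      qed
    qed
    also have "\<dots> = ennreal h * D" using h by (simp add: nn_integral_cmult_indicator mult.commute)
    finally show ?thesis .
  qed
  have "(\<integral>\<^sup>+t. \<integral>\<^sup>+s. (if t \<in> {0..1} \<and> s \<in> {0..1} \<and> \<bar>s - t\<bar> \<le> h then G s t else 0) \<partial>lborel \<partial>lborel)
      \<le> (\<integral>\<^sup>+t. \<integral>\<^sup>+s. A s t + A t s \<partial>lborel \<partial>lborel)"
  proof (intro nn_integral_mono)
    fix t s :: real
    show "(if t \<in> {0..1} \<and> s \<in> {0..1} \<and> \<bar>s - t\<bar> \<le> h then G s t else 0) \<le> A s t + A t s"
      using sym[of s t] by (cases "t \<le> s") (auto simp: A_def add_increasing add_increasing2)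
  qed
  also have "\<dots> = (\<integral>\<^sup>+t. (\<integral>\<^sup>+s. A s t \<partial>lborel) + (\<integral>\<^sup>+s. A t s \<partial>lborel) \<partial>lborel)"
    using A_slice by (intro nn_integral_cong nn_integral_add) auto
  also have "\<dots> = (\<integral>\<^sup>+t. \<integral>\<^sup>+s. A s t \<partial>lborel \<partial>lborel) + (\<integral>\<^sup>+t. \<integral>\<^sup>+s. A t s \<partial>lborel \<partial>lborel)"
    using A A_swap by (intro nn_integral_add lborel.borel_measurable_nn_integral) (auto simp: case_prod_unfold)
  also have "(\<integral>\<^sup>+t. \<integral>\<^sup>+s. A t s \<partial>lborel \<partial>lborel) = (\<integral>\<^sup>+t. \<integral>\<^sup>+s. A s t \<partial>lborel \<partial>lborel)"
    by (rule lborel_pair.Fubini'[symmetric]) (use A in \<open>simp add: case_prod_unfold\<close>)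
  finally show ?thesis using half by (auto simp: mult_2 distrib_right intro: order_trans add_mono)
qed

lemma sum_grid_indicator_le_1:
  "0 < n \<Longrightarrow> (\<Sum>i<N. indicator (grid_cell n i) s :: ennreal) \<le> 1"
proof -
  assume n: "0 < n"
  have "(\<Sum>i<N. indicator (grid_cell n i) s :: ennreal) = indicator {0<..real N / real n} s"
  proof (induction N)
    case (Suc N)
    have "0 \<le> real N / real n" "real N / real n \<le> real (Suc N) / real n" by (simp_all add: divide_right_mono)
    moreover have "indicator {0<..y} s = (indicator {0<..x} s + indicator {x<..y} s :: ennreal)"
      if "0 \<le> x" "x \<le> y" for x y using that by (auto simp: indicator_def)
    ultimately have "indicator {0<..real (Suc N) / real n} s =
        (indicator {0<..real N / real n} s + indicator (grid_cell n N) s :: ennreal)"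
      by blast
    then show ?case using Suc by simp
  qed simp
  then show ?thesis by (simp add: indicator_def)
qed

text \<open>For symmetric \<open>S\<close> the orthogonal complement of the range is annihilated by
  \<open>S\<close>, and its dimension is known from the rank.\<close>

lemma kernel_orthonormal_basis:
  fixes S :: "real^'d^'d"
  assumes S: "transpose S = S"
  obtains B where "pairwise orthogonal B" "\<And>b. b \<in> B \<Longrightarrow> norm b = 1" "independent B"
    "dim (span B) = CARD('d) - rank S" "\<And>b. b \<in> B \<Longrightarrow> S *v b = 0" "card B \<le> CARD('d)"
proof -
  let ?R = "range (\<lambda>x. S *v x)"
  define U where "U = {y \<in> UNIV. \<forall>x\<in>?R. orthogonal x y}"
  have "subspace ?R" by (rule linear_subspace_image) auto
  then have dimU: "dim U + rank S = CARD('d)"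
    using dim_subspace_orthogonal_to_vectors[of ?R UNIV] by (simp add: U_def rank_dim_range)
  have "subspace U" by (auto simp: U_def subspace_def orthogonal_def inner_add_right)
  then obtain B where B: "B \<subseteq> U" "pairwise orthogonal B" "\<And>b. b \<in> B \<Longrightarrow> norm b = 1" "independent B"
      "card B = dim U" "span B = U"
    using orthonormal_basis_subspace by metis
  have "S *v b = 0" if "b \<in> B" for b
  proof -
    have "(S *v (S *v b)) \<bullet> b = 0" using B(1) that by (auto simp: U_def orthogonal_def)
    then have "(S *v b) \<bullet> (S *v b) = 0" using symmetric_matrix_dot[OF S] by simp
    then show ?thesis by simp
  qed
  then show ?thesis using that[OF B(2-4)] B(5,6) dimU by auto
qed

lemma borel_measurable_covariance:
  "\<sigma> \<in> borel_measurable M \<Longrightarrow> covariance \<sigma> \<in> borel_measurable M" for \<sigma> :: "real \<Rightarrow> real^'k::finite^'d::finite"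
proof -
  assume \<sigma>: "\<sigma> \<in> borel_measurable M"
  have "continuous_on UNIV (\<lambda>A :: real^'k^'d. A ** transpose A)"
    unfolding matrix_matrix_mult_def transpose_def by (intro continuous_intros) 
  from measurable_compose[OF \<sigma> borel_measurable_continuous_onI[OF this]]
  show ?thesis unfolding covariance_def[abs_def] .
qed

context prob_space
begin

text \<open>The factor 4 of each Ito part is doubled by splitting the square of the sum of the two
  parts.\<close>

lemma model_increment_second_moment_le:
  fixes B :: "real \<Rightarrow> 'a \<Rightarrow> real^'m::finite" and BZ :: "real \<Rightarrow> 'a \<Rightarrow> real^'d::finite"
  assumes model: "diffusion_model M B BZ \<sigma>X \<sigma>Z X Z" and i: "i < n"
  shows "(\<integral>\<^sup>+\<omega>. ennreal ((u \<bullet> ((X (real (Suc i) / real n) \<omega> + Z (real (Suc i) / real n) \<omega>) -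
      (X (real i / real n) \<omega> + Z (real i / real n) \<omega>)))\<^sup>2) \<partial>M) \<le>
    8 * (quad_var \<sigma>X (grid_cell n i) u +
      quad_var \<sigma>Z (grid_cell n i) u)"
proof -
  let ?t = "real (Suc i) / real n" and ?s = "real i / real n"
  have BM: "standard_brownian_motion M B" "standard_brownian_motion M BZ"
    and X: "ito_differential M B \<sigma>X X" and Z: "ito_differential M BZ \<sigma>Z Z"
    using model by (auto simp: diffusion_model_def)
  have meas: "X t \<in> borel_measurable M" "Z t \<in> borel_measurable M" if "t \<in> {0..1}" for t
    using X Z that by (simp_all add: ito_differential_def)
  let ?f = "\<lambda>\<omega>. u \<bullet> (X ?t \<omega> - X ?s \<omega>)" and ?g = "\<lambda>\<omega>. u \<bullet> (Z ?t \<omega> - Z ?s \<omega>)"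
  have fg: "?f \<in> borel_measurable M" "?g \<in> borel_measurable M"
    using meas grid_in_unit_interval[OF i]
    by (intro borel_measurable_inner borel_measurable_const borel_measurable_diff; blast)+
  have "(\<integral>\<^sup>+\<omega>. ennreal ((u \<bullet> ((X ?t \<omega> + Z ?t \<omega>) - (X ?s \<omega> + Z ?s \<omega>)))\<^sup>2) \<partial>M) =
      (\<integral>\<^sup>+\<omega>. ennreal ((?f \<omega> + ?g \<omega>)\<^sup>2) \<partial>M)"
    by (simp add: inner_diff_right inner_add_right algebra_simps)
  also have "\<dots> \<le> 2 * (\<integral>\<^sup>+\<omega>. ennreal ((?f \<omega>)\<^sup>2) \<partial>M) + 2 * (\<integral>\<^sup>+\<omega>. ennreal ((?g \<omega>)\<^sup>2) \<partial>M)"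
    using nn_integral_norm_add_sq_le[OF fg] by (simp only: real_norm_def power2_abs)
  also have "\<dots> \<le> 2 * (4 * quad_var \<sigma>X {?s<..?t} u) + 2 * (4 * quad_var \<sigma>Z {?s<..?t} u)"
    by (intro add_mono mult_left_mono ito_increment_second_moment_le[OF BM(1) X i]
        ito_increment_second_moment_le[OF BM(2) Z i]) auto
  also have "\<dots> = 8 * (quad_var \<sigma>X {?s<..?t} u + quad_var \<sigma>Z {?s<..?t} u)"
    by (simp add: distrib_left mult.assoc[symmetric])
  finally show ?thesis .
qed

text \<open>Each block is projected onto the kernel of \<open>\<Sigma>\<^sub>X(t)\<close> for a point \<open>t\<close> of the block;
  averaging over \<open>t\<close> leads to a double integral near the diagonal.\<close>

lemma rank_statistic_expectation_le:
  fixes B :: "real \<Rightarrow> 'a \<Rightarrow> real^'m::finite" and BZ :: "real \<Rightarrow> 'a \<Rightarrow> real^'d::finite" and g :: "real \<Rightarrow> real"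
  assumes model: "diffusion_model M B BZ \<sigma>X \<sigma>Z X Z" and n: "1 \<le> n" and K: "0 < K"
    and sym: "\<And>t. t \<in> {0..1} \<Longrightarrow> transpose (covariance \<sigma>X t) = covariance \<sigma>X t"
    and rank: "\<And>t. t \<in> {0..1} \<Longrightarrow> rank (covariance \<sigma>X t) < K"
    and g [measurable]: "g \<in> borel_measurable borel"
    and quad: "\<And>s t b. s \<in> {0..1} \<Longrightarrow> t \<in> {0..1} \<Longrightarrow> norm b = 1 \<Longrightarrow> covariance \<sigma>X t *v b = 0 \<Longrightarrow>
      b \<bullet> (covariance \<sigma>X s *v b) \<le> g (norm (covariance \<sigma>X s - covariance \<sigma>X t))"
    and DX: "\<And>v. v \<in> {0..real K / real n} \<Longrightarrow> v \<le> 1 \<Longrightarrow>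
      (\<integral>\<^sup>+t\<in>{0..1-v}. ennreal (g (norm (covariance \<sigma>X (t + v) - covariance \<sigma>X t))) \<partial>lborel) \<le> DX"
    and DZ: "(\<integral>\<^sup>+t\<in>{0..1}. ennreal (norm (covariance \<sigma>Z t)) \<partial>lborel) \<le> DZ"
  shows "(\<integral>\<^sup>+\<omega>. ennreal (rank_statistic K n (sampled_sum n X Z \<omega>)) \<partial>M) \<le>
    ennreal (16 * real K * real CARD('d)) * (DX + 2 * DZ)"
proof (cases "K \<le> n")
  case False
  then show ?thesis by (simp add: rank_statistic_def)
next
  case Kn: True
  have X: "ito_differential M B \<sigma>X X" and Z: "ito_differential M BZ \<sigma>Z Z"
    using model by (auto simp: diffusion_model_def)
  have XZ_meas: "X t \<in> borel_measurable M" "Z t \<in> borel_measurable M" if "t \<in> {0..1}" for t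
    using X Z that by (simp_all add: ito_differential_def)
  define h where "h = real K / real n"
  have h: "0 < h" "h \<le> 1" using Kn K n by (simp_all add: h_def)
  define SX where "SX = covariance (\<lambda>s. indicator {0..1} s *\<^sub>R \<sigma>X s)"
  define SZ where "SZ = covariance (\<lambda>s. indicator {0..1} s *\<^sub>R \<sigma>Z s)"
  have S_eq: "SX t = covariance \<sigma>X t" "SZ t = covariance \<sigma>Z t" if "t \<in> {0..1}" for t
    using that by (simp_all add: SX_def SZ_def covariance_def)
  have [measurable]: "SX \<in> borel_measurable lborel" "SZ \<in> borel_measurable lborel"
    using X Z unfolding SX_def SZ_def
    by (auto intro!: borel_measurable_covariance simp: ito_differential_def square_integrable_def set_borel_measurable_def)
  \<comment> \<open>The variance bound involves \<open>SZ s\<close> alone; the term in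
    \<open>SZ t\<close> makes \<open>F\<close> symmetric, as
    \<open>nn_integral_near_diagonal\<close> demands, and is the reason for two copies of
    \<open>DZ\<close> in the result.\<close>
  define F where "F s t = ennreal (g (norm (SX s - SX t))) + (ennreal (norm (SZ s)) + ennreal (norm (SZ t)))" for s t
  have F [measurable]: "(\<lambda>p. F (fst p) (snd p)) \<in> borel_measurable (lborel \<Otimes>\<^sub>M lborel)"
    unfolding F_def by measurable
  have F_slice: "(\<lambda>s. F s t) \<in> borel_measurable lborel" for t unfolding F_def by measurable
  let ?I = "\<lambda>i. (grid_cell n i)"
  let ?J = "\<lambda>j. {real (j * K) / real n<..real (j * K) / real n + h}"
  define Y where "Y \<omega> i = X (real i / real n) \<omega> + Z (real i / real n) \<omega>" for \<omega> i
  define D where "D j \<omega> = degeneracy K (\<lambda>l. Y \<omega> (Suc (j * K + l)) - Y \<omega> (j * K + l))" for j \<omega>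
  have Y_meas: "(\<lambda>\<omega>. Y \<omega> i) \<in> borel_measurable M" if "i \<le> n" for i
    unfolding Y_def using that n by (intro borel_measurable_add XZ_meas) auto
  have D_meas: "D j \<in> borel_measurable M" if "j < n div K" for j
    unfolding D_def[abs_def] using block_index_less[OF that]
    by (intro borel_measurable_degeneracy[OF K] borel_measurable_diff Y_meas) (auto simp: Suc_le_eq less_imp_le)
  \<comment> \<open>The factor 8 is that of the increment moments, \<open>K\<close> that of
    \<open>degeneracy_le_projections\<close>, and the dimension bounds the number of basis vectors
    of the kernel.\<close>
  let ?c = "ennreal (8 * real K * real CARD('d))"
  have block_01: "?J j \<subseteq> {0..1}" if "j < n div K" for j
  proof -
    have "Suc j * K \<le> n" using that by (metis Suc_leI div_times_less_eq_dividend le_trans mult_le_mono1)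
    then have "real (Suc j * K) \<le> real n" by (rule of_nat_mono)
    then have "real (j * K) / real n + h \<le> 1" using n by (simp add: h_def add_divide_distrib[symmetric] add.commute)
    moreover have "0 \<le> real (j * K) / real n" by simp
    moreover have "{a<..b} \<subseteq> {0..1}" if "b \<le> 1" "0 \<le> a" for a b :: real using that by auto
    ultimately show ?thesis by blast
  qed
  have I_J: "?I (j * K + l) \<subseteq> ?J j" if "l < K" for j l
  proof -
    have "real (j * K) / real n \<le> real (j * K + l) / real n" by (simp add: divide_right_mono)
    moreover have "real (Suc (j * K + l)) / real n \<le> real (j * K + K) / real n"
      using that by (intro divide_right_mono of_nat_mono) auto
    then have "real (Suc (j * K + l)) / real n \<le> real (j * K) / real n + h" by (simp add: h_def add_divide_distrib)
    moreover have "{a<..b} \<subseteq> {c<..d}" if "c \<le> a" "b \<le> d" for a b c d :: real using that by auto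
    ultimately show ?thesis by blast
  qed
  \<comment> \<open>The left side does not depend on the reference point \<open>t\<close>, which is
    what permits averaging over the block afterwards.\<close>
  have block: "(\<integral>\<^sup>+\<omega>. ennreal (D j \<omega>) \<partial>M) \<le> ?c * (\<Sum>l<K. \<integral>\<^sup>+s\<in>?I (j * K + l). F s t \<partial>lborel)"
    if j: "j < n div K" and t: "t \<in> ?J j" for j t
  proof -
    have t01: "t \<in> {0..1}" using block_01[OF j] t by blast
    obtain A where A: "pairwise orthogonal A" "\<And>b. b \<in> A \<Longrightarrow> norm b = 1" "independent A"
      and A_dim: "dim (span A) = CARD('d) - rank (covariance \<sigma>X t)"
      and A_ker: "\<And>b. b \<in> A \<Longrightarrow> covariance \<sigma>X t *v b = 0" and A_card: "card A \<le> CARD('d)"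
      by (rule kernel_orthonormal_basis[OF sym[OF t01]]) blast
    have fin: "finite A" using A(3) by (rule independent_imp_finite)
    have "rank (covariance \<sigma>X t) \<le> CARD('d)" using rank_bound[of "covariance \<sigma>X t"] by simp
    then have dim: "DIM(real^'d) < dim (span A) + K" using rank[OF t01] A_dim by simp
    have qv: "quad_var \<sigma>X (?I (j * K + l)) b + quad_var \<sigma>Z (?I (j * K + l)) b \<le> (\<integral>\<^sup>+s\<in>?I (j * K + l). F s t \<partial>lborel)"
      if l: "l < K" and b: "b \<in> A" for l b
    proof -
      let ?Il = "?I (j * K + l)"
      have I01: "s \<in> {0..1}" if "s \<in> ?Il" for s using I_J[OF l] block_01[OF j] that by blast
      have "quad_var \<sigma>X ?Il b \<le> (\<integral>\<^sup>+s\<in>?Il. ennreal (g (norm (SX s - SX t))) \<partial>lborel)"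
        unfolding quad_var_def
      proof (rule nn_integral_mono)
        fix s
        show "ennreal ((norm (transpose (\<sigma>X s) *v b))\<^sup>2) * indicator ?Il s \<le>
            ennreal (g (norm (SX s - SX t))) * indicator ?Il s"
        proof (cases "s \<in> ?Il")
          case True
          then have "(norm (transpose (\<sigma>X s) *v b))\<^sup>2 \<le> g (norm (SX s - SX t))"
            unfolding transpose_mult_covariance S_eq(1)[OF I01[OF True]] S_eq(1)[OF t01]
            using I01 t01 A(2)[OF b] A_ker[OF b] by (intro quad) auto
          then show ?thesis using True by (simp add: ennreal_leI del: of_nat_Suc)
        qed simp
      qed
      moreover have "quad_var \<sigma>Z ?Il b \<le> (\<integral>\<^sup>+s\<in>?Il. ennreal (norm (SZ s)) + ennreal (norm (SZ t)) \<partial>lborel)"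
        unfolding quad_var_def
      proof (rule nn_integral_mono)
        fix s
        show "ennreal ((norm (transpose (\<sigma>Z s) *v b))\<^sup>2) * indicator ?Il s \<le>
            (ennreal (norm (SZ s)) + ennreal (norm (SZ t))) * indicator ?Il s"
        proof (cases "s \<in> ?Il")
          case True
          have "(norm (transpose (\<sigma>Z s) *v b))\<^sup>2 = b \<bullet> (SZ s *v b)"
            unfolding transpose_mult_covariance S_eq(2)[OF I01[OF True]] ..
          also have "\<dots> \<le> norm b * norm (SZ s *v b)" by (rule norm_cauchy_schwarz)
          also have "\<dots> \<le> norm (SZ s)" using norm_matrix_vector_mult_le[of "SZ s" b] A(2)[OF b] by simp
          finally have "ennreal ((norm (transpose (\<sigma>Z s) *v b))\<^sup>2) \<le> ennreal (norm (SZ s)) + ennreal (norm (SZ t))"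
            by (simp add: ennreal_leI add_increasing2)
          then show ?thesis using True by (simp del: of_nat_Suc)
        qed simp
      qed
      ultimately have "quad_var \<sigma>X ?Il b + quad_var \<sigma>Z ?Il b \<le>
          (\<integral>\<^sup>+s\<in>?Il. ennreal (g (norm (SX s - SX t))) \<partial>lborel) +
          (\<integral>\<^sup>+s\<in>?Il. ennreal (norm (SZ s)) + ennreal (norm (SZ t)) \<partial>lborel)" by (rule add_mono)
      also have "\<dots> = (\<integral>\<^sup>+s\<in>?Il. F s t \<partial>lborel)"
        unfolding F_def distrib_right by (intro nn_integral_add[symmetric]) measurable
      finally show ?thesis .
    qed
    have sq_meas: "(\<lambda>\<omega>. ennreal ((b \<bullet> (Y \<omega> (Suc (j * K + l)) - Y \<omega> (j * K + l)))\<^sup>2)) \<in> borel_measurable M"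
      if "l < K" for l b
      using block_index_less[OF j that]
      by (intro measurable_compose[OF _ measurable_ennreal] borel_measurable_power borel_measurable_inner
          borel_measurable_const borel_measurable_diff Y_meas) auto
    have "(\<integral>\<^sup>+\<omega>. ennreal (D j \<omega>) \<partial>M) \<le>
        (\<integral>\<^sup>+\<omega>. ennreal (real K) * (\<Sum>l<K. \<Sum>b\<in>A. ennreal ((b \<bullet> (Y \<omega> (Suc (j * K + l)) - Y \<omega> (j * K + l)))\<^sup>2)) \<partial>M)"
    proof (rule nn_integral_mono)
      fix \<omega>
      have "ennreal (D j \<omega>) \<le>
          ennreal (real K * (\<Sum>l<K. \<Sum>b\<in>A. (b \<bullet> (Y \<omega> (Suc (j * K + l)) - Y \<omega> (j * K + l)))\<^sup>2))"
        unfolding D_def by (intro ennreal_leI degeneracy_le_projections[OF dim A])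
      also have "\<dots> = ennreal (real K) * (\<Sum>l<K. \<Sum>b\<in>A. ennreal ((b \<bullet> (Y \<omega> (Suc (j * K + l)) - Y \<omega> (j * K + l)))\<^sup>2))"
        by (simp add: ennreal_mult sum_nonneg sum_ennreal[symmetric] del: sum_ennreal)
      finally show "ennreal (D j \<omega>) \<le>
          ennreal (real K) * (\<Sum>l<K. \<Sum>b\<in>A. ennreal ((b \<bullet> (Y \<omega> (Suc (j * K + l)) - Y \<omega> (j * K + l)))\<^sup>2))" .
    qed
    also have "\<dots> = ennreal (real K) *
        (\<Sum>l<K. \<Sum>b\<in>A. \<integral>\<^sup>+\<omega>. ennreal ((b \<bullet> (Y \<omega> (Suc (j * K + l)) - Y \<omega> (j * K + l)))\<^sup>2) \<partial>M)"
    proof -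
      let ?q = "\<lambda>l b \<omega>. ennreal ((b \<bullet> (Y \<omega> (Suc (j * K + l)) - Y \<omega> (j * K + l)))\<^sup>2)"
      have m: "(\<lambda>\<omega>. \<Sum>b\<in>A. ?q l b \<omega>) \<in> borel_measurable M" if "l \<in> {..<K}" for l
        by (rule borel_measurable_sum, rule sq_meas) (use that in simp)
      have "(\<integral>\<^sup>+\<omega>. ennreal (real K) * (\<Sum>l<K. \<Sum>b\<in>A. ?q l b \<omega>) \<partial>M) =
          ennreal (real K) * (\<integral>\<^sup>+\<omega>. (\<Sum>l<K. \<Sum>b\<in>A. ?q l b \<omega>) \<partial>M)"
        by (rule nn_integral_cmult, rule borel_measurable_sum, rule m)
      also have "(\<integral>\<^sup>+\<omega>. (\<Sum>l<K. \<Sum>b\<in>A. ?q l b \<omega>) \<partial>M) = (\<Sum>l<K. \<integral>\<^sup>+\<omega>. (\<Sum>b\<in>A. ?q l b \<omega>) \<partial>M)"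
        by (intro nn_integral_sum m)
      also have "\<dots> = (\<Sum>l<K. \<Sum>b\<in>A. \<integral>\<^sup>+\<omega>. ?q l b \<omega> \<partial>M)"
        by (intro sum.cong refl nn_integral_sum sq_meas) simp
      finally show ?thesis .
    qed
    also have "\<dots> \<le> ennreal (real K) * (\<Sum>l<K. \<Sum>b\<in>A. 8 * (\<integral>\<^sup>+s\<in>?I (j * K + l). F s t \<partial>lborel))"
    proof (intro mult_left_mono sum_mono)
      fix l b assume "l \<in> {..<K}" and b: "b \<in> A"
      then have l: "l < K" by simp
      have "(\<integral>\<^sup>+\<omega>. ennreal ((b \<bullet> (Y \<omega> (Suc (j * K + l)) - Y \<omega> (j * K + l)))\<^sup>2) \<partial>M) \<le>
          8 * (quad_var \<sigma>X (?I (j * K + l)) b + quad_var \<sigma>Z (?I (j * K + l)) b)"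
        unfolding Y_def by (rule model_increment_second_moment_le[OF model block_index_less[OF j l]])
      also have "\<dots> \<le> 8 * (\<integral>\<^sup>+s\<in>?I (j * K + l). F s t \<partial>lborel)" by (intro mult_left_mono qv[OF l b]) simp
      finally show "(\<integral>\<^sup>+\<omega>. ennreal ((b \<bullet> (Y \<omega> (Suc (j * K + l)) - Y \<omega> (j * K + l)))\<^sup>2) \<partial>M) \<le>
          8 * (\<integral>\<^sup>+s\<in>?I (j * K + l). F s t \<partial>lborel)" .
    qed simp
    also have "\<dots> = ennreal (real K) * (of_nat (card A) * (8 * (\<Sum>l<K. \<integral>\<^sup>+s\<in>?I (j * K + l). F s t \<partial>lborel)))"
      by (simp add: sum_distrib_left)
    also have "\<dots> \<le> ennreal (real K) * (of_nat CARD('d) * (8 * (\<Sum>l<K. \<integral>\<^sup>+s\<in>?I (j * K + l). F s t \<partial>lborel)))"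
      using A_card by (intro mult_left_mono mult_right_mono of_nat_mono) auto
    also have "\<dots> = ?c * (\<Sum>l<K. \<integral>\<^sup>+s\<in>?I (j * K + l). F s t \<partial>lborel)"
      by (simp add: ennreal_mult ennreal_of_nat_eq_real_of_nat[symmetric] ac_simps)
    finally show ?thesis .
  qed
  \<comment> \<open>Two points of one block differ by at most its length \<open>h\<close>, so all
    blocks together see \<open>F\<close> only in this strip around the diagonal.\<close>
  let ?E = "\<lambda>t s. if t \<in> {0..1} \<and> s \<in> {0..1} \<and> \<bar>s - t\<bar> \<le> h then F s t else 0"
  have E_meas: "(\<lambda>p. ?E (fst p) (snd p)) \<in> borel_measurable (lborel \<Otimes>\<^sub>M lborel)"
  proof -
    have "(\<lambda>p. F (snd p) (fst p)) \<in> borel_measurable (lborel \<Otimes>\<^sub>M lborel)"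
      using measurable_compose[OF _ F, of "\<lambda>p. (snd p, fst p)" "lborel \<Otimes>\<^sub>M lborel"] by simp
    then show ?thesis unfolding borel_measurable_lborel_pair by measurable
  qed
  have E_slice: "(\<lambda>s. ?E t s) \<in> borel_measurable lborel" for t
    using measurable_compose[OF measurable_Pair1' E_meas, of t] by (simp only: fst_conv snd_conv space_lborel space_borel UNIV_I)
  have EI_meas: "(\<lambda>t. \<integral>\<^sup>+s. indicator (?I i) s * ?E t s \<partial>lborel) \<in> borel_measurable lborel" for i
  proof (rule lborel.borel_measurable_nn_integral)
    show "(\<lambda>(t, s). indicator (?I i) s * ?E t s) \<in> borel_measurable (lborel \<Otimes>\<^sub>M lborel)"
      unfolding case_prod_unfold
      by (intro borel_measurable_times_ennreal E_meas measurable_compose[OF measurable_snd borel_measurable_indicator]) simp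
  qed
  \<comment> \<open>Integration over \<open>t\<close> in the block multiplies the left side by the
    block length \<open>h\<close>.\<close>
  have "ennreal h * (\<integral>\<^sup>+\<omega>. ennreal (D j \<omega>) \<partial>M) \<le>
      ?c * (\<Sum>i\<in>{j * K..<j * K + K}. \<integral>\<^sup>+t. \<integral>\<^sup>+s. indicator (?I i) s * ?E t s \<partial>lborel \<partial>lborel)"
    if j: "j < n div K" for j
  proof -
    have "ennreal h * (\<integral>\<^sup>+\<omega>. ennreal (D j \<omega>) \<partial>M) = (\<integral>\<^sup>+t. (\<integral>\<^sup>+\<omega>. ennreal (D j \<omega>) \<partial>M) * indicator (?J j) t \<partial>lborel)"
      using h by (simp add: nn_integral_cmult_indicator mult.commute)
    also have "\<dots> \<le> (\<integral>\<^sup>+t. ?c * (\<Sum>l<K. \<integral>\<^sup>+s. indicator (?I (j * K + l)) s * ?E t s \<partial>lborel) \<partial>lborel)"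
    proof (rule nn_integral_mono)
      fix t
      show "(\<integral>\<^sup>+\<omega>. ennreal (D j \<omega>) \<partial>M) * indicator (?J j) t \<le>
          ?c * (\<Sum>l<K. \<integral>\<^sup>+s. indicator (?I (j * K + l)) s * ?E t s \<partial>lborel)"
      proof (cases "t \<in> ?J j")
        case True
        have "(\<Sum>l<K. \<integral>\<^sup>+s\<in>?I (j * K + l). F s t \<partial>lborel) \<le>
            (\<Sum>l<K. \<integral>\<^sup>+s. indicator (?I (j * K + l)) s * ?E t s \<partial>lborel)"
        proof (intro sum_mono nn_integral_mono)
          fix l s assume l: "l \<in> {..<K}"
          show "F s t * indicator (?I (j * K + l)) s \<le> indicator (?I (j * K + l)) s * ?E t s"
          proof (cases "s \<in> ?I (j * K + l)")
            case s: True
            then have sJ: "s \<in> ?J j" using I_J[of l j] l by blast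
            then have "\<bar>s - t\<bar> \<le> h" using True unfolding greaterThanAtMost_iff abs_le_iff by linarith
            then have "?E t s = F s t" using sJ True block_01[OF j] by (auto dest: subsetD)
            then show ?thesis by (simp only: mult.commute order_refl)
          qed (simp del: of_nat_Suc)
        qed
        then have "?c * (\<Sum>l<K. \<integral>\<^sup>+s\<in>?I (j * K + l). F s t \<partial>lborel) \<le>
            ?c * (\<Sum>l<K. \<integral>\<^sup>+s. indicator (?I (j * K + l)) s * ?E t s \<partial>lborel)"
          by (rule mult_left_mono) simp
        with block[OF j True] have "(\<integral>\<^sup>+\<omega>. ennreal (D j \<omega>) \<partial>M) \<le>
            ?c * (\<Sum>l<K. \<integral>\<^sup>+s. indicator (?I (j * K + l)) s * ?E t s \<partial>lborel)" by (rule order_trans)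
        then show ?thesis using True by (simp only: indicator_simps mult_1_right)
      next
        case False
        then have "indicator (?J j) t = (0::ennreal)" by (rule indicator_simps(2))
        then show ?thesis by (simp only: mult_zero_right zero_le)
      qed
    qed
    also have "\<dots> = ?c * (\<Sum>l<K. \<integral>\<^sup>+t. \<integral>\<^sup>+s. indicator (?I (j * K + l)) s * ?E t s \<partial>lborel \<partial>lborel)"
      by (subst nn_integral_cmult, intro borel_measurable_sum EI_meas, subst nn_integral_sum, intro EI_meas, rule refl)
    also have "(\<Sum>l<K. \<integral>\<^sup>+t. \<integral>\<^sup>+s. indicator (?I (j * K + l)) s * ?E t s \<partial>lborel \<partial>lborel) =
        (\<Sum>i\<in>{j * K..<j * K + K}. \<integral>\<^sup>+t. \<integral>\<^sup>+s. indicator (?I i) s * ?E t s \<partial>lborel \<partial>lborel)"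
      by (rule sum.reindex_bij_witness[of _ "\<lambda>i. i - j * K" "\<lambda>l. j * K + l"]) auto
    finally show ?thesis .
  qed
  then have "(\<Sum>j<n div K. ennreal h * (\<integral>\<^sup>+\<omega>. ennreal (D j \<omega>) \<partial>M)) \<le>
      (\<Sum>j<n div K. ?c * (\<Sum>i\<in>{j * K..<j * K + K}. \<integral>\<^sup>+t. \<integral>\<^sup>+s. indicator (?I i) s * ?E t s \<partial>lborel \<partial>lborel))"
    by (intro sum_mono) simp
  also have "\<dots> = ?c * (\<Sum>i<n div K * K. \<integral>\<^sup>+t. \<integral>\<^sup>+s. indicator (?I i) s * ?E t s \<partial>lborel \<partial>lborel)"
    by (simp only: sum_distrib_left[symmetric] sum.nat_group)
  also have "(\<Sum>i<n div K * K. \<integral>\<^sup>+t. \<integral>\<^sup>+s. indicator (?I i) s * ?E t s \<partial>lborel \<partial>lborel) \<le>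
      (\<integral>\<^sup>+t. \<integral>\<^sup>+s. ?E t s \<partial>lborel \<partial>lborel)"
  proof -
    have IE: "(\<lambda>s. indicator (?I i) s * ?E t s) \<in> borel_measurable lborel" for i t
      by (intro borel_measurable_times_ennreal E_slice borel_measurable_indicator) simp
    have "(\<Sum>i<n div K * K. \<integral>\<^sup>+t. \<integral>\<^sup>+s. indicator (?I i) s * ?E t s \<partial>lborel \<partial>lborel) =
        (\<integral>\<^sup>+t. (\<Sum>i<n div K * K. \<integral>\<^sup>+s. indicator (?I i) s * ?E t s \<partial>lborel) \<partial>lborel)"
      by (rule nn_integral_sum[symmetric], rule EI_meas)
    also have "\<dots> = (\<integral>\<^sup>+t. \<integral>\<^sup>+s. (\<Sum>i<n div K * K. indicator (?I i) s * ?E t s) \<partial>lborel \<partial>lborel)"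
      by (intro nn_integral_cong nn_integral_sum[symmetric] IE)
    also have "\<dots> \<le> (\<integral>\<^sup>+t. \<integral>\<^sup>+s. ?E t s \<partial>lborel \<partial>lborel)"
    proof (intro nn_integral_mono)
      fix t s
      have "(\<Sum>i<n div K * K. indicator (?I i) s * ?E t s) = (\<Sum>i<n div K * K. indicator (?I i) s) * ?E t s"
        by (rule sum_distrib_right[symmetric])
      also have "\<dots> \<le> 1 * ?E t s" using n by (intro mult_right_mono sum_grid_indicator_le_1) auto
      finally show "(\<Sum>i<n div K * K. indicator (?I i) s * ?E t s) \<le> ?E t s" by (simp only: mult_1)
    qed
    finally show ?thesis .
  qed
  also have "(\<integral>\<^sup>+t. \<integral>\<^sup>+s. ?E t s \<partial>lborel \<partial>lborel) \<le> 2 * ennreal h * (DX + 2 * DZ)"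
  proof (rule nn_integral_near_diagonal[OF F])
    show "F s t = F t s" for s t by (simp add: F_def norm_minus_commute add.commute)
    fix v assume v: "v \<in> {0..h}"
    then have v1: "v \<le> 1" using h by simp
    have t1: "(\<integral>\<^sup>+t\<in>{0..1-v}. ennreal (g (norm (SX (t + v) - SX t))) \<partial>lborel) \<le> DX"
    proof -
      have "(\<integral>\<^sup>+t\<in>{0..1-v}. ennreal (g (norm (SX (t + v) - SX t))) \<partial>lborel) =
          (\<integral>\<^sup>+t\<in>{0..1-v}. ennreal (g (norm (covariance \<sigma>X (t + v) - covariance \<sigma>X t))) \<partial>lborel)"
        using v by (intro nn_integral_cong) (auto simp: S_eq indicator_def)
      then show ?thesis using DX[of v] v v1 by (simp add: h_def)
    qed
    have SZ_int: "(\<integral>\<^sup>+t. ennreal (norm (SZ t)) * indicator {0..1} t \<partial>lborel) \<le> DZ"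
    proof -
      have "(\<integral>\<^sup>+t. ennreal (norm (SZ t)) * indicator {0..1} t \<partial>lborel) =
          (\<integral>\<^sup>+t\<in>{0..1}. ennreal (norm (covariance \<sigma>Z t)) \<partial>lborel)"
        by (intro nn_integral_cong) (auto simp: S_eq indicator_def)
      then show ?thesis using DZ by simp
    qed
    have t2: "(\<integral>\<^sup>+t\<in>{0..1-v}. ennreal (norm (SZ t)) \<partial>lborel) \<le> DZ"
      by (rule order_trans[OF nn_integral_mono SZ_int]) (use v in \<open>auto simp: indicator_def\<close>)
    have t3: "(\<integral>\<^sup>+t\<in>{0..1-v}. ennreal (norm (SZ (t + v))) \<partial>lborel) \<le> DZ"
    proof -
      have "(\<integral>\<^sup>+t\<in>{0..1-v}. ennreal (norm (SZ (t + v))) \<partial>lborel) \<le>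
          (\<integral>\<^sup>+t. ennreal (norm (SZ (v + 1 * t))) * indicator {0..1} (v + 1 * t) \<partial>lborel)"
        by (rule nn_integral_mono) (use v in \<open>auto simp: indicator_def add.commute\<close>)
      also have "\<dots> = (\<integral>\<^sup>+t. ennreal (norm (SZ t)) * indicator {0..1} t \<partial>lborel)"
        using nn_integral_real_affine[of "\<lambda>t. ennreal (norm (SZ t)) * indicator {0..1} t" 1 v] by simp
      finally show ?thesis using SZ_int by simp
    qed
    have "(\<integral>\<^sup>+t\<in>{0..1-v}. F (t + v) t \<partial>lborel) =
        (\<integral>\<^sup>+t\<in>{0..1-v}. ennreal (g (norm (SX (t + v) - SX t))) \<partial>lborel) +
        ((\<integral>\<^sup>+t\<in>{0..1-v}. ennreal (norm (SZ (t + v))) \<partial>lborel) + (\<integral>\<^sup>+t\<in>{0..1-v}. ennreal (norm (SZ t)) \<partial>lborel))"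
    proof -
      have m: "(\<lambda>t. ennreal (g (norm (SX (t + v) - SX t))) * indicator {0..1-v} t) \<in> borel_measurable lborel"
        "(\<lambda>t. ennreal (norm (SZ (t + v))) * indicator {0..1-v} t) \<in> borel_measurable lborel"
        "(\<lambda>t. ennreal (norm (SZ t)) * indicator {0..1-v} t) \<in> borel_measurable lborel"
        by measurable
      show ?thesis
        unfolding F_def distrib_right
        by (subst nn_integral_add[OF m(1) borel_measurable_add[OF m(2,3)]], subst nn_integral_add[OF m(2,3)], rule refl)
    qed
    also have "\<dots> \<le> DX + (DZ + DZ)" by (intro add_mono t1 t2 t3)
    finally show "(\<integral>\<^sup>+t\<in>{0..1-v}. F (t + v) t \<partial>lborel) \<le> DX + 2 * DZ" by (simp add: mult_2)
  qed (use h in simp)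
  finally have "(\<Sum>j<n div K. ennreal h * (\<integral>\<^sup>+\<omega>. ennreal (D j \<omega>) \<partial>M)) \<le> ?c * (2 * ennreal h * (DX + 2 * DZ))"
    by (simp add: mult_left_mono)
  moreover have "(\<integral>\<^sup>+\<omega>. ennreal (rank_statistic K n (Y \<omega>)) \<partial>M) = (\<Sum>j<n div K. \<integral>\<^sup>+\<omega>. ennreal (D j \<omega>) \<partial>M)"
  proof -
    have "ennreal (rank_statistic K n (Y \<omega>)) = (\<Sum>j<n div K. ennreal (D j \<omega>))" for \<omega>
      unfolding rank_statistic_def D_def using K by (intro sum_ennreal[symmetric] degeneracy_nonneg)
    then show ?thesis
      using D_meas by (simp only:) (rule nn_integral_sum, auto)
  qed
  ultimately have "ennreal h * (\<integral>\<^sup>+\<omega>. ennreal (rank_statistic K n (Y \<omega>)) \<partial>M) \<le>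
      ?c * (2 * ennreal h * (DX + 2 * DZ))"
    by (simp only: sum_distrib_left)
  \<comment> \<open>The strip contributes width of order \<open>h\<close>, which cancels the block
    length on the left and leaves a bound free of the number of blocks.\<close>
  also have "\<dots> = ennreal h * (?c * 2 * (DX + 2 * DZ))" by (simp only: ac_simps)
  finally have "ennreal h * (\<integral>\<^sup>+\<omega>. ennreal (rank_statistic K n (Y \<omega>)) \<partial>M) \<le>
      ennreal h * (?c * 2 * (DX + 2 * DZ))" .
  then have "(\<integral>\<^sup>+\<omega>. ennreal (rank_statistic K n (Y \<omega>)) \<partial>M) \<le> ?c * 2 * (DX + 2 * DZ)"
    using h by (simp add: ennreal_mult_le_mult_iff)
  also have "?c * 2 = ennreal (16 * real K * real CARD('d))"
    using ennreal_mult[of "8 * real K * real CARD('d)" 2] by (simp add: mult.assoc)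
  finally show ?thesis by (simp add: Y_def[abs_def])
qed

end

section \<open>Norms, null hypotheses and alternatives\<close>

lemma spectral_norm_nonneg: "0 \<le> spectral_norm S"
  unfolding spectral_norm_def by (rule onorm_pos_le) simp

text \<open>On matrices \<open>norm\<close> is the Euclidean norm of all entries. Its square is the
  sum over the columns, each the image of a unit vector.\<close>

lemma norm_sq_le_spectral_norm: "(norm S)\<^sup>2 \<le> real CARD('d) * (spectral_norm S)\<^sup>2" for S :: "real^'d^'d"
proof -
  have "(norm S)\<^sup>2 = (norm (transpose S))\<^sup>2" by (simp only: norm_transpose)
  also have "\<dots> = (\<Sum>i\<in>UNIV. (norm (column i S))\<^sup>2)"
    unfolding power2_norm_eq_inner inner_vec_def[of "transpose S"]
    by (simp add: transpose_def column_def)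
  also have "\<dots> \<le> (\<Sum>i\<in>(UNIV :: 'd set). (spectral_norm S)\<^sup>2)"
  proof (intro sum_mono power_mono)
    fix i
    have "norm (S *v axis i 1) \<le> onorm ((*v) S) * norm (axis i (1::real))" by (rule onorm) simp
    then show "norm (column i S) \<le> spectral_norm S"
      by (simp add: matrix_vector_mult_basis spectral_norm_def)
  qed simp
  also have "\<dots> = real CARD('d) * (spectral_norm S)\<^sup>2" by simp
  finally show ?thesis .
qed

lemma ennreal_powr_inverse_leD:
  assumes "ennreal_powr x (1 / p) \<le> ennreal y" "0 < p" "0 \<le> y"
  shows "x \<le> ennreal (y powr p)"
proof (cases x)
  case (real a)
  then have "a powr (1 / p) \<le> y" using assms by (simp add: ennreal_powr_def)
  then have "(a powr (1 / p)) powr p \<le> y powr p" using assms(2) by (intro powr_mono2) auto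
  then show ?thesis using real assms(2) by (simp add: powr_powr ennreal_leI)
next
  case top
  then show ?thesis using assms(1) by (simp add: ennreal_powr_def top_unique)
qed

text \<open>Each supremum is evaluated at one point, the scale \<open>h\<close> in the seminorm and
  the lag \<open>v\<close> in the modulus, and the weight \<open>h powr - \<beta>\<close> is
  cancelled.\<close>

lemma besov_increment_le:
  assumes S: "besov_seminorm p \<beta> S \<le> ennreal L" and p: "0 < p" and L: "0 \<le> L"
    and h: "0 < h" "h \<le> 1" and v: "v \<in> {0..h}"
  shows "(\<integral>\<^sup>+t\<in>{0..1-v}. ennreal (spectral_norm (S (t + v) - S t) powr p) \<partial>lborel) \<le>
    ennreal ((L * h powr \<beta>) powr p)"
proof (rule ennreal_powr_inverse_leD[OF _ p])
  let ?x = "ennreal_powr (\<integral>\<^sup>+t\<in>{0..1-v}. ennreal (spectral_norm (S (t + v) - S t) powr p) \<partial>lborel) (1 / p)"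
  have "?x \<le> Lp_modulus p S h" unfolding Lp_modulus_def by (rule SUP_upper[OF v])
  then have "ennreal (h powr - \<beta>) * ?x \<le> ennreal (h powr - \<beta>) * Lp_modulus p S h"
    by (rule mult_left_mono) simp
  also have "\<dots> \<le> besov_seminorm p \<beta> S"
    unfolding besov_seminorm_def using h by (intro SUP_upper) auto
  also note S
  finally have "ennreal (h powr \<beta>) * (ennreal (h powr - \<beta>) * ?x) \<le> ennreal (h powr \<beta>) * ennreal L"
    by (rule mult_left_mono) simp
  moreover have "ennreal (h powr \<beta>) * ennreal (h powr - \<beta>) = 1"
    using h by (simp add: ennreal_mult[symmetric] powr_add[symmetric])
  ultimately show "?x \<le> ennreal (L * h powr \<beta>)"
    using L by (simp add: mult.assoc[symmetric] ennreal_mult mult.commute)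
qed (use L in simp)

text \<open>The pointwise inequality \<open>f t \<le> w + (f t)\<^sup>2 / w\<close>, integrated over
  a set of measure at most one, replaces the Cauchy-Schwarz inequality; \<open>w\<close> is the
  expected size of \<open>f\<close>.\<close>

lemma first_moment_le:
  fixes f :: "real \<Rightarrow> real"
  assumes f [measurable]: "f \<in> borel_measurable lborel" and A: "A \<in> sets borel" "A \<subseteq> {0..1}"
    and w: "0 < w" and c: "0 \<le> c"
    and le: "(\<integral>\<^sup>+t\<in>A. ennreal ((f t)\<^sup>2) \<partial>lborel) \<le> ennreal (c * w\<^sup>2)"
  shows "(\<integral>\<^sup>+t\<in>A. ennreal (f t) \<partial>lborel) \<le> ennreal ((1 + c) * w)"
proof -
  have [measurable]: "A \<in> sets lborel" using A by simp
  have "(\<integral>\<^sup>+t\<in>A. ennreal (f t) \<partial>lborel) \<le>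
      (\<integral>\<^sup>+t. ennreal w * indicator {0..1} t + ennreal (1 / w) * (ennreal ((f t)\<^sup>2) * indicator A t) \<partial>lborel)"
  proof (rule nn_integral_mono)
    fix t
    show "ennreal (f t) * indicator A t \<le>
        ennreal w * indicator {0..1} t + ennreal (1 / w) * (ennreal ((f t)\<^sup>2) * indicator A t)"
    proof (cases "t \<in> A")
      case True
      have "f t \<le> w + 1 / w * (f t)\<^sup>2"
      proof -
        have "0 \<le> (f t - w)\<^sup>2 + (f t)\<^sup>2 + w\<^sup>2" by simp
        then have "f t * w \<le> w\<^sup>2 + (f t)\<^sup>2" by (simp add: power2_diff)
        then show ?thesis using w by (simp add: field_simps power2_eq_square)
      qed
      then have "ennreal (f t) \<le> ennreal (w + 1 / w * (f t)\<^sup>2)" by (rule ennreal_leI)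
      also have "\<dots> = ennreal w + ennreal (1 / w) * ennreal ((f t)\<^sup>2)"
        using w by (subst ennreal_plus) (auto simp: ennreal_mult[symmetric])
      finally show ?thesis using True A(2) by (auto dest: subsetD)
    qed simp
  qed
  also have "\<dots> = ennreal w + ennreal (1 / w) * (\<integral>\<^sup>+t\<in>A. ennreal ((f t)\<^sup>2) \<partial>lborel)"
    by (subst nn_integral_add) (auto simp: nn_integral_cmult)
  also have "\<dots> \<le> ennreal w + ennreal (1 / w) * ennreal (c * w\<^sup>2)"
    by (intro add_left_mono mult_left_mono le) simp
  also have "\<dots> = ennreal ((1 + c) * w)"
  proof -
    have "ennreal (1 / w) * ennreal (c * w\<^sup>2) = ennreal (c * w)"
      using w c by (simp add: ennreal_mult[symmetric] power2_eq_square)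
    then show ?thesis using w c by (simp add: ennreal_plus[symmetric] distrib_right del: ennreal_plus)
  qed
  finally show ?thesis .
qed

lemma nn_integral_scale_le:
  fixes f :: "real \<Rightarrow> real"
  assumes f [measurable]: "f \<in> borel_measurable lborel" and A: "A \<in> sets borel" and d: "0 < d"
    and le: "(\<integral>\<^sup>+t\<in>A. ennreal (f t / d) \<partial>lborel) \<le> ennreal y"
  shows "(\<integral>\<^sup>+t\<in>A. ennreal (f t) \<partial>lborel) \<le> ennreal (d * y)"
proof -
  have [measurable]: "A \<in> sets lborel" using A by simp
  have "ennreal (f t) = ennreal d * ennreal (f t / d)" for t
    using d ennreal_mult'[of d "f t / d"] by simp
  then have "(\<integral>\<^sup>+t\<in>A. ennreal (f t) \<partial>lborel) = (\<integral>\<^sup>+t. ennreal d * (ennreal (f t / d) * indicator A t) \<partial>lborel)"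
    by (simp only: mult.assoc)
  also have "\<dots> = ennreal d * (\<integral>\<^sup>+t\<in>A. ennreal (f t / d) \<partial>lborel)" by (rule nn_integral_cmult) measurable
  also have "\<dots> \<le> ennreal d * ennreal y" by (intro mult_left_mono le) simp
  also have "\<dots> = ennreal (d * y)" using d by (simp add: ennreal_mult')
  finally show ?thesis .
qed

context
  fixes \<sigma> :: "real \<Rightarrow> real^'k::finite^'d::finite"
  assumes \<sigma>: "set_borel_measurable lborel {0..1} \<sigma>"
begin

text \<open>The covariance is controlled on \<open>{0..1}\<close> only; a cut-off version is
  measurable on the whole line and agrees wherever the integrals look.\<close>

lemma covariance_increment_measurable:
  obtains f where "f \<in> borel_measurable lborel"
    "\<And>t. t \<in> {0..1-v} \<Longrightarrow> 0 \<le> v \<Longrightarrow> f t = norm (covariance \<sigma> (t + v) - covariance \<sigma> t)"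
proof -
  define S where "S = covariance (\<lambda>s. indicator {0..1} s *\<^sub>R \<sigma> s)"
  have [measurable]: "S \<in> borel_measurable borel"
    using \<sigma> unfolding S_def set_borel_measurable_def by (intro borel_measurable_covariance) simp
  have "S t = covariance \<sigma> t" if "t \<in> {0..1}" for t using that by (simp add: S_def covariance_def)
  then show ?thesis by (intro that[of "\<lambda>t. norm (S (t + v) - S t)"]) auto
qed

text \<open>The case \<open>p = 4\<close> is reduced to second moments, which is all the spectral gap case needs.\<close>

lemma covariance_increment_sq_le:
  assumes p: "p = 2 \<or> p = 4" and S: "besov_seminorm p \<beta> (covariance \<sigma>) \<le> ennreal L" and L: "0 < L"
    and h: "0 < h" "h \<le> 1" and v: "v \<in> {0..h}"
  shows "(\<integral>\<^sup>+t\<in>{0..1-v}. ennreal ((norm (covariance \<sigma> (t + v) - covariance \<sigma> t))\<^sup>2) \<partial>lborel) \<le>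
    ennreal ((1 + (real CARD('d))\<^sup>2) * (L * h powr \<beta>)\<^sup>2)"
proof -
  let ?d = "real CARD('d)"
  define w where "w = L * h powr \<beta>"
  have w: "0 < w" using L h by (simp add: w_def)
  let ?D = "\<lambda>t. covariance \<sigma> (t + v) - covariance \<sigma> t"
  let ?A = "{0..1-v}"
  obtain f where f [measurable]: "f \<in> borel_measurable lborel"
    and f_eq: "\<And>t. t \<in> ?A \<Longrightarrow> f t = norm (?D t)"
    using covariance_increment_measurable[of v] v by auto
  have A: "?A \<in> sets borel" "?A \<subseteq> {0..1}" using v by auto
  have spec: "(\<integral>\<^sup>+t\<in>?A. ennreal (spectral_norm (?D t) powr p) \<partial>lborel) \<le> ennreal (w powr p)"
    unfolding w_def using p L by (intro besov_increment_le[OF S _ _ h v]) auto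
  have d: "1 \<le> ?d" by (simp add: Suc_le_eq)
  have "(\<integral>\<^sup>+t\<in>?A. ennreal ((f t)\<^sup>2) \<partial>lborel) \<le> ennreal ((1 + ?d\<^sup>2) * w\<^sup>2)"
    using p
  proof
    assume p2: "p = 2"
    have "(\<integral>\<^sup>+t\<in>?A. ennreal ((f t)\<^sup>2 / ?d) \<partial>lborel) \<le> ennreal (w powr p)"
    proof (rule order_trans[OF nn_integral_mono spec])
      fix t
      show "ennreal ((f t)\<^sup>2 / ?d) * indicator ?A t \<le> ennreal (spectral_norm (?D t) powr p) * indicator ?A t"
      proof (cases "t \<in> ?A")
        case True
        have "(norm (?D t))\<^sup>2 / ?d \<le> spectral_norm (?D t) powr p"
          using norm_sq_le_spectral_norm[of "?D t"] d spectral_norm_nonneg[of "?D t"]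
          by (simp add: p2 divide_le_eq mult.commute)
        then show ?thesis using True by (simp add: f_eq ennreal_leI)
      qed simp
    qed
    then have "(\<integral>\<^sup>+t\<in>?A. ennreal ((f t)\<^sup>2) \<partial>lborel) \<le> ennreal (?d * (w powr p))"
      using d by (intro nn_integral_scale_le A) auto
    also have "\<dots> \<le> ennreal ((1 + ?d\<^sup>2) * w\<^sup>2)"
    proof (intro ennreal_leI)
      have "?d * 1 \<le> ?d * ?d" using d by (intro mult_left_mono) auto
      then have "?d \<le> 1 + ?d\<^sup>2" unfolding power2_eq_square by linarith
      then show "?d * (w powr p) \<le> (1 + ?d\<^sup>2) * w\<^sup>2" using w by (simp add: p2 mult_right_mono)
    qed
    finally show ?thesis .
  next
    assume p4: "p = 4"
    have "(\<integral>\<^sup>+t\<in>?A. ennreal (((f t)\<^sup>2)\<^sup>2 / ?d\<^sup>2) \<partial>lborel) \<le> ennreal (w powr p)"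
    proof (rule order_trans[OF nn_integral_mono spec])
      fix t
      show "ennreal (((f t)\<^sup>2)\<^sup>2 / ?d\<^sup>2) * indicator ?A t \<le> ennreal (spectral_norm (?D t) powr p) * indicator ?A t"
      proof (cases "t \<in> ?A")
        case True
        have "((norm (?D t))\<^sup>2)\<^sup>2 \<le> (?d * (spectral_norm (?D t))\<^sup>2)\<^sup>2"
          by (intro power_mono norm_sq_le_spectral_norm) simp
        then have "((norm (?D t))\<^sup>2)\<^sup>2 / ?d\<^sup>2 \<le> spectral_norm (?D t) powr p"
          using d spectral_norm_nonneg[of "?D t"]
          by (simp add: p4 divide_le_eq power_mult_distrib power_mult[symmetric] mult.commute)
        then show ?thesis using True by (simp add: f_eq ennreal_leI)
      qed simp
    qed
    then have "(\<integral>\<^sup>+t\<in>?A. ennreal (((f t)\<^sup>2)\<^sup>2) \<partial>lborel) \<le> ennreal (?d\<^sup>2 * (w powr p))"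
      using d by (intro nn_integral_scale_le A) auto
    also have "?d\<^sup>2 * (w powr p) = ?d\<^sup>2 * (w\<^sup>2)\<^sup>2" using w by (simp add: p4 power_mult[symmetric])
    \<comment> \<open>Applied to the squared norm at scale \<open>w\<^sup>2\<close>, which turns a
      fourth moment into a second moment.\<close>
    finally show ?thesis using w by (intro first_moment_le A) auto
  qed
  moreover have "(\<integral>\<^sup>+t\<in>?A. ennreal ((f t)\<^sup>2) \<partial>lborel) = (\<integral>\<^sup>+t\<in>?A. ennreal ((norm (?D t))\<^sup>2) \<partial>lborel)"
    by (intro nn_integral_cong) (auto simp: f_eq indicator_def)
  ultimately show ?thesis by (simp add: w_def)
qed

lemma covariance_increment_le:
  assumes p: "p = 2 \<or> p = 4" and S: "besov_seminorm p \<beta> (covariance \<sigma>) \<le> ennreal L" and L: "0 < L"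
    and h: "0 < h" "h \<le> 1" and v: "v \<in> {0..h}"
  shows "(\<integral>\<^sup>+t\<in>{0..1-v}. ennreal (norm (covariance \<sigma> (t + v) - covariance \<sigma> t)) \<partial>lborel) \<le>
    ennreal ((2 + (real CARD('d))\<^sup>2) * (L * h powr \<beta>))"
proof -
  let ?A = "{0..1-v}"
  obtain f where f: "f \<in> borel_measurable lborel"
    and f_eq: "\<And>t. t \<in> ?A \<Longrightarrow> f t = norm (covariance \<sigma> (t + v) - covariance \<sigma> t)"
    using covariance_increment_measurable[of v] v by auto
  have eq: "(\<integral>\<^sup>+t\<in>?A. ennreal (F (f t)) \<partial>lborel) =
      (\<integral>\<^sup>+t\<in>?A. ennreal (F (norm (covariance \<sigma> (t + v) - covariance \<sigma> t))) \<partial>lborel)" for F :: "real \<Rightarrow> real"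
    by (intro nn_integral_cong) (auto simp: f_eq indicator_def)
  have "(\<integral>\<^sup>+t\<in>?A. ennreal (f t) \<partial>lborel) \<le> ennreal ((1 + (1 + (real CARD('d))\<^sup>2)) * (L * h powr \<beta>))"
    using v L h covariance_increment_sq_le[OF assms]
    by (intro first_moment_le[OF f]) (auto simp: eq[of "\<lambda>x. x\<^sup>2"])
  then show ?thesis by (simp add: eq[of "\<lambda>x. x"])
qed

text \<open>A positive \<open>w\<close> stands in for \<open>\<epsilon>\<close>, which may be zero,
  because \<open>first_moment_le\<close> divides by its scale.\<close>

lemma covariance_norm_le:
  assumes S: "Lp_norm 2 (covariance \<sigma>) \<le> ennreal \<epsilon>" and e: "0 \<le> \<epsilon>" "\<epsilon> \<le> w" "0 < w"
  shows "(\<integral>\<^sup>+t\<in>{0..1}. ennreal (norm (covariance \<sigma> t)) \<partial>lborel) \<le> ennreal ((1 + real CARD('d)) * w)"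
proof -
  let ?d = "real CARD('d)"
  have d: "1 \<le> ?d" by (simp add: Suc_le_eq)
  define S' where "S' = covariance (\<lambda>s. indicator {0..1} s *\<^sub>R \<sigma> s)"
  have [measurable]: "S' \<in> borel_measurable borel"
    using \<sigma> unfolding S'_def set_borel_measurable_def by (intro borel_measurable_covariance) simp
  have S'_eq: "S' t = covariance \<sigma> t" if "t \<in> {0..1}" for t using that by (simp add: S'_def covariance_def)
  have spec: "(\<integral>\<^sup>+t\<in>{0..1}. ennreal (spectral_norm (covariance \<sigma> t) powr 2) \<partial>lborel) \<le> ennreal (\<epsilon> powr 2)"
    using S e unfolding Lp_norm_def by (intro ennreal_powr_inverse_leD) auto
  have "(\<integral>\<^sup>+t\<in>{0..1}. ennreal ((norm (S' t))\<^sup>2 / ?d) \<partial>lborel) \<le> ennreal (\<epsilon> powr 2)"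
  proof (rule order_trans[OF nn_integral_mono spec])
    fix t
    show "ennreal ((norm (S' t))\<^sup>2 / ?d) * indicator {0..1} t \<le>
        ennreal (spectral_norm (covariance \<sigma> t) powr 2) * indicator {0..1} t"
    proof (cases "t \<in> {0..1::real}")
      case True
      have "(norm (covariance \<sigma> t))\<^sup>2 / ?d \<le> spectral_norm (covariance \<sigma> t) powr 2"
        using norm_sq_le_spectral_norm[of "covariance \<sigma> t"] d spectral_norm_nonneg[of "covariance \<sigma> t"]
        by (simp add: divide_le_eq mult.commute)
      then show ?thesis using True by (simp add: S'_eq ennreal_leI)
    qed simp
  qed
  then have "(\<integral>\<^sup>+t\<in>{0..1}. ennreal ((norm (S' t))\<^sup>2) \<partial>lborel) \<le> ennreal (?d * (\<epsilon> powr 2))"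
    using d by (intro nn_integral_scale_le) auto
  also have "\<dots> \<le> ennreal (?d * w\<^sup>2)" using e by (intro ennreal_leI mult_left_mono) (auto simp: power_mono)
  finally have "(\<integral>\<^sup>+t\<in>{0..1}. ennreal (norm (S' t)) \<partial>lborel) \<le> ennreal ((1 + ?d) * w)"
    using e by (intro first_moment_le) auto
  moreover have "(\<integral>\<^sup>+t\<in>{0..1}. ennreal (norm (S' t)) \<partial>lborel) = (\<integral>\<^sup>+t\<in>{0..1}. ennreal (norm (covariance \<sigma> t)) \<partial>lborel)"
    by (intro nn_integral_cong) (auto simp: S'_eq indicator_def)
  ultimately show ?thesis by simp
qed

text \<open>The trace of \<open>\<Sigma>\<^sub>X(t)\<close> over \<open>U\<close> dominates \<open>eigval K (\<Sigma>\<^sub>X(t))\<close> for every \<open>t\<close>, although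
  the maximising direction in \<open>U\<close> may depend on \<open>t\<close>.\<close>

lemma quad_var_direction:
  assumes I: "I = {s<..t}" "0 \<le> s" "s \<le> t" "t \<le> 1"
    and psd: "\<And>x. x \<in> I \<Longrightarrow> transpose (covariance \<sigma> x) = covariance \<sigma> x"
    and eig: "\<And>x. x \<in> I \<Longrightarrow> \<mu> \<le> eigval K (covariance \<sigma> x)" and l: "0 < \<mu>" and st: "s < t"
    and K: "1 \<le> K" "K \<le> CARD('d)" and U: "subspace U" "CARD('d) < dim U + K"
  obtains u where "u \<in> U" "norm u = 1" "ennreal (\<mu> * (t - s) / (2 * real CARD('d))) \<le> quad_var \<sigma> I u"
proof (rule ccontr)
  assume neg: "\<not> thesis"
  \<comment> \<open>If every unit vector of \<open>U\<close> stayed below \<open>?\<gamma>\<close>,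
    an orthonormal basis of \<open>U\<close> would collect at most
    \<open>\<mu> * (t - s) / 2\<close>, while its trace integral is at least
    \<open>\<mu> * (t - s)\<close>.\<close>
  let ?\<gamma> = "\<mu> * (t - s) / (2 * real CARD('d))"
  have no_direction: "\<not> (u \<in> U \<and> norm u = 1 \<and> ennreal ?\<gamma> \<le> quad_var \<sigma> I u)" for u
    using that neg by blast
  obtain B where B: "B \<subseteq> U" "pairwise orthogonal B" "\<And>b. b \<in> B \<Longrightarrow> norm b = 1" "independent B"
      "card B = dim U" "span B = U"
    using orthonormal_basis_subspace[OF U(1)] by metis
  have fin: "finite B" using B(4) by (rule independent_imp_finite)
  have small: "quad_var \<sigma> I b \<le> ennreal ?\<gamma>" if "b \<in> B" for b
    using no_direction[of b] B(1,3) that linear by blast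
  define \<sigma>' where "\<sigma>' x = indicator {0..1} x *\<^sub>R \<sigma> x" for x :: real
  have [measurable]: "\<sigma>' \<in> borel_measurable lborel"
    using \<sigma> by (simp add: \<sigma>'_def[abs_def] set_borel_measurable_def)
  have \<sigma>'_eq: "\<sigma>' x = \<sigma> x" if "x \<in> I" for x using that I by (simp add: \<sigma>'_def)
  have meas: "(\<lambda>x. ennreal ((norm (transpose (\<sigma>' x) *v b))\<^sup>2) * indicator I x) \<in> borel_measurable lborel" for b
  proof -
    have "(\<lambda>x. (norm (transpose (\<sigma>' x) *v b))\<^sup>2) \<in> borel_measurable lborel"
      by (rule measurable_compose[OF _ borel_measurable_transpose_mult]) measurable
    then show ?thesis using I(1) by (intro borel_measurable_times_ennreal measurable_compose[OF _ measurable_ennreal]) auto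
  qed
  have point: "\<mu> \<le> (\<Sum>b\<in>B. (norm (transpose (\<sigma>' x) *v b))\<^sup>2)" if x: "x \<in> I" for x
  proof -
    let ?T = "\<lambda>b. transpose (\<sigma> x) *v b"
    obtain u where u: "u \<in> U" "norm u = 1" "eigval K (covariance \<sigma> x) \<le> u \<bullet> (covariance \<sigma> x *v u)"
      by (rule eigval_le_quadratic_form[OF psd[OF x] K U])
    define a where "a b = b \<bullet> u" for b
    have a: "u = (\<Sum>b\<in>B. a b *\<^sub>R b)"
      unfolding a_def using u(1) B(6) by (intro orthonormal_basis_coefficients B(2-4)) auto
    have a2: "(\<Sum>b\<in>B. (a b)\<^sup>2) = 1"
      unfolding a_def using norm_sum_orthonormal_basis[OF B(2-4), of u] u(1,2) B(6) by simp
    have "\<mu> \<le> (norm (?T u))\<^sup>2"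
      using eig[OF x] u(3) unfolding transpose_mult_covariance by linarith
    also have "?T u = (\<Sum>b\<in>B. a b *\<^sub>R ?T b)"
      by (subst a) (simp only: linear_sum[OF matrix_vector_mul_linear] matrix_vector_mult_scaleR)
    also have "(norm \<dots>)\<^sup>2 \<le> (\<Sum>b\<in>B. \<bar>a b\<bar> * norm (?T b))\<^sup>2"
      by (intro power_mono order_trans[OF norm_sum]) auto
    also have "\<dots> \<le> (\<Sum>b\<in>B. \<bar>a b\<bar>\<^sup>2) * (\<Sum>b\<in>B. (norm (?T b))\<^sup>2)" by (rule Cauchy_Schwarz_ineq_sum)
    also have "\<dots> = (\<Sum>b\<in>B. (norm (?T b))\<^sup>2)" by (simp add: a2)
    finally show ?thesis by (simp only: \<sigma>'_eq[OF x])
  qed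
  have "ennreal (\<mu> * (t - s)) = (\<integral>\<^sup>+x. ennreal \<mu> * indicator I x \<partial>lborel)"
    using I l by (simp add: nn_integral_cmult_indicator ennreal_mult)
  also have "\<dots> \<le> (\<integral>\<^sup>+x. (\<Sum>b\<in>B. ennreal ((norm (transpose (\<sigma>' x) *v b))\<^sup>2) * indicator I x) \<partial>lborel)"
  proof (rule nn_integral_mono)
    fix x
    show "ennreal \<mu> * indicator I x \<le> (\<Sum>b\<in>B. ennreal ((norm (transpose (\<sigma>' x) *v b))\<^sup>2) * indicator I x)"
    proof (cases "x \<in> I")
      case True
      have "ennreal \<mu> \<le> ennreal (\<Sum>b\<in>B. (norm (transpose (\<sigma>' x) *v b))\<^sup>2)" by (rule ennreal_leI[OF point[OF True]])
      also have "\<dots> = (\<Sum>b\<in>B. ennreal ((norm (transpose (\<sigma>' x) *v b))\<^sup>2))" by (rule sum_ennreal[symmetric]) simp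
      finally show ?thesis using True by simp
    qed simp
  qed
  also have "\<dots> = (\<Sum>b\<in>B. \<integral>\<^sup>+x. ennreal ((norm (transpose (\<sigma>' x) *v b))\<^sup>2) * indicator I x \<partial>lborel)"
    by (rule nn_integral_sum[OF meas])
  also have "\<dots> = (\<Sum>b\<in>B. quad_var \<sigma> I b)"
    unfolding quad_var_def by (intro sum.cong refl nn_integral_cong) (auto simp: \<sigma>'_eq indicator_def)
  also have "\<dots> \<le> (\<Sum>b\<in>B. ennreal ?\<gamma>)" by (intro sum_mono small)
  also have "\<dots> = ennreal (real (card B)) * ennreal ?\<gamma>"
    by (simp only: sum_constant ennreal_of_nat_eq_real_of_nat)
  also have "\<dots> = ennreal (real (card B) * ?\<gamma>)"
    using l st by (intro ennreal_mult[symmetric]) auto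
  also have "\<dots> \<le> ennreal (real CARD('d) * ?\<gamma>)"
    using l st B(5) dim_subset_UNIV_cart[of U] by (intro ennreal_leI mult_right_mono) auto
  also have "real CARD('d) * ?\<gamma> = \<mu> * (t - s) / 2" by simp
  finally show False using l st by (subst (asm) ennreal_le_iff) auto
qed

end

text \<open>The prefactor comes from \<open>rank_statistic_expectation_le\<close> with
  \<open>K = Suc r\<close>. In the bracket stand the bound for increments of
  \<open>\<Sigma>\<^sub>X\<close> at lags up to \<open>K / n\<close> and twice the bound for the
  norm of \<open>\<Sigma>\<^sub>Z\<close>.\<close>

definition null_constant :: "nat \<Rightarrow> nat \<Rightarrow> real" where
  "null_constant d r = 16 * real (Suc r) * real d * ((2 + (real d)\<^sup>2) * (real (Suc r))\<^sup>2 + 2 * (1 + real d))"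

section \<open>The statistic under the alternative and under the null hypotheses\<close>

lemma quadratic_form_diff_le:
  fixes S T :: "real^'d^'d"
  assumes "norm b = 1" "T *v b = 0"
  shows "norm (S *v b) \<le> norm (S - T)" "b \<bullet> (S *v b) \<le> norm (S - T)"
proof -
  have "S *v b = (S - T) *v b" using assms(2) by (simp add: matrix_vector_mult_diff_rdistrib)
  then show 1: "norm (S *v b) \<le> norm (S - T)" using norm_matrix_vector_mult_le[of "S - T" b] assms(1) by simp
  have "b \<bullet> (S *v b) \<le> norm b * norm (S *v b)" by (rule norm_cauchy_schwarz)
  then show "b \<bullet> (S *v b) \<le> norm (S - T)" using 1 assms(1) by simp
qed

context prob_space
begin

lemma rank_statistic_alternative:
  fixes B :: "real \<Rightarrow> 'a \<Rightarrow> real^'m::finite" and BZ :: "real \<Rightarrow> 'a \<Rightarrow> real^'d::finite"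
  assumes model: "diffusion_model M B BZ \<sigma>X \<sigma>Z X Z" and r: "r < CARD('d)"
    and H1: "covariance \<sigma>X \<in> H1 r hbar v" and v: "0 < v" and hbar: "0 < hbar" "hbar < 1"
  defines "K \<equiv> Suc r"
  assumes nh: "4 * real K \<le> real n * hbar" and \<kappa>: "3200 * real CARD('d) * real K ^ 3 * \<kappa> < v"
  shows "prob {\<omega>\<in>space M. rank_statistic K n (sampled_sum n X Z \<omega>) \<le> \<kappa>}
    \<le> exp (- (real n * hbar / (4 * real K)))"
proof -
  let ?S = "covariance \<sigma>X" and ?d = "real CARD('d)"
  have K: "0 < K" "1 \<le> K" "K \<le> CARD('d)" using r by (auto simp: K_def)
  have n: "0 < n" "1 \<le> n" using nh K(1) by (cases n; force)+
  have psd: "psd (?S t)" if "t \<in> {0..1}" for t using H1 that by (auto simp: H1_def)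
  let ?T = "{(b - a) * (INF t\<in>{a..b}. eigval (r + 1) (?S t)) | a b. 0 \<le> a \<and> b \<le> 1 \<and> hbar \<le> b - a}"
  \<comment> \<open>The supremum need not be attained; giving up a factor 2 selects an actual
    interval.\<close>
  have "\<exists>y\<in>?T. v / 2 < y"
  proof (rule less_cSupD)
    have "(1 - 0) * (INF t\<in>{0..1}. eigval (r + 1) (?S t)) \<in> ?T"
      by (rule CollectI, rule exI[of _ 0], rule exI[of _ 1]) (use hbar in auto)
    then show "?T \<noteq> {}" by blast
    show "v / 2 < Sup ?T" using H1 v by (auto simp: H1_def)
  qed
  then obtain a b where ab: "0 \<le> a" "b \<le> 1" "hbar \<le> b - a"
    and big: "v / 2 < (b - a) * (INF t\<in>{a..b}. eigval (r + 1) (?S t))"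
    by blast
  define \<mu> where "\<mu> = (INF t\<in>{a..b}. eigval (r + 1) (?S t))"
  have l: "0 < \<mu>"
  proof -
    have "0 < (b - a) * \<mu>" using big v by (simp add: \<mu>_def)
    then show ?thesis using ab(3) hbar by (simp add: zero_less_mult_iff)
  qed
  have eig: "\<mu> \<le> eigval K (?S t)" if "t \<in> {a..b}" for t
  proof -
    \<comment> \<open>A real infimum bounds its values only for sets bounded below, which holds
      because eigenvalues of positive semidefinite matrices are nonnegative.\<close>
    have "bdd_below ((\<lambda>t. eigval (r + 1) (?S t)) ` {a..b})"
      using ab r by (intro bdd_belowI2[of _ 0] eigval_nonneg psd) auto
    from cINF_lower[OF this that] show ?thesis by (simp add: \<mu>_def K_def)
  qed
  \<comment> \<open>\<open>J\<close> collects the indices \<open>j\<close> for which the time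
    interval from \<open>j * K / n\<close> to \<open>Suc j * K / n\<close> lies inside
    \<open>[a, b]\<close>.\<close>
  define lo where "lo = nat \<lceil>a * real n / real K\<rceil>"
  define hi where "hi = nat \<lfloor>b * real n / real K\<rfloor>"
  define J where "J = {lo..<hi}"
  have b0: "0 \<le> b" using ab hbar by linarith
  have lo: "a * real n / real K \<le> real lo" unfolding lo_def by linarith
  have "0 \<le> a * real n / real K" using ab(1) by simp
  then have lo': "real lo \<le> a * real n / real K + 1" unfolding lo_def by linarith
  have hi: "real hi \<le> b * real n / real K" unfolding hi_def using b0 by (simp add: of_nat_floor)
  have hi': "b * real n / real K - 1 \<le> real hi" unfolding hi_def by linarith
  \<comment> \<open>Rounding at the two ends loses at most two blocks, and by \<open>nh\<close> the
    interval has room for at least four, so at least half of \<open>n * (b - a) / K\<close>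
    remain.\<close>
  have J_card: "real n * (b - a) / (2 * real K) \<le> real (card J)"
  proof -
    have "4 * real K \<le> real n * (b - a)"
      using nh mult_left_mono[OF ab(3), of "real n"] by linarith
    then have "2 \<le> real n * (b - a) / (2 * real K)" using K by (simp add: field_simps)
    moreover have "b * real n / real K - a * real n / real K = 2 * (real n * (b - a) / (2 * real K))"
      using K by (simp add: field_simps)
    ultimately have "real n * (b - a) / (2 * real K) \<le> real hi - real lo" using lo' hi' by linarith
    also have "\<dots> \<le> real (card J)" by (simp add: J_def)
    finally show ?thesis .
  qed
  have J_in: "a \<le> real (j * K) / real n" "real (j * K + K) / real n \<le> b" "j < n div K" if "j \<in> J" for j
  proof -
    have "a * real n / real K \<le> real j" "real (Suc j) \<le> b * real n / real K"
      using that lo hi by (auto simp: J_def)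
    then have *: "a * real n \<le> real j * real K" "real (Suc j) * real K \<le> b * real n"
      using K by (simp_all add: field_simps)
    then show "a \<le> real (j * K) / real n" "real (j * K + K) / real n \<le> b"
      using n by (simp_all add: field_simps)
    have "b * real n \<le> 1 * real n" using ab(2) by (intro mult_right_mono) auto
    then have "real (Suc j * K) \<le> real n" using *(2) unfolding of_nat_mult by linarith
    then have "Suc j * K \<le> n" by (simp only: of_nat_le_iff)
    then show "j < n div K" using K(1) by (simp add: less_eq_div_iff_mult_less_eq Suc_le_eq[symmetric])
  qed
  \<comment> \<open>The directional variance that \<open>quad_var_direction\<close> yields on a grid
    cell of length \<open>1 / n\<close>.\<close>
  define \<gamma> where "\<gamma> = \<mu> / (2 * ?d * real n)"
  have g: "0 < \<gamma>" using l n by (simp add: \<gamma>_def)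
  have "\<kappa> < \<gamma> * real (card J) / (400 * (real K)\<^sup>2)"
  \<comment> \<open>The constant is \<open>3200 = 400 * 2 * 2 * 2\<close>: the 400 of the small-ball
    argument, and factors 2 from \<open>\<gamma>\<close>, from the block count and from passing to
    \<open>v / 2\<close>.\<close>
  proof -
    have "\<kappa> < v / (3200 * ?d * real K ^ 3)"
      using \<kappa> K by (simp add: pos_less_divide_eq mult.commute)
    also have "\<dots> \<le> (2 * ((b - a) * \<mu>)) / (3200 * ?d * real K ^ 3)"
      using big K by (intro divide_right_mono) (auto simp: \<mu>_def)
    also have "\<dots> = \<gamma> * (real n * (b - a) / (2 * real K)) / (400 * (real K)\<^sup>2)"
      using n K by (simp add: \<gamma>_def field_simps power2_eq_square power3_eq_cube)
    also have "\<dots> \<le> \<gamma> * real (card J) / (400 * (real K)\<^sup>2)"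
      using g J_card by (intro divide_right_mono mult_left_mono) auto
    finally show ?thesis .
  qed
  then have "prob {\<omega>\<in>space M. rank_statistic K n (sampled_sum n X Z \<omega>) \<le> \<kappa>}
      \<le> exp (- real (card J) / 2)"
  proof (rule prob_rank_statistic_ito[OF model K(1) n(2) _ g, rotated -1])
    show "J \<subseteq> {..<n div K}" using J_in(3) by auto
    fix j l and U :: "(real^'d) set"
    assume j: "j \<in> J" and lK: "l < K" and U: "subspace U" "CARD('d) < dim U + K"
    let ?s = "real (j * K + l) / real n" and ?t = "real (Suc (j * K + l)) / real n"
    have "real (j * K) / real n \<le> ?s" by (simp add: divide_right_mono)
    then have as: "a \<le> ?s" using J_in(1)[OF j] by linarith
    have "?t \<le> real (j * K + K) / real n" using lK by (intro divide_right_mono of_nat_mono) auto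
    then have tb: "?t \<le> b" using J_in(2)[OF j] by linarith
    have st: "?t - ?s = 1 / real n" by (simp add: diff_divide_distrib[symmetric])
    then have st': "?s < ?t" using n(1) by (smt (verit) divide_pos_pos of_nat_0_less_iff)
    have sub: "x \<in> {a..b}" if "x \<in> {?s<..?t}" for x using that as tb by (auto simp del: of_nat_Suc)
    have \<sigma>: "set_borel_measurable lborel {0..1} \<sigma>X"
      using model by (simp add: diffusion_model_def ito_differential_def square_integrable_def)
    obtain u where u: "u \<in> U" "norm u = 1" "ennreal (\<mu> * (?t - ?s) / (2 * ?d)) \<le> quad_var \<sigma>X {?s<..?t} u"
    proof (rule quad_var_direction[OF \<sigma> refl _ _ _ _ _ l st' K(2,3) U])
      show "0 \<le> ?s" "?s \<le> ?t" "?t \<le> 1" using st' tb ab by auto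
      show "transpose (?S x) = ?S x" if "x \<in> {?s<..?t}" for x
        using psd[of x] sub[OF that] ab by (auto simp: psd_def)
      show "\<mu> \<le> eigval K (?S x)" if "x \<in> {?s<..?t}" for x by (rule eig[OF sub[OF that]])
    qed
    moreover have "\<mu> * (?t - ?s) / (2 * ?d) = \<gamma>" unfolding st by (simp add: \<gamma>_def)
    ultimately show "\<exists>u\<in>U. norm u = 1 \<and> ennreal \<gamma> \<le> quad_var \<sigma>X {?s<..?t} u" by metis
  qed
  also have "\<dots> \<le> exp (- (real n * hbar / (4 * real K)))"
  proof -
    have "real n * hbar \<le> real n * (b - a)" using ab(3) by (intro mult_left_mono) auto
    then have "real n * hbar / (2 * real K) \<le> real n * (b - a) / (2 * real K)" by (rule divide_right_mono) simp
    then have "real n * hbar / (2 * real K) \<le> real (card J)" using J_card by (rule order_trans)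
    moreover have "real n * hbar / (4 * real K) = real n * hbar / (2 * real K) / 2" by simp
    ultimately have "real n * hbar / (4 * real K) \<le> real (card J) / 2" by linarith
    then show ?thesis by simp
  qed
  finally show ?thesis .
qed

text \<open>The common part of both null hypotheses: \<open>g\<close> is the identity in the basic
  case and the square divided by the gap in the other, while \<open>W\<close> is the rate aimed
  at.\<close>

lemma rank_statistic_null_aux:
  fixes B :: "real \<Rightarrow> 'a \<Rightarrow> real^'m::finite" and BZ :: "real \<Rightarrow> 'a \<Rightarrow> real^'d::finite" and g :: "real \<Rightarrow> real"
  assumes model: "diffusion_model M B BZ \<sigma>X \<sigma>Z X Z" and n: "1 \<le> n"
    and psd: "\<And>t. t \<in> {0..1} \<Longrightarrow> psd (covariance \<sigma>X t)"
    and rank: "\<And>t. t \<in> {0..1} \<Longrightarrow> rank (covariance \<sigma>X t) \<le> r"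
    and SZ: "Lp_norm 2 (covariance \<sigma>Z) \<le> ennreal \<epsilon>" and e: "0 \<le> \<epsilon>" "\<epsilon> \<le> W" and W: "0 < W"
    and g: "g \<in> borel_measurable borel"
    and quad: "\<And>s t b. s \<in> {0..1} \<Longrightarrow> t \<in> {0..1} \<Longrightarrow> norm b = 1 \<Longrightarrow> covariance \<sigma>X t *v b = 0 \<Longrightarrow>
      b \<bullet> (covariance \<sigma>X s *v b) \<le> g (norm (covariance \<sigma>X s - covariance \<sigma>X t))"
    and c: "0 \<le> c" and DX: "\<And>v. Suc r \<le> n \<Longrightarrow> v \<in> {0..real (Suc r) / real n} \<Longrightarrow>
      (\<integral>\<^sup>+t\<in>{0..1-v}. ennreal (g (norm (covariance \<sigma>X (t + v) - covariance \<sigma>X t))) \<partial>lborel) \<le> ennreal (c * W)"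
  shows "(\<integral>\<^sup>+\<omega>. ennreal (rank_statistic (Suc r) n (sampled_sum n X Z \<omega>)) \<partial>M) \<le>
    ennreal (16 * real (Suc r) * real CARD('d) * (c + 2 * (1 + real CARD('d))) * W)"
proof (cases "Suc r \<le> n")
  case False
  then show ?thesis by (simp add: rank_statistic_def)
next
  case True
  let ?d = "real CARD('d)"
  have \<sigma>Z: "set_borel_measurable lborel {0..1} \<sigma>Z"
    using model by (simp add: diffusion_model_def ito_differential_def square_integrable_def)
  have "(\<integral>\<^sup>+\<omega>. ennreal (rank_statistic (Suc r) n (sampled_sum n X Z \<omega>)) \<partial>M) \<le>
      ennreal (16 * real (Suc r) * ?d) * (ennreal (c * W) + 2 * ennreal ((1 + ?d) * W))"
  proof (rule rank_statistic_expectation_le[OF model n zero_less_Suc _ _ g quad])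
    show "transpose (covariance \<sigma>X t) = covariance \<sigma>X t" if "t \<in> {0..1}" for t
      using psd[OF that] by (simp add: psd_def)
    show "rank (covariance \<sigma>X t) < Suc r" if "t \<in> {0..1}" for t using rank[OF that] by simp
    show "(\<integral>\<^sup>+t\<in>{0..1}. ennreal (norm (covariance \<sigma>Z t)) \<partial>lborel) \<le> ennreal ((1 + ?d) * W)"
      by (rule covariance_norm_le[OF \<sigma>Z SZ e W])
  qed (use DX True in auto)
  also have "2 * ennreal ((1 + ?d) * W) = ennreal (2 * ((1 + ?d) * W))"
    using ennreal_mult'[of 2 "(1 + ?d) * W"] by simp
  also have "ennreal (c * W) + ennreal (2 * ((1 + ?d) * W)) = ennreal (c * W + 2 * ((1 + ?d) * W))"
    using c W by (intro ennreal_plus[symmetric]) auto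
  also have "ennreal (16 * real (Suc r) * ?d) * ennreal (c * W + 2 * ((1 + ?d) * W)) =
      ennreal (16 * real (Suc r) * ?d * (c * W + 2 * ((1 + ?d) * W)))"
    by (intro ennreal_mult'[symmetric]) simp
  also have "16 * real (Suc r) * ?d * (c * W + 2 * ((1 + ?d) * W)) = 16 * real (Suc r) * ?d * (c + 2 * (1 + ?d)) * W"
    by (simp only: distrib_left distrib_right ac_simps)
  finally show ?thesis .
qed

lemma rank_statistic_null:
  fixes B :: "real \<Rightarrow> 'a \<Rightarrow> real^'m::finite" and BZ :: "real \<Rightarrow> 'a \<Rightarrow> real^'d::finite"
  assumes model: "diffusion_model M B BZ \<sigma>X \<sigma>Z X Z" and n: "1 \<le> n"
    and psd: "\<And>t. t \<in> {0..1} \<Longrightarrow> psd (covariance \<sigma>X t)"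
    and rank: "\<And>t. t \<in> {0..1} \<Longrightarrow> rank (covariance \<sigma>X t) \<le> r"
    and SZ: "Lp_norm 2 (covariance \<sigma>Z) \<le> ennreal \<epsilon>" and e: "0 \<le> \<epsilon>"
    and p: "p = 2 \<or> p = 4" and SX: "besov_seminorm p \<beta> (covariance \<sigma>X) \<le> ennreal L"
    and L: "0 < L" and \<beta>: "0 < \<beta>" "\<beta> < 1"
  shows rank_statistic_null_basic:
      "(\<integral>\<^sup>+\<omega>. ennreal (rank_statistic (Suc r) n (sampled_sum n X Z \<omega>)) \<partial>M) \<le>
        ennreal (null_constant CARD('d) r * (L * real n powr (- \<beta>) + \<epsilon>))"
    and rank_statistic_null_gap:
      "\<And>lam. 1 \<le> r \<Longrightarrow> r < CARD('d) \<Longrightarrow> 0 < lam \<Longrightarrow> (\<And>t. t \<in> {0..1} \<Longrightarrow> lam \<le> eigval r (covariance \<sigma>X t)) \<Longrightarrow>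
        (\<integral>\<^sup>+\<omega>. ennreal (rank_statistic (Suc r) n (sampled_sum n X Z \<omega>)) \<partial>M) \<le>
        ennreal (null_constant CARD('d) r * (inverse lam * L\<^sup>2 * real n powr (- 2 * \<beta>) + \<epsilon>))"
proof -
  let ?d = "real CARD('d)" and ?K = "real (Suc r)"
  define P where "P = L * real n powr (- \<beta>)"
  have P: "0 < P" using L n by (simp add: P_def)
  have \<sigma>X: "set_borel_measurable lborel {0..1} \<sigma>X"
    using model by (simp add: diffusion_model_def ito_differential_def square_integrable_def)
  \<comment> \<open>The lag of a block is \<open>K / n\<close>, the rate is stated at
    \<open>1 / n\<close>; since \<open>\<beta> < 1\<close>, the difference is at most a factor
    \<open>K\<close>.\<close>
  have w: "L * (?K / real n) powr \<beta> \<le> ?K * P"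
  proof -
    have "?K powr \<beta> \<le> ?K powr 1" using \<beta> by (intro powr_mono) auto
    then have "?K powr \<beta> \<le> ?K" by simp
    then have "L * real n powr (- \<beta>) * ?K powr \<beta> \<le> L * real n powr (- \<beta>) * ?K"
      using L by (intro mult_left_mono) auto
    moreover have "(?K / real n) powr \<beta> = ?K powr \<beta> * real n powr (- \<beta>)"
      unfolding powr_divide powr_minus by (rule divide_inverse)
    ultimately show ?thesis by (simp add: P_def mult_ac del: of_nat_Suc)
  qed
  have w0: "0 \<le> L * (?K / real n) powr \<beta>" using L by simp
  have h: "0 < ?K / real n" "?K / real n \<le> 1" if "Suc r \<le> n" using that n by (auto simp: divide_le_eq)
  \<comment> \<open>\<open>null_constant\<close> carries the square of \<open>K\<close> that the
    squared increments need; this inequality lets the basic case share it.\<close>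
  have K1: "?K \<le> ?K\<^sup>2" by (simp add: power2_eq_square del: of_nat_Suc)
  show "(\<integral>\<^sup>+\<omega>. ennreal (rank_statistic (Suc r) n (sampled_sum n X Z \<omega>)) \<partial>M) \<le>
        ennreal (null_constant CARD('d) r * (L * real n powr (- \<beta>) + \<epsilon>))"
    unfolding null_constant_def P_def[symmetric]
  proof (rule rank_statistic_null_aux[OF model n psd rank SZ e, where g="\<lambda>x. x"])
    show "\<epsilon> \<le> P + \<epsilon>" "0 < P + \<epsilon>" using P e by auto
    show "b \<bullet> (covariance \<sigma>X s *v b) \<le> norm (covariance \<sigma>X s - covariance \<sigma>X t)"
      if "norm b = 1" "covariance \<sigma>X t *v b = 0" for s t b
      by (rule quadratic_form_diff_le(2)[OF that])
    fix v assume nr: "Suc r \<le> n" and v: "v \<in> {0..?K / real n}"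
    have "(\<integral>\<^sup>+t\<in>{0..1-v}. ennreal (norm (covariance \<sigma>X (t + v) - covariance \<sigma>X t)) \<partial>lborel) \<le>
        ennreal ((2 + ?d\<^sup>2) * (L * (?K / real n) powr \<beta>))"
      by (rule covariance_increment_le[OF \<sigma>X p SX L h[OF nr] v])
    also have "\<dots> \<le> ennreal ((2 + ?d\<^sup>2) * ?K\<^sup>2 * (P + \<epsilon>))"
    proof (rule ennreal_leI)
      have "?K * P \<le> ?K\<^sup>2 * (P + \<epsilon>)" using K1 P e by (intro mult_mono) auto
      then have "(2 + ?d\<^sup>2) * (L * (?K / real n) powr \<beta>) \<le> (2 + ?d\<^sup>2) * (?K\<^sup>2 * (P + \<epsilon>))"
        using w by (intro mult_left_mono) auto
      then show "(2 + ?d\<^sup>2) * (L * (?K / real n) powr \<beta>) \<le> (2 + ?d\<^sup>2) * ?K\<^sup>2 * (P + \<epsilon>)"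
        by (simp only: mult.assoc)
    qed
    finally show "(\<integral>\<^sup>+t\<in>{0..1-v}. ennreal (norm (covariance \<sigma>X (t + v) - covariance \<sigma>X t)) \<partial>lborel) \<le>
        ennreal ((2 + ?d\<^sup>2) * ?K\<^sup>2 * (P + \<epsilon>))" .
  qed (auto simp: e)
  fix lam :: real
  assume r: "1 \<le> r" "r < CARD('d)" and lam: "0 < lam" and gap: "\<And>t. t \<in> {0..1} \<Longrightarrow> lam \<le> eigval r (covariance \<sigma>X t)"
  define Q where "Q = inverse lam * L\<^sup>2 * real n powr (- 2 * \<beta>)"
  \<comment> \<open>The gap rate is the squared basic rate divided by the gap, matching
    \<open>g\<close> below.\<close>
  have Q_eq: "Q = P\<^sup>2 / lam"
    using n by (simp add: Q_def P_def power_mult_distrib powr_power divide_inverse mult_ac)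
  have Q: "0 < Q" using P lam by (simp add: Q_eq)
  show "(\<integral>\<^sup>+\<omega>. ennreal (rank_statistic (Suc r) n (sampled_sum n X Z \<omega>)) \<partial>M) \<le>
        ennreal (null_constant CARD('d) r * (inverse lam * L\<^sup>2 * real n powr (- 2 * \<beta>) + \<epsilon>))"
    unfolding null_constant_def Q_def[symmetric]
  proof (rule rank_statistic_null_aux[OF model n psd rank SZ e, where g="\<lambda>x. x\<^sup>2 / lam"])
    show "\<epsilon> \<le> Q + \<epsilon>" "0 < Q + \<epsilon>" using Q e by auto
    show "b \<bullet> (covariance \<sigma>X s *v b) \<le> (norm (covariance \<sigma>X s - covariance \<sigma>X t))\<^sup>2 / lam"
      if s: "s \<in> {0..1}" and b: "norm b = 1" "covariance \<sigma>X t *v b = 0" for s t b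
    proof -
      have "lam * (b \<bullet> (covariance \<sigma>X s *v b)) \<le> (norm (covariance \<sigma>X s *v b))\<^sup>2"
        using r by (intro quadratic_form_le_spectral_gap[OF psd[OF s] _ _ rank[OF s] lam gap[OF s]]) auto
      also have "\<dots> \<le> (norm (covariance \<sigma>X s - covariance \<sigma>X t))\<^sup>2"
        by (intro power_mono quadratic_form_diff_le(1)[OF b]) simp
      finally show ?thesis using lam by (simp add: le_divide_eq mult.commute)
    qed
    fix v assume nr: "Suc r \<le> n" and v: "v \<in> {0..?K / real n}"
    let ?f = "\<lambda>t. norm (covariance \<sigma>X (t + v) - covariance \<sigma>X t)"
    have v0: "0 \<le> v" using v by simp
    obtain f where f: "f \<in> borel_measurable lborel" "\<And>t. t \<in> {0..1-v} \<Longrightarrow> 0 \<le> v \<Longrightarrow> f t = ?f t"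
      using covariance_increment_measurable[OF \<sigma>X, of v] by blast
    have sq: "(\<integral>\<^sup>+t\<in>{0..1-v}. ennreal ((f t)\<^sup>2) \<partial>lborel) = (\<integral>\<^sup>+t\<in>{0..1-v}. ennreal ((?f t)\<^sup>2) \<partial>lborel)"
      "(\<integral>\<^sup>+t\<in>{0..1-v}. ennreal ((?f t)\<^sup>2 / lam) \<partial>lborel) = (\<integral>\<^sup>+t\<in>{0..1-v}. ennreal ((f t)\<^sup>2 / lam) \<partial>lborel)"
      using v0 by (intro nn_integral_cong; auto simp: f(2) indicator_def)+
    have "(\<integral>\<^sup>+t\<in>{0..1-v}. ennreal ((f t)\<^sup>2 / lam) \<partial>lborel) \<le>
        ennreal (inverse lam * ((1 + ?d\<^sup>2) * (L * (?K / real n) powr \<beta>)\<^sup>2))"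
    proof (rule nn_integral_scale_le)
      have "ennreal ((f t)\<^sup>2 / lam / inverse lam) = ennreal ((f t)\<^sup>2)" for t using lam by simp
      then show "(\<integral>\<^sup>+t\<in>{0..1-v}. ennreal ((f t)\<^sup>2 / lam / inverse lam) \<partial>lborel) \<le>
          ennreal ((1 + ?d\<^sup>2) * (L * (?K / real n) powr \<beta>)\<^sup>2)"
        using covariance_increment_sq_le[OF \<sigma>X p SX L h[OF nr] v] by (simp only: sq(1))
    qed (use f(1) lam in auto)
    also have "\<dots> \<le> ennreal ((2 + ?d\<^sup>2) * ?K\<^sup>2 * (Q + \<epsilon>))"
    proof (rule ennreal_leI)
      have "(L * (?K / real n) powr \<beta>)\<^sup>2 \<le> (?K * P)\<^sup>2" using w w0 by (intro power_mono) auto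
      then have "(1 + ?d\<^sup>2) * (L * (?K / real n) powr \<beta>)\<^sup>2 \<le> (2 + ?d\<^sup>2) * (?K * P)\<^sup>2"
        by (intro mult_mono) auto
      then have "inverse lam * ((1 + ?d\<^sup>2) * (L * (?K / real n) powr \<beta>)\<^sup>2) \<le> inverse lam * ((2 + ?d\<^sup>2) * (?K * P)\<^sup>2)"
        using lam by (intro mult_left_mono) auto
      also have "\<dots> = (2 + ?d\<^sup>2) * ?K\<^sup>2 * Q"
        by (simp add: Q_eq power_mult_distrib divide_inverse mult_ac del: of_nat_Suc)
      also have "\<dots> \<le> (2 + ?d\<^sup>2) * ?K\<^sup>2 * (Q + \<epsilon>)" using e by (intro mult_left_mono) auto
      finally show "inverse lam * ((1 + ?d\<^sup>2) * (L * (?K / real n) powr \<beta>)\<^sup>2) \<le> (2 + ?d\<^sup>2) * ?K\<^sup>2 * (Q + \<epsilon>)" .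
    qed
    finally show "(\<integral>\<^sup>+t\<in>{0..1-v}. ennreal ((?f t)\<^sup>2 / lam) \<partial>lborel) \<le> ennreal ((2 + ?d\<^sup>2) * ?K\<^sup>2 * (Q + \<epsilon>))"
      by (simp only: sq(2))
  qed (auto simp: e)
qed

end

section \<open>The tests\<close>

lemma rank_statistic_cong:
  assumes "\<And>i. i \<le> n \<Longrightarrow> x i = y i" "0 < K"
  shows "rank_statistic K n x = rank_statistic K n y"
  unfolding rank_statistic_def degeneracy_def
proof (intro sum.cong refl INF_cong arg_cong[where f="\<lambda>v. (norm v)\<^sup>2"])
  fix j c l assume "j \<in> {..<n div K}" "l \<in> {..<K}"
  then have "j * K + l < n" using block_index_less by simp
  then show "c l *\<^sub>R (x (Suc (j * K + l)) - x (j * K + l)) = c l *\<^sub>R (y (Suc (j * K + l)) - y (j * K + l))"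
    using assms(1) by simp
qed

lemma rank_statistic_obs:
  "0 < K \<Longrightarrow> rank_statistic K n (obs n Y \<omega>) = rank_statistic K n (\<lambda>i. Y (real i / real n) \<omega>)"
  by (rule rank_statistic_cong) (auto simp: obs_def)

lemma experiment_rank_statistic_measurable:
  fixes Y :: "real \<Rightarrow> 'w \<Rightarrow> real^'d::finite"
  assumes "(M, Y) \<in> experiments TYPE('m::finite) N" "0 < K" "1 \<le> n"
  shows "prob_space M" "(\<lambda>\<omega>. rank_statistic K n (\<lambda>i. Y (real i / real n) \<omega>)) \<in> borel_measurable M"
proof -
  obtain B :: "real \<Rightarrow> 'w \<Rightarrow> real^'m" and BZ \<sigma>X \<sigma>Z X Z where
    m: "diffusion_model M B BZ \<sigma>X \<sigma>Z X Z" and Y: "Y = (\<lambda>t \<omega>. X t \<omega> + Z t \<omega>)"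
    using assms(1) unfolding experiments_def by blast
  show "prob_space M" using m by (simp add: diffusion_model_def)
  show "(\<lambda>\<omega>. rank_statistic K n (\<lambda>i. Y (real i / real n) \<omega>)) \<in> borel_measurable M"
    using m assms(2,3) unfolding Y
    by (intro borel_measurable_rank_statistic borel_measurable_add)
      (auto simp: diffusion_model_def ito_differential_def)
qed

text \<open>Markov's inequality calibrates the test, so its critical value is \<open>1 / \<alpha>\<close> times a bound for
  the expectation of the statistic under the null hypothesis.\<close>

lemma tests_from_expectation_bound:
  fixes N :: "nat \<Rightarrow> ((real \<Rightarrow> real^'d::finite^'d) \<times> (real \<Rightarrow> real^'d^'d)) set" and W hbar :: "nat \<Rightarrow> real"
  assumes \<alpha>: "0 < \<alpha>" and r: "r < CARD('d)" and W: "\<And>n. 1 \<le> n \<Longrightarrow> 0 < W n" and C0: "0 < C0"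
    and hbar: "\<And>n. 0 < hbar n \<and> hbar n < 1" and nh: "filterlim (\<lambda>n. real n * hbar n) at_top sequentially"
    and null: "\<And>n (M :: 'w measure) Y. 1 \<le> n \<Longrightarrow> (M, Y) \<in> experiments TYPE('m::finite) (N n) \<Longrightarrow>
      (\<integral>\<^sup>+\<omega>. ennreal (rank_statistic (Suc r) n (\<lambda>i. Y (real i / real n) \<omega>)) \<partial>M) \<le> ennreal (C0 * W n)"
  shows "\<exists>C>0. \<exists>\<phi> :: nat \<Rightarrow> (nat \<Rightarrow> real^'d) \<Rightarrow> real.
    (\<forall>n\<ge>1. is_test n (\<phi> n)) \<and>
    uniform_level \<alpha> \<phi> (\<lambda>n. experiments TYPE('m) (N n) :: ('w measure \<times> (real \<Rightarrow> 'w \<Rightarrow> real^'d)) set) \<and>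
    uniformly_consistent \<phi> (\<lambda>n. experiments TYPE('m) (H1 r (hbar n) (C * W n) \<times> UNIV)
      :: ('w measure \<times> (real \<Rightarrow> 'w \<Rightarrow> real^'d)) set)"
proof -
  define K where "K = Suc r"
  have K: "0 < K" by (simp add: K_def)
  define \<kappa> where "\<kappa> n = C0 * W n / \<alpha>" for n
  have \<kappa>: "0 < \<kappa> n" if "1 \<le> n" for n using W[OF that] C0 \<alpha> by (simp add: \<kappa>_def)
  define c where "c = 3200 * real CARD('d) * real K ^ 3"
  have c: "0 < c" using K by (simp add: c_def)
  \<comment> \<open>The alternative requires \<open>c * \<kappa> n < C * W n\<close>, and
    \<open>c * \<kappa> n\<close> is \<open>c * C0 / \<alpha>\<close> times \<open>W n\<close>; the
    factor 2 makes the inequality strict.\<close>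
  define C where "C = 2 * c * C0 / \<alpha>"
  have C: "0 < C" using c C0 \<alpha> by (simp add: C_def)
  define \<phi> where "\<phi> n y = (if \<kappa> n < rank_statistic K n y then 1 else 0 :: real)" for n and y :: "nat \<Rightarrow> real^'d"
  have \<phi>_event: "{\<omega>\<in>space M. \<phi> n (obs n Y \<omega>) = 1} =
      {\<omega>\<in>space M. \<kappa> n < rank_statistic K n (\<lambda>i. Y (real i / real n) \<omega>)}"
    for n and M :: "'w measure" and Y :: "real \<Rightarrow> 'w \<Rightarrow> real^'d"
    using K by (auto simp: \<phi>_def rank_statistic_obs)
  have test: "is_test n (\<phi> n)" for n
  proof -
    have "(\<lambda>y. rank_statistic K n y) \<in> borel_measurable (PiM {0..n} (\<lambda>_. borel :: (real^'d) measure))"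
      by (intro borel_measurable_rank_statistic[OF K] measurable_component_singleton) simp
    then have "\<phi> n \<in> borel_measurable (PiM {0..n} (\<lambda>_. borel))"
      unfolding \<phi>_def[abs_def] by measurable
    then show ?thesis by (simp add: is_test_def \<phi>_def)
  qed
  have level: "measure M {\<omega>\<in>space M. \<phi> n (obs n Y \<omega>) = 1} \<le> \<alpha>"
    if n: "1 \<le> n" and E: "(M, Y) \<in> experiments TYPE('m) (N n)" for n and M :: "'w measure" and Y
  proof -
    interpret prob_space M by (rule experiment_rank_statistic_measurable(1)[OF E K n])
    let ?T = "\<lambda>\<omega>. rank_statistic K n (\<lambda>i. Y (real i / real n) \<omega>)"
    have T [measurable]: "?T \<in> borel_measurable M" by (rule experiment_rank_statistic_measurable(2)[OF E K n])
    have "emeasure M {\<omega>\<in>space M. \<kappa> n < ?T \<omega>} \<le> emeasure M {\<omega>\<in>space M. 1 \<le> ennreal (1 / \<kappa> n) * ennreal (?T \<omega>)}"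
    proof (rule emeasure_mono)
      have "1 \<le> ennreal (1 / \<kappa> n) * ennreal (?T \<omega>)" if "\<kappa> n < ?T \<omega>" for \<omega>
        using that \<kappa>[OF n] by (simp add: ennreal_mult[symmetric] le_divide_eq)
      then show "{\<omega>\<in>space M. \<kappa> n < ?T \<omega>} \<subseteq> {\<omega>\<in>space M. 1 \<le> ennreal (1 / \<kappa> n) * ennreal (?T \<omega>)}" by blast
    qed measurable
    also have "\<dots> \<le> ennreal (1 / \<kappa> n) * (\<integral>\<^sup>+\<omega>. ennreal (?T \<omega>) * indicator (space M) \<omega> \<partial>M)"
      by (rule nn_integral_Markov_inequality)
        (intro borel_measurable_times_ennreal measurable_compose[OF T measurable_ennreal]
          borel_measurable_indicator sets.top)+
    also have "(\<integral>\<^sup>+\<omega>. ennreal (?T \<omega>) * indicator (space M) \<omega> \<partial>M) = (\<integral>\<^sup>+\<omega>. ennreal (?T \<omega>) \<partial>M)"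
      by (intro nn_integral_cong) simp
    also have "ennreal (1 / \<kappa> n) * \<dots> \<le> ennreal (1 / \<kappa> n) * ennreal (C0 * W n)"
      using null[OF n E] by (intro mult_left_mono) (simp_all add: K_def)
    also have "\<dots> = ennreal \<alpha>"
      using \<kappa>[OF n] C0 W[OF n] \<alpha> by (simp add: ennreal_mult[symmetric] \<kappa>_def)
    finally show ?thesis using \<alpha> unfolding \<phi>_event by (simp add: emeasure_eq_measure)
  qed
  let ?E = "\<lambda>n. experiments TYPE('m) (H1 r (hbar n) (C * W n) \<times> UNIV) :: ('w measure \<times> (real \<Rightarrow> 'w \<Rightarrow> real^'d)) set"
  have power: "1 - exp (- (real n * hbar n / (4 * real K))) \<le> measure M {\<omega>\<in>space M. \<phi> n (obs n Y \<omega>) = 1}"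
    if n: "1 \<le> n" and large: "4 * real K \<le> real n * hbar n" and E: "(M, Y) \<in> ?E n" for n M Y
  proof -
    interpret prob_space M by (rule experiment_rank_statistic_measurable(1)[OF E K n])
    let ?T = "\<lambda>\<omega>. rank_statistic K n (\<lambda>i. Y (real i / real n) \<omega>)"
    have T [measurable]: "?T \<in> borel_measurable M" by (rule experiment_rank_statistic_measurable(2)[OF E K n])
    obtain B :: "real \<Rightarrow> 'w \<Rightarrow> real^'m" and BZ \<sigma>X \<sigma>Z X Z where
      m: "diffusion_model M B BZ \<sigma>X \<sigma>Z X Z" and Y: "Y = (\<lambda>t \<omega>. X t \<omega> + Z t \<omega>)"
      and H1: "covariance \<sigma>X \<in> H1 r (hbar n) (C * W n)"
      using E unfolding experiments_def by blast
    have "c * \<kappa> n < C * W n"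
      using c C0 W[OF n] \<alpha> by (simp add: C_def \<kappa>_def field_simps)
    then have "prob {\<omega>\<in>space M. ?T \<omega> \<le> \<kappa> n} \<le> exp (- (real n * hbar n / (4 * real K)))"
      unfolding Y K_def c_def
      using hbar[of n] C W[OF n] large by (intro rank_statistic_alternative[OF m r H1]) (auto simp: K_def)
    moreover have "prob {\<omega>\<in>space M. \<kappa> n < ?T \<omega>} = 1 - prob {\<omega>\<in>space M. ?T \<omega> \<le> \<kappa> n}"
    proof -
      have "{\<omega>\<in>space M. \<kappa> n < ?T \<omega>} = space M - {\<omega>\<in>space M. ?T \<omega> \<le> \<kappa> n}" by auto
      moreover have "{\<omega>\<in>space M. ?T \<omega> \<le> \<kappa> n} \<in> events" by measurable
      ultimately show ?thesis using prob_compl by simp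
    qed
    ultimately show ?thesis unfolding \<phi>_event by linarith
  qed
  have "(\<lambda>n. Inf (insert 1 (rejection_probs n (\<phi> n) (?E n)))) \<longlonglongrightarrow> 1"
  proof (rule tendsto_sandwich)
    have large: "\<forall>\<^sub>F n in sequentially. 4 * real K \<le> real n * hbar n"
      using nh by (simp add: filterlim_at_top)
    show "\<forall>\<^sub>F n in sequentially. 1 - exp (- (real n * hbar n / (4 * real K))) \<le>
        Inf (insert 1 (rejection_probs n (\<phi> n) (?E n)))"
      using large eventually_ge_at_top[of 1]
    proof eventually_elim
      case (elim n)
      show ?case
      proof (rule cInf_greatest)
        fix p assume "p \<in> insert 1 (rejection_probs n (\<phi> n) (?E n))"
        then show "1 - exp (- (real n * hbar n / (4 * real K))) \<le> p"
          using power[OF elim(2,1)] by (auto simp: rejection_probs_def)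
      qed simp
    qed
    have "Inf (insert 1 (rejection_probs n (\<phi> n) (?E n))) \<le> 1" for n
      by (intro cInf_lower bdd_belowI[of _ 0]) (auto simp: rejection_probs_def)
    then show "\<forall>\<^sub>F n in sequentially. Inf (insert 1 (rejection_probs n (\<phi> n) (?E n))) \<le> 1" by simp
    have "filterlim (\<lambda>n. real n * hbar n / (4 * real K)) at_top sequentially"
      using K by (intro filterlim_tendsto_pos_mult_at_top[OF tendsto_const _ nh, of "1 / (4 * real K)", simplified]) simp
    then have "(\<lambda>n. exp (- (real n * hbar n / (4 * real K)))) \<longlonglongrightarrow> 0"
      by (intro filterlim_compose[OF exp_at_bot] filterlim_compose[OF filterlim_uminus_at_bot_at_top])
    then have "(\<lambda>n. 1 - exp (- (real n * hbar n / (4 * real K)))) \<longlonglongrightarrow> 1 - 0"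
      by (intro tendsto_diff tendsto_const)
    then show "(\<lambda>n. 1 - exp (- (real n * hbar n / (4 * real K)))) \<longlonglongrightarrow> 1" by simp
  qed simp
  then have "uniformly_consistent \<phi> ?E" by (simp add: uniformly_consistent_def)
  moreover have "uniform_level \<alpha> \<phi> (\<lambda>n. experiments TYPE('m) (N n) :: ('w measure \<times> (real \<Rightarrow> 'w \<Rightarrow> real^'d)) set)"
    unfolding uniform_level_def rejection_probs_def using level by blast
  ultimately show ?thesis using C test by blast
qed

text \<open>A supremum of natural numbers dominates its members only for bounded sets; the rank is
  bounded by the dimension.\<close>

lemma rank_le_SUP_rank: "t \<in> {0..1} \<Longrightarrow> rank (S t) \<le> (SUP t\<in>{0..1::real}. rank (S t))"
  for S :: "real \<Rightarrow> real^'d^'d"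
  using rank_bound by (intro cSUP_upper bdd_aboveI2[of _ _ "CARD('d)"]) auto

text \<open>Both parts use the same statistic and differ only in its critical value. The constant
  found depends on \<open>\<alpha>\<close>, \<open>r\<close> and the dimension alone. The factor
  \<open>UNIV\<close> leaves \<open>\<Sigma>\<^sub>Z\<close> unrestricted under the
  alternative.\<close>

theorem corollary3p7:
  fixes \<alpha> \<beta> L :: real and r :: nat and \<epsilon> lam hbar :: "nat \<Rightarrow> real"
  assumes "0 < \<alpha>" "\<alpha> < 1"
    and "r < CARD('d::finite)"
    and "0 < \<beta>" "\<beta> < 1"
    and "0 < L"
    and "\<And>n. 0 \<le> \<epsilon> n"
    and "\<And>n. 0 < lam n"
    and "\<And>n. 0 < hbar n \<and> hbar n < 1"
    and "filterlim (\<lambda>n. real n * hbar n) at_top sequentially"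
  shows
    "(\<exists>C>0. \<exists>\<phi> :: nat \<Rightarrow> (nat \<Rightarrow> real^'d) \<Rightarrow> real.
        (\<forall>n\<ge>1. is_test n (\<phi> n)) \<and>
        uniform_level \<alpha> \<phi>
          (\<lambda>n. experiments TYPE('m::finite) (H0 r \<beta> L (\<epsilon> n))
             :: ('w measure \<times> (real \<Rightarrow> 'w \<Rightarrow> real^'d)) set) \<and>
        uniformly_consistent \<phi>
          (\<lambda>n. experiments TYPE('m)
             (H1 r (hbar n) (C * (L * real n powr (- \<beta>) + \<epsilon> n)) \<times> UNIV)
             :: ('w measure \<times> (real \<Rightarrow> 'w \<Rightarrow> real^'d)) set)) \<and>
     (1 \<le> r \<longrightarrow>
      (\<exists>C>0. \<exists>\<phi> :: nat \<Rightarrow> (nat \<Rightarrow> real^'d) \<Rightarrow> real.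
        (\<forall>n\<ge>1. is_test n (\<phi> n)) \<and>
        uniform_level \<alpha> \<phi>
          (\<lambda>n. experiments TYPE('m) (H0_gap r \<beta> L (\<epsilon> n) (lam n))
             :: ('w measure \<times> (real \<Rightarrow> 'w \<Rightarrow> real^'d)) set) \<and>
        uniformly_consistent \<phi>
          (\<lambda>n. experiments TYPE('m)
             (H1 r (hbar n)
                (C * min (L * real n powr (- \<beta>) + \<epsilon> n)
                         (inverse (lam n) * L\<^sup>2 * real n powr (- 2 * \<beta>) + \<epsilon> n)) \<times> UNIV)
             :: ('w measure \<times> (real \<Rightarrow> 'w \<Rightarrow> real^'d)) set)))"
  proof -
  define W1 where "W1 n = L * real n powr (- \<beta>) + \<epsilon> n" for n
  define W2 where "W2 n = inverse (lam n) * L\<^sup>2 * real n powr (- 2 * \<beta>) + \<epsilon> n" for n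
  have C0: "0 < null_constant CARD('d) r"
    unfolding null_constant_def by (intro mult_pos_pos add_nonneg_pos) auto
  \<comment> \<open>At \<open>n = 0\<close> the power of zero is zero by convention and the rate may
    vanish, hence the restriction to \<open>n \<ge> 1\<close>.\<close>
  have W1: "0 < W1 n" and W2: "0 < W2 n" if "1 \<le> n" for n
    using that assms(6) assms(7)[of n] assms(8)[of n] by (auto simp: W1_def W2_def intro!: add_pos_nonneg)
  have basic: "(\<integral>\<^sup>+\<omega>. ennreal (rank_statistic (Suc r) n (\<lambda>i. Y (real i / real n) \<omega>)) \<partial>M) \<le> ennreal (null_constant CARD('d) r * W1 n)"
    if n: "1 \<le> n" and E: "(M, Y) \<in> experiments TYPE('m) (H0 r \<beta> L (\<epsilon> n))"
    for n and M :: "'w measure" and Y :: "real \<Rightarrow> 'w \<Rightarrow> real^'d"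
  proof -
    obtain B :: "real \<Rightarrow> 'w \<Rightarrow> real^'m" and BZ \<sigma>X \<sigma>Z X Z where
      m: "diffusion_model M B BZ \<sigma>X \<sigma>Z X Z" and H: "(covariance \<sigma>X, covariance \<sigma>Z) \<in> H0 r \<beta> L (\<epsilon> n)"
      and Y: "Y = (\<lambda>t \<omega>. X t \<omega> + Z t \<omega>)"
      using E unfolding experiments_def by blast
    interpret prob_space M using m by (simp add: diffusion_model_def)
    have psd: "psd (covariance \<sigma>X t)" if "t \<in> {0..1}" for t
      using H that by (simp add: H0_def)
    have rank: "rank (covariance \<sigma>X t) \<le> r" if "t \<in> {0..1}" for t
      using order_trans[OF rank_le_SUP_rank[OF that, of "covariance \<sigma>X"]] H by (simp add: H0_def)
    show ?thesis
      unfolding Y W1_def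
      by (rule rank_statistic_null_basic[OF m n psd rank _ _ disjI1[OF refl] _ assms(6,4,5)])
        (use H assms(7) in \<open>auto simp: H0_def\<close>)
  qed
  have gap: "(\<integral>\<^sup>+\<omega>. ennreal (rank_statistic (Suc r) n (\<lambda>i. Y (real i / real n) \<omega>)) \<partial>M) \<le>
      ennreal (null_constant CARD('d) r * min (W1 n) (W2 n))"
    if r: "1 \<le> r" and n: "1 \<le> n" and E: "(M, Y) \<in> experiments TYPE('m) (H0_gap r \<beta> L (\<epsilon> n) (lam n))"
    for n and M :: "'w measure" and Y :: "real \<Rightarrow> 'w \<Rightarrow> real^'d"
  proof -
    obtain B :: "real \<Rightarrow> 'w \<Rightarrow> real^'m" and BZ \<sigma>X \<sigma>Z X Z where
      m: "diffusion_model M B BZ \<sigma>X \<sigma>Z X Z" and Y: "Y = (\<lambda>t \<omega>. X t \<omega> + Z t \<omega>)"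
      and H: "(covariance \<sigma>X, covariance \<sigma>Z) \<in> H0_gap r \<beta> L (\<epsilon> n) (lam n)"
      using E unfolding experiments_def by blast
    interpret prob_space M using m by (simp add: diffusion_model_def)
    have psd: "psd (covariance \<sigma>X t)" if "t \<in> {0..1}" for t
      using H that by (simp add: H0_gap_def)
    have rank: "rank (covariance \<sigma>X t) \<le> r" if "t \<in> {0..1}" for t
      using order_trans[OF rank_le_SUP_rank[OF that, of "covariance \<sigma>X"]] H by (simp add: H0_gap_def)
    have SZ: "Lp_norm 2 (covariance \<sigma>Z) \<le> ennreal (\<epsilon> n)"
      and SX: "besov_seminorm 4 \<beta> (covariance \<sigma>X) \<le> ennreal L"
      using H by (simp_all add: H0_gap_def)
    have eig: "lam n \<le> eigval r (covariance \<sigma>X t)" if t: "t \<in> {0..1}" for t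
    proof -
      have "bdd_below ((\<lambda>t. eigval r (covariance \<sigma>X t)) ` {0..1})"
        using r assms(3) by (intro bdd_belowI2[of _ 0] eigval_nonneg psd) auto
      from cINF_lower[OF this t] show ?thesis using H by (simp add: H0_gap_def)
    qed
    \<comment> \<open>A bound on the Besov seminorm with \<open>p = 4\<close> supports the basic
      estimate as well, with the same constant. Both estimates hold at once, so one critical value
      built on the minimum suffices.\<close>
    note hyps = m n psd rank SZ assms(7) disjI2[OF refl] SX assms(6,4,5)
    show ?thesis
      using rank_statistic_null_basic[OF hyps] rank_statistic_null_gap[OF hyps r assms(3,8) eig]
      unfolding Y W1_def W2_def by (simp add: min_def)
  qed
  have W12: "0 < min (W1 n) (W2 n)" if "1 \<le> n" for n using W1[OF that] W2[OF that] by simp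
  show ?thesis
    unfolding W1_def[symmetric] W2_def[symmetric]
    by (intro conjI impI, rule tests_from_expectation_bound[OF assms(1,3) W1 C0 assms(9,10) basic], assumption+,
      rule tests_from_expectation_bound[OF assms(1,3) W12 C0 assms(9,10)], assumption, rule gap)
qed

end
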